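(* For every $n\ge2$ and every $c\ge0$, the group $\hat{\mathcal{G}}'\subset\mathrm{Isom}(\hat N_n^c,g^c)$ is isomorphic to $\mathrm{SU}(1,n-1)\ltimes(\mathrm{Heis}_{2n+1}/\mathcal{F}')$. In particular, the group $\mathrm{SU}(1,n-1)\ltimes(\mathrm{Heis}_{2n+1}/\mathcal{F}')$ acts effectively and isometrically on $(\hat N_n^c,g^c)$.
   Context: Indices: $a,b$ run over $1,\dots,n-1$ and $k,l$ over $0,\dots,n-1$; complex vector fields use $\partial/\partial z,\partial/\partial\bar z$. Metric. $\bar N_n=\{(X,w,\tilde\phi,\rho)\in\mathbb{C}^{n-1}\times\mathbb{C}^n\times\mathbb{R}\times\mathbb{R}_{>0}:\|X\|<1\}$, $X=(X^a)$, $w=(w^k)$, with the complete quaternionic Kähler metric $$\begin{aligned}g^c&=\tfrac{\rho+c}{\rho}\,g_{\mathbb{C}\mathrm{H}^{n-1}}+\tfrac{1}{4\rho^2}\tfrac{\rho+2c}{\rho+c}d\rho^2-\tfrac1\rho\Big(|dw^0|^2-\sum_a|dw^a|^2\Big)+\tfrac{\rho+c}{\rho^2}\tfrac{2}{1-\|X\|^2}\Big|dw^0+\sum_aX^adw^a\Big|^2\\&\quad+\tfrac1{4\rho^2}\tfrac{\rho+c}{\rho+2c}\Big(d\tilde\phi-2\operatorname{Im}\big(\bar w^0dw^0-\sum_a\bar w^adw^a\big)+\tfrac{2c}{1-\|X\|^2}\operatorname{Im}\sum_a\bar X^adX^a\Big)^2,\end{aligned}$$ $g_{\mathbb{C}\mathrm{H}^{n-1}}=\frac1{1-\|X\|^2}\big(\sum_a|dX^a|^2+\frac1{1-\|X\|^2}|\sum_a\bar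 X^adX^a|^2\big)$. Lie algebras. $\mathfrak{u}(1,n-1)$ is the fixed-point set in $\mathfrak{gl}(n,\mathbb{C})$ of $\sigma(A)=-I\bar A^\top I$, $I=\mathrm{diag}(-1,1,\dots,1)$ (indices $0,\dots,n-1$). $\mathfrak{gl}(n,\mathbb{C})$ is generated by $C=i\mathbb{1}_n$, $U_a$ (matrix with single nonzero entry $1$ in row $0$, column $a$) and $U_a^\sigma=\sigma(U_a)$ (entry $1$ in row $a$, column $0$). $\mathfrak{heis}_{2n+1}$ is the real Lie algebra with basis $e_k,f_k,T$ and nonzero brackets $[e_0,f_0]=T$, $[e_a,f_a]=-T$. $A\in\mathfrak{u}(1,n-1)$ acts on it as the derivation with $T\mapsto0$ and $v\mapsto-A^\top v$ on $\mathbb{R}^{2n}=\mathrm{span}(e_k,f_k)\cong\mathbb{C}^n$ ($e_k\leftrightarrow$ standard basis vector, $f_k\leftrightarrow i$ times it), giving $\mathfrak{u}(1,n-1)\ltimes\mathfrak{heis}_{2n+1}$. Put $E_k=e_k-if_k$, $\bar E_k=e_k+if_k$ in the complexification. Infinitesimal action. $\alpha:\mathfrak{u}(1,n-1)\ltimes\mathfrak{heis}_{2n+1}\to\mathfrak{isom}(\bar N_n,g^c)$ is the injective Lie algebra anti-homomorphism into Killing fields whose complex-linear extension sends $C\mapsto Y_C$, $U_a\mapsto Y_a$, $U_a^\sigma\mapsto\bar Y_a$, $E_k\mapsto V_k$, $\bar E_k\mapsto\bar V_k$, $T\mapsto\partial/\partial\tilde\phi$, where $$Y_C=-i\sum_k\Big(w^k\tfrac{\partial}{\partial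 w^k}-\bar w^k\tfrac{\partial}{\partial\bar w^k}\Big)-2c\tfrac{\partial}{\partial\tilde\phi},\quad Y_a=\tfrac{\partial}{\partial\bar X^a}-X^a\sum_bX^b\tfrac{\partial}{\partial X^b}-w^0\tfrac{\partial}{\partial w^a}-\bar w^a\tfrac{\partial}{\partial\bar w^0}+icX^a\tfrac{\partial}{\partial\tilde\phi},$$ $V_0=\frac{\partial}{\partial w^0}+i\bar w^0\frac{\partial}{\partial\tilde\phi}$, $V_a=\frac{\partial}{\partial w^a}-i\bar w^a\frac{\partial}{\partial\tilde\phi}$. Groups. $\widetilde{\mathrm{U}}(1,n-1)$, $\widetilde{\mathrm{SU}}(1,n-1)$, $\mathrm{Heis}_{2n+1}$ are the simply connected Lie groups of the corresponding Lie algebras. By completeness of $g^c$, $\alpha$ integrates to an isometric action, i.e. a homomorphism $\beta:\widetilde{\mathrm{U}}(1,n-1)\ltimes\mathrm{Heis}_{2n+1}\to\mathrm{Isom}(\bar N_n,g^c)$; $\beta'$ is its restriction to $\widetilde{\mathrm{SU}}(1,n-1)\ltimes\mathrm{Heis}_{2n+1}$. Set $\mathcal{H}=\beta(\mathrm{Heis}_{2n+1})$, $\mathcal{U}'=\beta'(\widetilde{\mathrm{SU}}(1,n-1))$, $\mathcal{F}'=\mathcal{U}'\cap\mathcal{H}$, a (trivial for $c=0$, infinite cyclic for $c>0$) subgroup of the center of $\mathcal H$, also viewed as a central subgroup of $\mathrm{Heis}_{2n+1}$ via the isomorphism $\beta:\mathrm{Heis}_{2n+1}\to\mathcal{H}$.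 Put $\hat N_n^c=\bar N_n/\mathcal{F}'$ for $c>0$, $\hat N_n^0=\bar N_n$, with the induced metric, still denoted $g^c$. The action of $\widetilde{\mathrm{SU}}(1,n-1)\ltimes\mathrm{Heis}_{2n+1}$ descends to $\hat\beta':\widetilde{\mathrm{SU}}(1,n-1)\ltimes\mathrm{Heis}_{2n+1}\to\mathrm{Isom}(\hat N_n^c,g^c)$, and $\hat{\mathcal{G}}'$ is the image of $\hat\beta'$. $\mathrm{SU}(1,n-1)$ acts on $\mathrm{Heis}_{2n+1}$ (hence on $\mathrm{Heis}_{2n+1}/\mathcal F'$) by integrating the derivation action above. *)

theory Defs
  imports "HOL-Analysis.Analysis" "HOL-Algebra.Group_Action"
begin

text \<open>
  Throughout, the type variable \<^typ>\<open>'m::finite\<close> is the index set of \<open>a, b = 1, \<dots>, n - 1\<close>,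
  and \<^typ>\<open>'m option\<close> is the index set of \<open>k, l = 0, \<dots>, n - 1\<close>, with \<^term>\<open>None\<close> in the
  role of the index \<open>0\<close>. Thus \<open>n = CARD('m) + 1\<close> ranges over all integers \<open>\<ge> 2\<close>.
\<close>

section \<open>The Riemannian manifold\<close>

text \<open>
  Points are tuples \<open>(X, w, \<phi>, \<rho>)\<close>. The manifold is an open subset of this real vector space,
  which is therefore also its tangent space at every point.
\<close>

type_synonym 'm pt = "(complex^'m) \<times> (complex^('m option)) \<times> real \<times> real"

definition Nbar :: "('m::finite) pt set"
  where "Nbar = {(X, w, \<phi>, \<rho>). norm X < 1 \<and> \<rho> > 0}"

text \<open>
  The metric is written as a symmetric bilinear form on tangent vectors: for a complex valued
  1-form \<open>\<theta>\<close> the square \<open>|\<theta>|\<^sup>2\<close> polarises to \<open>(u, v) \<mapsto> \<theta> u \<bullet> \<theta> v\<close>, where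
  \<open>z \<bullet> z' = Re (z * cnj z')\<close>.
\<close>

definition CH_form :: "complex^'m::finite \<Rightarrow> complex^'m \<Rightarrow> complex"
  where "CH_form X dX = (\<Sum>a\<in>UNIV. cnj (X $ a) * dX $ a)"

definition g_CH :: "complex^'m::finite \<Rightarrow> complex^'m \<Rightarrow> complex^'m \<Rightarrow> real"
  where "g_CH X dX dX' =
    1 / (1 - (norm X)\<^sup>2) *
      ((\<Sum>a\<in>UNIV. dX $ a \<bullet> dX' $ a)
        + 1 / (1 - (norm X)\<^sup>2) * (CH_form X dX \<bullet> CH_form X dX'))"

definition w_form :: "complex^'m::finite \<Rightarrow> complex^('m option) \<Rightarrow> complex"
  where "w_form X dw = dw $ None + (\<Sum>a\<in>UNIV. X $ a * dw $ Some a)"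

definition contact_form :: "real \<Rightarrow> 'm::finite pt \<Rightarrow> 'm pt \<Rightarrow> real"
  where "contact_form c = (\<lambda>(X, w, \<phi>, \<rho>) (dX, dw, d\<phi>, d\<rho>).
    d\<phi>
    - 2 * Im (cnj (w $ None) * dw $ None - (\<Sum>a\<in>UNIV. cnj (w $ Some a) * dw $ Some a))
    + 2 * c / (1 - (norm X)\<^sup>2) * Im (CH_form X dX))"

definition metric :: "real \<Rightarrow> 'm::finite pt \<Rightarrow> 'm pt \<Rightarrow> 'm pt \<Rightarrow> real"
  where "metric c = (\<lambda>(X, w, \<phi>, \<rho>) (dX, dw, d\<phi>, d\<rho>) (dX', dw', d\<phi>', d\<rho>').
    (\<rho> + c) / \<rho> * g_CH X dX dX'
    + 1 / (4 * \<rho>\<^sup>2) * ((\<rho> + 2 * c) / (\<rho> + c)) * (d\<rho> * d\<rho>')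
    - 1 / \<rho> * (dw $ None \<bullet> dw' $ None - (\<Sum>a\<in>UNIV. dw $ Some a \<bullet> dw' $ Some a))
    + (\<rho> + c) / \<rho>\<^sup>2 * (2 / (1 - (norm X)\<^sup>2)) * (w_form X dw \<bullet> w_form X dw')
    + 1 / (4 * \<rho>\<^sup>2) * ((\<rho> + c) / (\<rho> + 2 * c)) *
        (contact_form c (X, w, \<phi>, \<rho>) (dX, dw, d\<phi>, d\<rho>)
         * contact_form c (X, w, \<phi>, \<rho>) (dX', dw', d\<phi>', d\<rho>')))"

text \<open>\<open>Ck_on k S f\<close>: for open \<open>S\<close>, the map \<open>f\<close> is of class \<open>C\<^sup>k\<close> on \<open>S\<close>.\<close>

primrec Ck_on :: "nat \<Rightarrow> 'a::real_normed_vector set \<Rightarrow> ('a \<Rightarrow> 'b::real_normed_vector) \<Rightarrow> bool"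
  where
    "Ck_on 0 S f \<longleftrightarrow> continuous_on S f"
  | "Ck_on (Suc k) S f \<longleftrightarrow>
       (\<forall>x\<in>S. f differentiable (at x)) \<and> (\<forall>v. Ck_on k S (\<lambda>x. frechet_derivative f (at x) v))"

definition smooth_on :: "'a::real_normed_vector set \<Rightarrow> ('a \<Rightarrow> 'b::real_normed_vector) \<Rightarrow> bool"
  where "smooth_on S f \<longleftrightarrow> (\<forall>k. Ck_on k S f)"

definition preserves_metric_on :: "real \<Rightarrow> 'm::finite pt set \<Rightarrow> ('m pt \<Rightarrow> 'm pt) \<Rightarrow> bool"
  where "preserves_metric_on c S f \<longleftrightarrow>
    (\<forall>p\<in>S. \<forall>u v. metric c (f p) (frechet_derivative f (at p) u) (frechet_derivative f (at p) v)
                 = metric c p u v)"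

definition Isom :: "real \<Rightarrow> ('m::finite pt \<Rightarrow> 'm pt) monoid"
  where "Isom c = BijGroup Nbar
    \<lparr>carrier := {f \<in> Bij Nbar. smooth_on Nbar f \<and> smooth_on Nbar (inv_into Nbar f)
                             \<and> preserves_metric_on c Nbar f}\<rparr>"


section \<open>Lie algebras\<close>

type_synonym 'm mat = "complex^('m option)^('m option)"

definition cscale :: "complex \<Rightarrow> 'm::finite mat \<Rightarrow> 'm mat"
  where "cscale z A = (\<chi> i j. z * A $ i $ j)"

definition adj :: "'m::finite mat \<Rightarrow> 'm mat"
  where "adj A = (\<chi> i j. cnj (A $ j $ i))"

definition I_mat :: "'m::finite mat"
  where "I_mat = (\<chi> i j. if i = j then if i = None then -1 else 1 else 0)"

definition sigma :: "'m::finite mat \<Rightarrow> 'm mat"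
  where "sigma A = - (I_mat ** adj A ** I_mat)"

definition u_alg :: "'m::finite mat set"
  where "u_alg = {A. sigma A = A}"

definition C_gen :: "'m::finite mat"
  where "C_gen = cscale \<i> (mat 1)"

definition U_gen :: "'m::finite \<Rightarrow> 'm mat"
  where "U_gen a = (\<chi> i j. if i = None \<and> j = Some a then 1 else 0)"

text \<open>
  The underlying space of the Heisenberg algebra is \<open>\<complex>\<^sup>n \<times> \<real>\<close>: the first component of
  \<open>(v, t)\<close> lies in the span of the \<open>e\<^sub>k, f\<^sub>k\<close>, and the second is the coefficient of \<open>T\<close>.
  The form \<open>heis_form\<close> is the real bilinear form with \<open>[v, v'] = heis_form v v' \<cdot> T\<close>, i.e. with
  \<open>[e\<^sub>0, f\<^sub>0] = T\<close>, \<open>[e\<^sub>a, f\<^sub>a] = - T\<close> and all other brackets of basis vectors zero.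
\<close>

type_synonym 'm heis = "(complex^('m option)) \<times> real"

definition e_vec :: "'m option \<Rightarrow> 'm::finite heis"
  where "e_vec k = (axis k 1, 0)"

definition f_vec :: "'m option \<Rightarrow> 'm::finite heis"
  where "f_vec k = (axis k \<i>, 0)"

definition T_vec :: "'m::finite heis"
  where "T_vec = (0, 1)"

definition heis_form :: "complex^('m::finite option) \<Rightarrow> complex^('m option) \<Rightarrow> real"
  where "heis_form v v' =
    Im (cnj (v $ None) * v' $ None) - (\<Sum>a\<in>UNIV. Im (cnj (v $ Some a) * v' $ Some a))"

lemma heis_form_basis:
  fixes k l :: "'m::finite option"
  shows "heis_form (fst (e_vec k)) (fst (f_vec l)) =
      (if k = l then if k = None then 1 else -1 else 0)"
    and "heis_form (fst (e_vec k)) (fst (e_vec l)) = 0"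
    and "heis_form (fst (f_vec k)) (fst (f_vec l)) = 0"
proof -
  have sum_eq: "(\<Sum>a\<in>UNIV. Im (cnj (axis k z $ Some a) * axis l z' $ Some a)) =
      (if k = l \<and> k \<noteq> None then Im (cnj z * z') else 0)" for z z'
  proof (cases k)
    case None
    then show ?thesis by (simp add: axis_def)
  next
    case (Some b)
    have "(\<Sum>a\<in>UNIV. Im (cnj (axis k z $ Some a) * axis l z' $ Some a)) =
        (\<Sum>a\<in>UNIV. if a = b then (if k = l then Im (cnj z * z') else 0) else 0)"
      by (rule sum.cong) (auto simp: axis_def Some)
    then show ?thesis by (simp add: Some)
  qed
  show "heis_form (fst (e_vec k)) (fst (f_vec l)) =
      (if k = l then if k = None then 1 else -1 else 0)"
    unfolding heis_form_def e_vec_def f_vec_def fst_conv sum_eq by (auto simp: axis_def)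
  show "heis_form (fst (e_vec k)) (fst (e_vec l)) = 0"
    unfolding heis_form_def e_vec_def f_vec_def fst_conv sum_eq by (auto simp: axis_def)
  show "heis_form (fst (f_vec k)) (fst (f_vec l)) = 0"
    unfolding heis_form_def e_vec_def f_vec_def fst_conv sum_eq by (auto simp: axis_def)
qed

definition heis_deriv :: "'m::finite mat \<Rightarrow> 'm heis \<Rightarrow> 'm heis"
  where "heis_deriv A = (\<lambda>(v, t). (- (transpose A *v v), 0))"

type_synonym 'm liealg = "'m mat \<times> 'm heis"

definition g_alg :: "'m::finite liealg set"
  where "g_alg = u_alg \<times> UNIV"

definition g_bracket :: "'m::finite liealg \<Rightarrow> 'm liealg \<Rightarrow> 'm liealg"
  where "g_bracket = (\<lambda>(A, h) (B, k).
    (A ** B - B ** A, (0, heis_form (fst h) (fst k)) + heis_deriv A k - heis_deriv B h))"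


section \<open>The infinitesimal action\<close>

text \<open>
  A complexified tangent vector is given by its coefficients with respect to
  \<open>\<partial>/\<partial>X\<^sup>a, \<partial>/\<partial>cnj X\<^sup>a, \<partial>/\<partial>w\<^sup>k, \<partial>/\<partial>cnj w\<^sup>k, \<partial>/\<partial>\<phi>, \<partial>/\<partial>\<rho>\<close>, in this order.
\<close>

type_synonym 'm cvec =
  "(complex^'m) \<times> (complex^'m) \<times> (complex^('m option)) \<times> (complex^('m option))
    \<times> complex \<times> complex"

definition complexify :: "'m::finite pt \<Rightarrow> 'm cvec"
  where "complexify = (\<lambda>(dX, dw, d\<phi>, d\<rho>).
    (dX, (\<chi> a. cnj (dX $ a)), dw, (\<chi> k. cnj (dw $ k)), of_real d\<phi>, of_real d\<rho>))"

definition scale_cvec :: "complex \<Rightarrow> 'm::finite cvec \<Rightarrow> 'm cvec"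
  where "scale_cvec z = (\<lambda>(dX, dX', dw, dw', d\<phi>, d\<rho>).
    (z *s dX, z *s dX', z *s dw, z *s dw', z * d\<phi>, z * d\<rho>))"

definition cnj_cvec :: "'m::finite cvec \<Rightarrow> 'm cvec"
  where "cnj_cvec = (\<lambda>(dX, dX', dw, dw', d\<phi>, d\<rho>).
    ((\<chi> a. cnj (dX' $ a)), (\<chi> a. cnj (dX $ a)), (\<chi> k. cnj (dw' $ k)), (\<chi> k. cnj (dw $ k)),
      cnj d\<phi>, cnj d\<rho>))"

definition Y_C :: "real \<Rightarrow> 'm::finite pt \<Rightarrow> 'm cvec"
  where "Y_C c = (\<lambda>(X, w, \<phi>, \<rho>).
    (0, 0, (\<chi> k. - \<i> * w $ k), (\<chi> k. \<i> * cnj (w $ k)), - 2 * of_real c, 0))"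

definition Y_vf :: "real \<Rightarrow> 'm::finite \<Rightarrow> 'm pt \<Rightarrow> 'm cvec"
  where "Y_vf c a = (\<lambda>(X, w, \<phi>, \<rho>).
    ((\<chi> b. - X $ a * X $ b), axis a 1,
     axis (Some a) (- w $ None), axis None (- cnj (w $ Some a)),
     \<i> * of_real c * X $ a, 0))"

definition V_vf :: "'m option \<Rightarrow> 'm::finite pt \<Rightarrow> 'm cvec"
  where "V_vf k = (\<lambda>(X, w, \<phi>, \<rho>).
    (0, 0, axis k 1, 0, (if k = None then \<i> else - \<i>) * cnj (w $ k), 0))"

definition lie_bracket :: "('a::real_normed_vector \<Rightarrow> 'a) \<Rightarrow> ('a \<Rightarrow> 'a) \<Rightarrow> 'a \<Rightarrow> 'a"
  where "lie_bracket Y Z p =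
    frechet_derivative Z (at p) (Y p) - frechet_derivative Y (at p) (Z p)"

text \<open>
  The value at \<open>p\<close> of the complex-linear extension of \<open>\<alpha>\<close> on the element \<open>x + \<i> y\<close> of the
  complexified Lie algebra.
\<close>

definition cext :: "('m::finite liealg \<Rightarrow> 'm pt \<Rightarrow> 'm pt) \<Rightarrow> 'm liealg \<Rightarrow> 'm liealg \<Rightarrow> 'm pt \<Rightarrow> 'm cvec"
  where "cext \<alpha> x y p = complexify (\<alpha> x p) + scale_cvec \<i> (complexify (\<alpha> y p))"

text \<open>
  In the complexification, \<open>E\<^sub>k\<close> is \<open>e\<^sub>k + \<i> (- f\<^sub>k)\<close> and its conjugate is \<open>e\<^sub>k + \<i> f\<^sub>k\<close>; a matrix
  \<open>M\<close> corresponds to \<open>A + \<i> B\<close> for the unique \<open>A, B \<in> \<uu>(1, n-1)\<close> with \<open>M = A + \<i> B\<close>. Since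
  \<open>C, U\<^sub>a, sigma U\<^sub>a\<close> generate \<open>\<gg>\<ll>(n, \<complex>)\<close>, the conditions determine \<open>\<alpha>\<close> on \<^const>\<open>g_alg\<close> and
  \<^const>\<open>Nbar\<close>; that it is injective with values in the Killing fields is a consequence.
\<close>

definition infinitesimal_action ::
    "real \<Rightarrow> ('m::finite liealg \<Rightarrow> 'm pt \<Rightarrow> 'm pt) \<Rightarrow> bool"
  where "infinitesimal_action c \<alpha> \<longleftrightarrow>
    (\<forall>x\<in>g_alg. smooth_on Nbar (\<alpha> x)) \<and>
    (\<forall>p\<in>Nbar.
      (\<forall>x\<in>g_alg. \<forall>y\<in>g_alg. \<forall>r s :: real.
         \<alpha> (r *\<^sub>R x + s *\<^sub>R y) p = r *\<^sub>R \<alpha> x p + s *\<^sub>R \<alpha> y p) \<and>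
      (\<forall>x\<in>g_alg. \<forall>y\<in>g_alg. \<alpha> (g_bracket x y) p = - lie_bracket (\<alpha> x) (\<alpha> y) p) \<and>
      complexify (\<alpha> (C_gen, 0) p) = Y_C c p \<and>
      (\<forall>a. \<forall>A\<in>u_alg. \<forall>B\<in>u_alg. A + cscale \<i> B = U_gen a \<longrightarrow>
         cext \<alpha> (A, 0) (B, 0) p = Y_vf c a p) \<and>
      (\<forall>a. \<forall>A\<in>u_alg. \<forall>B\<in>u_alg. A + cscale \<i> B = sigma (U_gen a) \<longrightarrow>
         cext \<alpha> (A, 0) (B, 0) p = cnj_cvec (Y_vf c a p)) \<and>
      (\<forall>k. cext \<alpha> (0, e_vec k) (0, - f_vec k) p = V_vf k p) \<and>
      (\<forall>k. cext \<alpha> (0, e_vec k) (0, f_vec k) p = cnj_cvec (V_vf k p)) \<and>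
      complexify (\<alpha> (0, T_vec) p) = (0, 0, 0, 0, 1, 0))"

definition alpha :: "real \<Rightarrow> 'm::finite liealg \<Rightarrow> 'm pt \<Rightarrow> 'm pt"
  where "alpha c = (SOME \<alpha>. infinitesimal_action c \<alpha>)"


section \<open>The groups\<close>

definition U_group :: "'m::finite mat monoid"
  where "U_group = \<lparr>carrier = {A. adj A ** I_mat ** A = I_mat}, mult = (**), one = mat 1\<rparr>"

definition SU_group :: "'m::finite mat monoid"
  where "SU_group = U_group \<lparr>carrier := {A \<in> carrier U_group. det A = 1}\<rparr>"

text \<open>
  The simply connected Lie group with the Lie algebra of a connected matrix group \<open>G\<close> is the
  universal covering group of \<open>G\<close>, realised as the set of homotopy classes (with fixed end points)
  of paths in \<open>G\<close> that start at the identity, with pointwise multiplication. The covering map is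
  \<open>cover_proj\<close>, the end point of a class.
\<close>

definition path_class :: "'m::finite mat monoid \<Rightarrow> (real \<Rightarrow> 'm mat) \<Rightarrow> (real \<Rightarrow> 'm mat) set"
  where "path_class G \<gamma> = {\<delta>. homotopic_paths (carrier G) \<gamma> \<delta>}"

definition cover :: "'m::finite mat monoid \<Rightarrow> (real \<Rightarrow> 'm mat) set monoid"
  where "cover G =
    \<lparr>carrier = {path_class G \<gamma> |\<gamma>.
        path \<gamma> \<and> path_image \<gamma> \<subseteq> carrier G \<and> pathstart \<gamma> = one G},
     mult = (\<lambda>x y. \<Union>\<gamma>\<in>x. \<Union>\<delta>\<in>y. path_class G (\<lambda>t. mult G (\<gamma> t) (\<delta> t))),
     one = path_class G (\<lambda>t. one G)\<rparr>"

definition cover_proj :: "(real \<Rightarrow> 'm::finite mat) set \<Rightarrow> 'm mat"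
  where "cover_proj x = the_elem (pathfinish ` x)"

text \<open>The homomorphism from the covering group of SU(1,n-1) to that of U(1,n-1) induced by inclusion.\<close>

definition cover_incl :: "(real \<Rightarrow> 'm::finite mat) set \<Rightarrow> (real \<Rightarrow> 'm mat) set"
  where "cover_incl x = (\<Union>\<gamma>\<in>x. path_class U_group \<gamma>)"

text \<open>
  The Heisenberg group in exponential coordinates: its exponential map is the identity, and the
  product is given by the Baker-Campbell-Hausdorff formula.
\<close>

definition Heis :: "'m::finite heis monoid"
  where "Heis =
    \<lparr>carrier = UNIV,
     mult = (\<lambda>(v, t) (v', t'). (v + v', t + t' + heis_form v v' / 2)),
     one = (0, 0)\<rparr>"

text \<open>The action of matrix groups on the Heisenberg group whose differential is \<^const>\<open>heis_deriv\<close>.\<close>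

definition heis_act :: "'m::finite mat \<Rightarrow> 'm heis \<Rightarrow> 'm heis"
  where "heis_act A = (\<lambda>(v, t). (transpose (matrix_inv A) *v v, t))"

definition semidirect ::
    "('a, 'c) monoid_scheme \<Rightarrow> ('a \<Rightarrow> 'b \<Rightarrow> 'b) \<Rightarrow> ('b, 'd) monoid_scheme \<Rightarrow> ('a \<times> 'b) monoid"
  where "semidirect G act N =
    \<lparr>carrier = carrier G \<times> carrier N,
     mult = (\<lambda>(g, h) (g', h'). (mult G g g', mult N h (act g h'))),
     one = (one G, one N)\<rparr>"

definition U_cover_Heis :: "((real \<Rightarrow> 'm::finite mat) set \<times> 'm heis) monoid"
  where "U_cover_Heis = semidirect (cover U_group) (\<lambda>x. heis_act (cover_proj x)) Heis"

definition SU_cover_Heis :: "((real \<Rightarrow> 'm::finite mat) set \<times> 'm heis) monoid"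
  where "SU_cover_Heis = semidirect (cover SU_group) (\<lambda>x. heis_act (cover_proj x)) Heis"


section \<open>The isometric actions\<close>

text \<open>
  A homomorphism \<open>\<beta>\<close> integrates \<open>\<alpha>\<close> if for every curve \<open>\<theta>\<close> in the group through the identity
  with initial velocity \<open>\<xi>\<close> in the Lie algebra, the curve \<open>t \<mapsto> \<beta> (\<theta> t) p\<close> has initial velocity
  \<open>\<alpha> \<xi> p\<close>. A curve in the covering group starting at the identity is of the form
  \<open>t \<mapsto> [\<gamma> restricted to [0, t]]\<close>. As the groups are connected, this determines \<open>\<beta>\<close> on the carrier.
\<close>

definition integrates ::
    "real \<Rightarrow> ('m::finite liealg \<Rightarrow> 'm pt \<Rightarrow> 'm pt)
      \<Rightarrow> ((real \<Rightarrow> 'm mat) set \<times> 'm heis \<Rightarrow> 'm pt \<Rightarrow> 'm pt) \<Rightarrow> bool"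
  where "integrates c \<alpha> \<beta> \<longleftrightarrow>
    \<beta> \<in> hom U_cover_Heis (Isom c) \<and>
    (\<forall>\<gamma> A h \<xi>. \<forall>p\<in>Nbar.
       path \<gamma> \<and> path_image \<gamma> \<subseteq> carrier U_group \<and> pathstart \<gamma> = mat 1 \<and>
       (\<gamma> has_vector_derivative A) (at 0 within {0..1}) \<and>
       h 0 = 0 \<and> (h has_vector_derivative \<xi>) (at 0 within {0..1}) \<longrightarrow>
       ((\<lambda>t. \<beta> (path_class U_group (subpath 0 t \<gamma>), h t) p)
          has_vector_derivative \<alpha> (A, \<xi>) p) (at 0 within {0..1}))"

definition beta :: "real \<Rightarrow> (real \<Rightarrow> 'm::finite mat) set \<times> 'm heis \<Rightarrow> 'm pt \<Rightarrow> 'm pt"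
  where "beta c = (SOME \<beta>. integrates c (alpha c) \<beta>)"

definition beta' :: "real \<Rightarrow> (real \<Rightarrow> 'm::finite mat) set \<times> 'm heis \<Rightarrow> 'm pt \<Rightarrow> 'm pt"
  where "beta' c = (\<lambda>(x, h). beta c (cover_incl x, h))"

definition H_img :: "real \<Rightarrow> ('m::finite pt \<Rightarrow> 'm pt) set"
  where "H_img c = (\<lambda>h. beta c (one (cover U_group), h)) ` carrier Heis"

definition U'_img :: "real \<Rightarrow> ('m::finite pt \<Rightarrow> 'm pt) set"
  where "U'_img c = (\<lambda>x. beta' c (x, one Heis)) ` carrier (cover SU_group)"

definition F' :: "real \<Rightarrow> ('m::finite pt \<Rightarrow> 'm pt) set"
  where "F' c = U'_img c \<inter> H_img c"

definition F'_Heis :: "real \<Rightarrow> 'm::finite heis set"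
  where "F'_Heis c = {h \<in> carrier Heis. beta c (one (cover U_group), h) \<in> F' c}"

text \<open>
  The quotient manifold is the set of orbits in \<^const>\<open>Nbar\<close> of the following group; for \<open>c = 0\<close>
  this is \<^const>\<open>Nbar\<close> itself, its points being regarded as singletons.
\<close>

definition deck :: "real \<Rightarrow> ('m::finite pt \<Rightarrow> 'm pt) monoid"
  where "deck c = (Isom c) \<lparr>carrier := (if c = 0 then {one (Isom c)} else F' c)\<rparr>"

definition proj :: "real \<Rightarrow> 'm::finite pt \<Rightarrow> 'm pt set"
  where "proj c p = orbit (deck c) (\<lambda>f. f) p"

definition Nhat :: "real \<Rightarrow> 'm::finite pt set set"
  where "Nhat c = orbits (deck c) Nbar (\<lambda>f. f)"

text \<open>
  The smooth structure and the metric of the quotient are those for which \<^const>\<open>proj\<close> is a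
  local diffeomorphism and a local isometry. Hence a map of the quotient is smooth and preserves
  the metric iff it has, around every point, a lift to \<^const>\<open>Nbar\<close> which does.
\<close>

definition local_isometry_hat :: "real \<Rightarrow> ('m::finite pt set \<Rightarrow> 'm pt set) \<Rightarrow> bool"
  where "local_isometry_hat c F \<longleftrightarrow>
    (\<forall>p\<in>Nbar. \<exists>S f. open S \<and> p \<in> S \<and> S \<subseteq> Nbar \<and> f ` S \<subseteq> Nbar \<and>
       (\<forall>q\<in>S. proj c (f q) = F (proj c q)) \<and> smooth_on S f \<and> preserves_metric_on c S f)"

definition Isom_hat :: "real \<Rightarrow> ('m::finite pt set \<Rightarrow> 'm pt set) monoid"
  where "Isom_hat c = BijGroup (Nhat c)
    \<lparr>carrier := {F \<in> Bij (Nhat c). local_isometry_hat c F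
                                 \<and> local_isometry_hat c (inv_into (Nhat c) F)}\<rparr>"

text \<open>The descended action: an element acts on an orbit by taking its image.\<close>

definition beta_hat' ::
    "real \<Rightarrow> (real \<Rightarrow> 'm::finite mat) set \<times> 'm heis \<Rightarrow> 'm pt set \<Rightarrow> 'm pt set"
  where "beta_hat' c x = (\<lambda>P\<in>Nhat c. beta' c x ` P)"

definition G_hat' :: "real \<Rightarrow> ('m::finite pt set \<Rightarrow> 'm pt set) set"
  where "G_hat' c = beta_hat' c ` carrier SU_cover_Heis"

text \<open>An element of SU(1,n-1) acts on a coset of \<open>F'\<close> by taking its image.\<close>

definition SU_Heis_mod :: "real \<Rightarrow> ('m::finite mat \<times> 'm heis set) monoid"
  where "SU_Heis_mod c = semidirect SU_group (\<lambda>A K. heis_act A ` K) (Heis Mod F'_Heis c)"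

end

(*
  The infinitesimal action is integrated explicitly: U(1,n-1) acts on X by fractional linear
  transformations g X, on w by the contragredient representation, and translates phi by -2c times the
  argument of the automorphy factor (g (1,X))_0, followed along a path from 1 to g; the Heisenberg
  group acts by affine maps.  The prescribed action agrees with this one: along a differentiable curve
  in the group the quotient of the two actions has derivative zero, and in a Cayley chart every
  element of the covering group is a product of endpoints of such curves.  An element of the covering
  group of SU(1,n-1) over 1 only translates phi, and conversely an element that acts on the quotient
  by such a translation lies over 1.  Hence F' is the group of these translations, and the kernel of
  the descended action is the kernel of the projection to the semidirect product in the theorem, which
  is onto because SU(1,n-1) is connected: complex reflections reduce any element to the identity.
*)
theory Submission
  imports Defs "HOL-Complex_Analysis.Complex_Analysis"
begin

section \<open>Calculus of smooth maps\<close>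

text \<open>\<open>alpha\<close> and \<open>beta\<close> are chosen objects, known only through
  their defining conditions; the homomorphism is prescribed by one-sided velocities at the identity,
  with no continuity given beforehand. Hence the comparison along curves instead of through flows.
  The multiplier -2c is forced by the metric: under a fractional linear map the summand of the
  contact form with coefficient \<open>2 * c\<close> changes by 2c times the differential of the
  argument of the automorphy factor, and the translation of \<phi> cancels this change. That
  argument is multivalued on U(1,n-1). It is split as \<theta> + \<open>ash g X\<close>: the factor
  divided by its value at X = 0 lies in the right half-plane, where the principal logarithm is
  smooth, so all dependence on the path sits in one real number \<theta>, the argument of the corner
  entry of g. The price is the correction \<open>ash g (mob g' 0)\<close> in the composition law of
  \<open>act\<close>; the arguments of products of paths need the same correction, so the two fit
  together.\<close>

lemma frechet_derivative_cong_open: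
  assumes "open S" "x \<in> S" "\<And>y. y \<in> S \<Longrightarrow> f y = g y"
  shows "frechet_derivative f (at x) = frechet_derivative g (at x)"
proof -
  have "(f has_derivative D) (at x) \<longleftrightarrow> (g has_derivative D) (at x)" for D
    using has_derivative_transform_within_open[OF _ assms(1,2)] assms(3) by metis
  then show ?thesis unfolding frechet_derivative_def by simp
qed

lemma Ck_on_cong:
  assumes "open S" "\<And>x. x \<in> S \<Longrightarrow> f x = g x" "Ck_on k S f"
  shows "Ck_on k S g"
  using assms(2,3)
proof (induction k arbitrary: f g)
  case 0
  then show ?case using continuous_on_cong by (metis Ck_on.simps(1))
next
  case (Suc k)
  have "g differentiable (at x)" if "x \<in> S" for x
    using Suc.prems that has_derivative_transform_within_open[OF _ assms(1) that]
    unfolding Ck_on.simps differentiable_def by metis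
  moreover have "Ck_on k S (\<lambda>x. frechet_derivative g (at x) v)" for v
    using Suc.prems Suc.IH[of "\<lambda>x. frechet_derivative f (at x) v"]
      frechet_derivative_cong_open[OF assms(1), of _ f g] by simp
  ultimately show ?case by simp
qed

text \<open>\<open>frechet_derivative\<close> is a choice operator. Any explicit derivative
  coincides with it on the open set S, and \<open>Ck_on\<close> only sees values on S, so D may take
  its place in the recursive clause.\<close>

lemma Ck_on_SucI:
  assumes "open S" "\<And>x. x \<in> S \<Longrightarrow> (f has_derivative D x) (at x)"
    and "\<And>v. Ck_on k S (\<lambda>x. D x v)"
  shows "Ck_on (Suc k) S f"
proof -
  have eq: "D x = frechet_derivative f (at x)" if "x \<in> S" for x
    by (rule frechet_derivative_at[OF assms(2)[OF that]])
  have "Ck_on k S (\<lambda>x. frechet_derivative f (at x) v)" for v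
    by (rule Ck_on_cong[OF assms(1) _ assms(3)[of v]]) (simp add: eq)
  then show ?thesis using assms(2) by (auto intro: differentiableI)
qed

lemma Ck_on_Suc_has_derivative:
  assumes "Ck_on (Suc k) S f" "x \<in> S"
  shows "(f has_derivative frechet_derivative f (at x)) (at x)"
  using assms frechet_derivative_works by auto

lemma Ck_on_Suc_imp: "Ck_on (Suc k) S f \<Longrightarrow> Ck_on k S f"
proof (induction k arbitrary: f)
  case 0
  then show ?case
    by (metis Ck_on.simps continuous_at_imp_continuous_on differentiable_imp_continuous_within)
next
  case (Suc k)
  then show ?case by (metis Ck_on.simps(2))
qed

lemma Ck_on_const: "open S \<Longrightarrow> Ck_on k S (\<lambda>_. c)"
  by (induction k arbitrary: c) (auto intro: Ck_on_SucI[where D="\<lambda>_ _. 0"] simp del: Ck_on.simps(2))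

lemma Ck_on_bounded_linear:
  assumes "bounded_linear L" "open S" "Ck_on k S f"
  shows "Ck_on k S (\<lambda>x. L (f x))"
  using assms(3)
proof (induction k arbitrary: f)
  case 0
  then show ?case
    using assms(1) by (simp add: bounded_linear.continuous_on)
next
  case (Suc k)
  show ?case
  proof (rule Ck_on_SucI[OF assms(2)])
    show "((\<lambda>x. L (f x)) has_derivative (\<lambda>v. L (frechet_derivative f (at x) v))) (at x)"
      if "x \<in> S" for x
      using bounded_linear.has_derivative[OF assms(1) Ck_on_Suc_has_derivative[OF Suc.prems that]] .
    show "Ck_on k S (\<lambda>x. L (frechet_derivative f (at x) v))" for v
      using Suc by auto
  qed
qed

lemma Ck_on_add:
  assumes "open S" "Ck_on k S f" "Ck_on k S g"
  shows "Ck_on k S (\<lambda>x. f x + g x)"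
  using assms(2,3)
proof (induction k arbitrary: f g)
  case 0
  then show ?case by (simp add: continuous_on_add)
next
  case (Suc k)
  show ?case
  proof (rule Ck_on_SucI[OF assms(1)])
    show "((\<lambda>x. f x + g x) has_derivative
        (\<lambda>v. frechet_derivative f (at x) v + frechet_derivative g (at x) v)) (at x)"
      if "x \<in> S" for x
      using has_derivative_add[OF Suc.prems[THEN Ck_on_Suc_has_derivative, OF that]] .
    show "Ck_on k S (\<lambda>x. frechet_derivative f (at x) v + frechet_derivative g (at x) v)" for v
      using Suc by auto
  qed
qed

text \<open>The product rule gives a sum of two terms of the same shape; in each, the
  undifferentiated factor is of class C^k by \<open>Ck_on_Suc_imp\<close>.\<close>

lemma Ck_on_bilinear:
  assumes bl: "bounded_bilinear B" and "open S" "Ck_on k S f" "Ck_on k S g"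
  shows "Ck_on k S (\<lambda>x. B (f x) (g x))"
  using assms(3,4)
proof (induction k arbitrary: f g)
  case 0
  then show ?case using bounded_bilinear.continuous_on[OF bl] by simp
next
  case (Suc k)
  show ?case
  proof (rule Ck_on_SucI[OF assms(2)])
    show "((\<lambda>x. B (f x) (g x)) has_derivative
        (\<lambda>v. B (f x) (frechet_derivative g (at x) v) + B (frechet_derivative f (at x) v) (g x))) (at x)"
      if "x \<in> S" for x
      using bounded_bilinear.FDERIV[OF bl Suc.prems[THEN Ck_on_Suc_has_derivative, OF that]] .
    show "Ck_on k S (\<lambda>x. B (f x) (frechet_derivative g (at x) v) + B (frechet_derivative f (at x) v) (g x))" for v
      by (rule Ck_on_add[OF assms(2)]; rule Suc.IH)
        (use Suc.prems Ck_on_Suc_imp[OF Suc.prems(1)] Ck_on_Suc_imp[OF Suc.prems(2)] in auto)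
  qed
qed

text \<open>The derivative involves only f' and \<open>inverse f\<close> itself, so the induction
  hypothesis for the same f closes the step.\<close>

lemma Ck_on_inverse:
  fixes f :: "'a::real_normed_vector \<Rightarrow> complex"
  assumes "open S" "\<And>x. x \<in> S \<Longrightarrow> f x \<noteq> 0" "Ck_on k S f"
  shows "Ck_on k S (\<lambda>x. inverse (f x))"
  using assms(3)
proof (induction k)
  case 0
  then show ?case using assms(2) by (simp add: continuous_on_inverse)
next
  case (Suc k)
  note inv = Suc.IH[OF Ck_on_Suc_imp[OF Suc.prems]]
  show ?case
  proof (rule Ck_on_SucI[OF assms(1)])
    show "((\<lambda>x. inverse (f x)) has_derivative
        (\<lambda>v. - (inverse (f x) * frechet_derivative f (at x) v * inverse (f x)))) (at x)"
      if "x \<in> S" for x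
      using Deriv.has_derivative_inverse[OF assms(2)[OF that] Ck_on_Suc_has_derivative[OF Suc.prems that]] .
    show "Ck_on k S (\<lambda>x. - (inverse (f x) * frechet_derivative f (at x) v * inverse (f x)))" for v
      by (rule Ck_on_bounded_linear[OF bounded_linear_minus[OF bounded_linear_ident] assms(1)],
          (rule Ck_on_bilinear[OF bounded_bilinear_mult assms(1)])+)
        (use Suc.prems inv in auto)
  qed
qed

text \<open>One differentiation leads to f'/f and thus to \<open>Ck_on_inverse\<close>. Positivity
  of the real part keeps the values away from the branch cut; for the automorphy factor it comes
  from \<open>Re_afac_pos\<close>.\<close>

lemma Ck_on_Ln:
  fixes f :: "'a::real_normed_vector \<Rightarrow> complex"
  assumes "open S" "\<And>x. x \<in> S \<Longrightarrow> Re (f x) > 0" "Ck_on k S f"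
  shows "Ck_on k S (\<lambda>x. Ln (f x))"
proof -
  have nz: "f x \<notin> \<real>\<^sub>\<le>\<^sub>0" if "x \<in> S" for x
    using assms(2)[OF that] by (auto simp: complex_nonpos_Reals_iff)
  show ?thesis
  proof (cases k)
    case 0
    then show ?thesis using assms(3) nz by (auto intro: continuous_on_Ln')
  next
    case (Suc m)
    show ?thesis unfolding Suc
    proof (rule Ck_on_SucI[OF assms(1)])
      show "((\<lambda>x. Ln (f x)) has_derivative (\<lambda>v. inverse (f x) * frechet_derivative f (at x) v)) (at x)"
        if "x \<in> S" for x
      proof -
        have "(Ln has_derivative (\<lambda>v. inverse (f x) * v)) (at (f x))"
          using has_field_derivative_Ln[OF nz[OF that]] by (simp add: has_field_derivative_def)
        from has_derivative_compose[OF Ck_on_Suc_has_derivative[OF assms(3)[unfolded Suc] that] this]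
        show ?thesis .
      qed
      show "Ck_on m S (\<lambda>x. inverse (f x) * frechet_derivative f (at x) v)" for v
        by (rule Ck_on_bilinear[OF bounded_bilinear_mult assms(1)] Ck_on_inverse[OF assms(1)])+
          (use assms(2,3) Suc Ck_on_Suc_imp[of m S f] in fastforce)+
    qed
  qed
qed

section \<open>Closure properties of smooth maps on open sets\<close>

lemma smooth_on_imp_differentiable: "smooth_on S f \<Longrightarrow> x \<in> S \<Longrightarrow> f differentiable (at x)"
  unfolding smooth_on_def by (metis Ck_on.simps(2))

lemma smooth_on_cong:
  "open S \<Longrightarrow> (\<And>x. x \<in> S \<Longrightarrow> f x = g x) \<Longrightarrow> smooth_on S f \<Longrightarrow> smooth_on S g"
  unfolding smooth_on_def using Ck_on_cong by metis

lemma smooth_on_const: "open S \<Longrightarrow> smooth_on S (\<lambda>_. c)"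
  by (simp add: smooth_on_def Ck_on_const)

lemma smooth_on_bounded_linear:
  "open S \<Longrightarrow> bounded_linear L \<Longrightarrow> smooth_on S f \<Longrightarrow> smooth_on S (\<lambda>x. L (f x))"
  by (simp add: smooth_on_def Ck_on_bounded_linear)

lemma smooth_on_add:
  "open S \<Longrightarrow> smooth_on S f \<Longrightarrow> smooth_on S g \<Longrightarrow> smooth_on S (\<lambda>x. f x + g x)"
  by (simp add: smooth_on_def Ck_on_add)

lemma smooth_on_bilinear:
  "open S \<Longrightarrow> bounded_bilinear B \<Longrightarrow> smooth_on S f \<Longrightarrow> smooth_on S g \<Longrightarrow> smooth_on S (\<lambda>x. B (f x) (g x))"
  by (simp add: smooth_on_def Ck_on_bilinear)

lemma smooth_on_inverse:
  fixes f :: "'a::real_normed_vector \<Rightarrow> complex"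
  shows "open S \<Longrightarrow> (\<And>x. x \<in> S \<Longrightarrow> f x \<noteq> 0) \<Longrightarrow> smooth_on S f \<Longrightarrow> smooth_on S (\<lambda>x. inverse (f x))"
  by (simp add: smooth_on_def Ck_on_inverse)

lemma smooth_on_Ln:
  fixes f :: "'a::real_normed_vector \<Rightarrow> complex"
  shows "open S \<Longrightarrow> (\<And>x. x \<in> S \<Longrightarrow> Re (f x) > 0) \<Longrightarrow> smooth_on S f \<Longrightarrow> smooth_on S (\<lambda>x. Ln (f x))"
  by (simp add: smooth_on_def Ck_on_Ln)

lemma smooth_on_sum:
  "open S \<Longrightarrow> (\<And>i. i \<in> I \<Longrightarrow> smooth_on S (f i)) \<Longrightarrow> smooth_on S (\<lambda>x. \<Sum>i\<in>I. f i x)"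
  by (induction I rule: infinite_finite_induct) (auto intro: smooth_on_const smooth_on_add)

lemma smooth_on_mult:
  fixes f g :: "'a::real_normed_vector \<Rightarrow> 'b::real_normed_algebra"
  shows "open S \<Longrightarrow> smooth_on S f \<Longrightarrow> smooth_on S g \<Longrightarrow> smooth_on S (\<lambda>x. f x * g x)"
  by (rule smooth_on_bilinear[OF _ bounded_bilinear_mult])

lemma smooth_on_divide:
  fixes f g :: "'a::real_normed_vector \<Rightarrow> complex"
  shows "open S \<Longrightarrow> (\<And>x. x \<in> S \<Longrightarrow> g x \<noteq> 0) \<Longrightarrow> smooth_on S f \<Longrightarrow> smooth_on S g
    \<Longrightarrow> smooth_on S (\<lambda>x. f x / g x)"
  unfolding divide_inverse by (intro smooth_on_mult smooth_on_inverse)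

lemma smooth_on_minus: "open S \<Longrightarrow> smooth_on S f \<Longrightarrow> smooth_on S (\<lambda>x. - f x)"
  by (rule smooth_on_bounded_linear[OF _ bounded_linear_minus[OF bounded_linear_ident]])

lemma smooth_on_diff:
  "open S \<Longrightarrow> smooth_on S f \<Longrightarrow> smooth_on S g \<Longrightarrow> smooth_on S (\<lambda>x. f x - g x)"
  using smooth_on_add[of S f "\<lambda>x. - g x"] by (simp add: smooth_on_minus)

lemma smooth_on_Pair:
  assumes "open S" "smooth_on S f" "smooth_on S g"
  shows "smooth_on S (\<lambda>x. (f x, g x))"
proof -
  have "bounded_linear (\<lambda>a. (a, 0::'c))" "bounded_linear (\<lambda>b. (0::'b, b))"
    by (intro bounded_linear_Pair bounded_linear_ident bounded_linear_zero)+
  from smooth_on_add[OF assms(1) smooth_on_bounded_linear[OF assms(1) this(1) assms(2)]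
      smooth_on_bounded_linear[OF assms(1) this(2) assms(3)]]
  show ?thesis by simp
qed

lemma bounded_linear_axis: "bounded_linear (axis i :: 'a::real_normed_vector \<Rightarrow> 'a^'n::finite)"
proof
  show "axis i (x + y) = axis i x + (axis i y :: 'a^'n)" for x y
    by (simp add: axis_def vec_eq_iff)
  show "axis i (r *\<^sub>R x) = r *\<^sub>R (axis i x :: 'a^'n)" for r x
    by (simp add: axis_def vec_eq_iff)
  show "\<exists>K. \<forall>x. norm (axis i x :: 'a^'n) \<le> norm x * K"
  proof (intro exI[of _ 1] allI)
    fix x :: 'a
    have "(\<Sum>j\<in>UNIV. (norm (if j = i then x else 0))\<^sup>2) = (\<Sum>j\<in>UNIV. if j = i then (norm x)\<^sup>2 else 0)"
      by (intro sum.cong) auto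
    then show "norm (axis i x :: 'a^'n) \<le> norm x * 1"
      by (simp add: norm_vec_def L2_set_def axis_def)
  qed
qed

text \<open>As a finite sum of bounded linear images of its components, a vector inherits
  smoothness, derivatives and continuity from them.\<close>

lemma vec_lambda_eq_sum_axis: "(\<chi> i. f i) = (\<Sum>i\<in>UNIV. axis i (f i :: 'a::real_normed_vector) :: 'a^'n::finite)"
  by (simp add: vec_eq_iff axis_def if_distrib cong: if_cong)

lemma smooth_on_vec:
  fixes f :: "'n::finite \<Rightarrow> 'a::real_normed_vector \<Rightarrow> 'b::real_normed_vector"
  assumes "open S" "\<And>i. smooth_on S (f i)"
  shows "smooth_on S (\<lambda>x. \<chi> i. f i x)"
  unfolding vec_lambda_eq_sum_axis
  by (intro smooth_on_sum smooth_on_bounded_linear[OF _ bounded_linear_axis] assms)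

lemma smooth_on_linear: "open S \<Longrightarrow> bounded_linear L \<Longrightarrow> smooth_on S L"
proof -
  assume S: "open S" and L: "bounded_linear L"
  have "Ck_on k S (\<lambda>x. x)" for k
    by (cases k)
      (auto intro!: Ck_on_SucI[where D="\<lambda>_ v. v"] continuous_on_id Ck_on_const S simp del: Ck_on.simps(2))
  then show ?thesis using smooth_on_bounded_linear[OF S L, of "\<lambda>x. x"] by (simp add: smooth_on_def)
qed

section \<open>The indefinite unitary group\<close>

lemma sum_option: "(\<Sum>k\<in>UNIV. f k) = f None + (\<Sum>a\<in>UNIV. f (Some a))"
  for f :: "'m::finite option \<Rightarrow> 'b::comm_monoid_add"
  by (simp add: UNIV_option_conv sum.reindex inj_on_def)

lemma forall_option: "(\<forall>k. P k) \<longleftrightarrow> P None \<and> (\<forall>a. P (Some a))"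
  by (metis option.exhaust)

lemma matrix_vector_mult_smult: "A *v (c *s x) = c *s (A *v x)"
  for A :: "'a::comm_semiring_1^'n^'m"
  by (simp add: vec_eq_iff matrix_vector_mult_def sum_distrib_left ac_simps)

section \<open>The Hermitian form of signature (n-1, 1) and its adjoint\<close>

definition isgn :: "'m option \<Rightarrow> complex"
  where "isgn k = (if k = None then -1 else 1)"

lemma isgn_simps [simp]: "isgn None = -1" "isgn (Some a) = 1"
  by (simp_all add: isgn_def)

lemma isgn_sq [simp]: "isgn k * isgn k = 1" "isgn k * (isgn k * z) = z" "cnj (isgn k) = isgn k"
  by (simp_all add: isgn_def)

text \<open>The indefinite form with Gram matrix \<open>I_mat\<close>, conjugate-linear in the first
  argument. The ball, the metric and the Heisenberg bracket are all expressed through it.\<close>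

definition herm :: "complex^('m::finite option) \<Rightarrow> complex^('m option) \<Rightarrow> complex"
  where "herm x y = (\<Sum>k\<in>UNIV. isgn k * (cnj (x $ k) * y $ k))"

text \<open>The adjoint for \<open>herm\<close>, see \<open>herm_dag\<close>. In these terms the Lie
  algebra consists of the A with \<open>dag A = - A\<close> and the group of the A with inverse
  \<open>dag A\<close>, so \<open>dag\<close> serves as inversion throughout.\<close>

definition dag :: "'m::finite mat \<Rightarrow> 'm mat"
  where "dag A = I_mat ** adj A ** I_mat"

lemma dag_nth: "dag A $ i $ j = isgn i * isgn j * cnj (A $ j $ i)"
proof -
  have I: "(I_mat :: 'a mat) $ i $ j = (if i = j then isgn i else 0)" for i j
    by (simp add: I_mat_def isgn_def)
  show ?thesis
    by (simp add: dag_def matrix_matrix_mult_def I adj_def if_distrib[of "\<lambda>x. x * _"]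
        if_distrib[of "\<lambda>x. _ * x"] cong: if_cong)
qed

lemma sigma_eq_dag: "sigma A = - dag A"
  by (simp add: sigma_def dag_def)

lemma u_alg_iff: "A \<in> u_alg \<longleftrightarrow> dag A = - A"
  unfolding u_alg_def sigma_eq_dag mem_Collect_eq by (metis minus_equation_iff)

lemma dag_dag [simp]: "dag (dag A) = A"
  by (simp add: vec_eq_iff dag_nth ac_simps)

lemma dag_mat1 [simp]: "dag (mat 1) = mat 1"
  by (auto simp: vec_eq_iff dag_nth mat_def)

lemma dag_add: "dag (A + B) = dag A + dag B"
  and dag_minus: "dag (- A) = - dag A"
  and dag_diff: "dag (A - B) = dag A - dag B"
  and dag_scaleR: "dag (r *\<^sub>R A) = r *\<^sub>R dag A"
  and dag_cscale: "dag (cscale z A) = cscale (cnj z) (dag A)"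
  by (simp_all add: vec_eq_iff dag_nth algebra_simps cscale_def)

lemma dag_mult: "dag (A ** B) = dag B ** dag A"
proof -
  have "isgn i * isgn j * (cnj (A $ j $ k) * cnj (B $ k $ i)) =
      (isgn i * isgn k * cnj (B $ k $ i)) * (isgn k * isgn j * cnj (A $ j $ k))" for i j k
    by (simp add: isgn_def)
  then show ?thesis
    unfolding vec_eq_iff dag_nth matrix_matrix_mult_def
    by (simp only: vec_lambda_beta dag_nth cnj_sum complex_cnj_mult sum_distrib_left)
      (auto intro!: sum.cong)
qed

lemma I_mat_sq: "I_mat ** I_mat = (mat 1 :: 'm::finite mat)"
  by (auto simp: vec_eq_iff matrix_matrix_mult_def I_mat_def mat_def
      if_distrib[of "\<lambda>x. x * _"] if_distrib[of "\<lambda>x. _ * x"] cong: if_cong)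

text \<open>\<open>I_mat\<close> is its own inverse, so multiplying the defining equation by it on
  the left loses nothing.\<close>

lemma mem_U_iff: "A \<in> carrier U_group \<longleftrightarrow> dag A ** A = mat 1"
proof -
  have "adj A ** I_mat ** A = I_mat \<longleftrightarrow> I_mat ** (adj A ** I_mat ** A) = I_mat ** I_mat"
    by (metis I_mat_sq matrix_mul_assoc matrix_mul_lid)
  then show ?thesis
    by (simp add: U_group_def dag_def I_mat_sq matrix_mul_assoc)
qed

lemma U_dag_right: "A \<in> carrier U_group \<Longrightarrow> A ** dag A = mat 1"
  by (simp add: mem_U_iff matrix_left_right_inverse)

lemma U_dag_left: "A \<in> carrier U_group \<Longrightarrow> dag A ** A = mat 1"
  by (simp add: mem_U_iff)

lemma U_mult: "A \<in> carrier U_group \<Longrightarrow> B \<in> carrier U_group \<Longrightarrow> A ** B \<in> carrier U_group"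
proof -
  assume A: "A \<in> carrier U_group" and B: "B \<in> carrier U_group"
  have "dag (A ** B) ** (A ** B) = dag B ** (dag A ** A) ** B"
    by (simp only: dag_mult matrix_mul_assoc)
  then show ?thesis using A B by (simp add: mem_U_iff)
qed

lemma U_one: "mat 1 \<in> carrier U_group"
  by (simp add: mem_U_iff)

lemma U_dag: "A \<in> carrier U_group \<Longrightarrow> dag A \<in> carrier U_group"
  by (simp add: mem_U_iff matrix_left_right_inverse)

lemma matrix_inv_eqI:
  fixes A :: "'a::field^'n^'n"
  assumes "B ** A = mat 1"
  shows "matrix_inv A = B"
proof -
  have "A ** B = mat 1" using assms by (simp add: matrix_left_right_inverse)
  then have "\<exists>A'. A ** A' = mat 1 \<and> A' ** A = mat 1" using assms by blast
  then have "A ** matrix_inv A = mat 1" unfolding matrix_inv_def by (rule someI2_ex) auto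
  then show ?thesis by (metis assms matrix_mul_assoc matrix_mul_lid matrix_mul_rid)
qed

lemma U_matrix_inv: "A \<in> carrier U_group \<Longrightarrow> matrix_inv A = dag A"
  by (simp add: matrix_inv_eqI U_dag_left)

lemma herm_option: "herm x y = - (cnj (x $ None) * y $ None) + (\<Sum>a\<in>UNIV. cnj (x $ Some a) * y $ Some a)"
  by (simp add: herm_def sum_option)

lemma herm_axis: "herm (axis k z) w = isgn k * (cnj z * w $ k)"
  by (simp add: herm_def axis_def if_distrib[of "\<lambda>x. x * _"] if_distrib[of "\<lambda>x. _ * x"] if_distrib[of cnj]
      cong: if_cong)

lemma herm_add_left: "herm (x + y) z = herm x z + herm y z"
  and herm_add_right: "herm x (y + z) = herm x y + herm x z"
  and herm_smult_left: "herm (c *s x) y = cnj c * herm x y"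
  and herm_smult_right: "herm x (c *s y) = c * herm x y"
  and herm_minus_left: "herm (- x) y = - herm x y"
  and herm_minus_right: "herm x (- y) = - herm x y"
  by (simp_all add: herm_def sum.distrib sum_distrib_left sum_negf algebra_simps)

lemma herm_diff_left: "herm (x - y) z = herm x z - herm y z"
  and herm_diff_right: "herm x (y - z) = herm x y - herm x z"
  using herm_add_left[of x "- y" z] herm_add_right[of x y "- z"]
  by (simp_all add: herm_minus_left herm_minus_right)

lemma herm_scaleR_left: "herm (r *\<^sub>R x) y = r * herm x y"
  and herm_scaleR_right: "herm x (r *\<^sub>R y) = r * herm x y"
  by (simp_all add: herm_def scaleR_conv_of_real[where 'a=complex] sum_distrib_left ac_simps)

lemma herm_cnj: "cnj (herm x y) = herm y x"
  by (simp add: herm_def cnj_sum ac_simps)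

lemma herm_dag: "herm (A *v x) y = herm x (dag A *v y)"
proof -
  have "herm (A *v x) y = (\<Sum>k\<in>UNIV. \<Sum>l\<in>UNIV. isgn k * (cnj (A $ k $ l) * cnj (x $ l) * y $ k))"
    by (simp add: herm_def matrix_vector_mult_def cnj_sum sum_distrib_left sum_distrib_right)
  also have "\<dots> = (\<Sum>l\<in>UNIV. \<Sum>k\<in>UNIV. isgn k * (cnj (A $ k $ l) * cnj (x $ l) * y $ k))"
    by (rule sum.swap)
  also have "\<dots> = herm x (dag A *v y)"
    by (simp add: herm_def matrix_vector_mult_def dag_nth sum_distrib_left ac_simps)
  finally show ?thesis .
qed

lemma herm_U: "A \<in> carrier U_group \<Longrightarrow> herm (A *v x) (A *v y) = herm x y"
  by (simp add: herm_dag matrix_vector_mul_assoc U_dag_left)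

lemma heis_form_eq: "heis_form v w = - Im (herm v w)"
  by (simp add: heis_form_def herm_option)

lemma heis_form_simps:
  "heis_form (x + y) z = heis_form x z + heis_form y z"
  "heis_form x (y + z) = heis_form x y + heis_form x z"
  "heis_form (r *\<^sub>R x) y = r * heis_form x y"
  "heis_form x (r *\<^sub>R y) = r * heis_form x y"
  "heis_form (- x) y = - heis_form x y"
  "heis_form x (- y) = - heis_form x y"
  "heis_form 0 y = 0" "heis_form x 0 = 0"
  by (simp_all add: heis_form_eq herm_add_left herm_add_right herm_scaleR_left herm_scaleR_right
      herm_minus_left herm_minus_right) (simp_all add: herm_def)

lemma heis_form_commute: "heis_form x y = - heis_form y x"
  unfolding heis_form_eq by (metis cnj.simps(2) herm_cnj)

lemma heis_form_self [simp]: "heis_form x x = 0"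
  using heis_form_commute[of x x] by simp

text \<open>The contragredient representation, which acts on the coordinates \<open>w\<close>.\<close>

definition ctr :: "'m::finite mat \<Rightarrow> 'm mat"
  where "ctr A = transpose (dag A)"

lemma ctr_nth: "ctr A $ i $ j = isgn i * isgn j * cnj (A $ i $ j)"
  by (simp add: ctr_def transpose_def dag_nth ac_simps)

lemma ctr_mult: "ctr (A ** B) = ctr A ** ctr B"
  by (simp add: ctr_def dag_mult matrix_transpose_mul)

lemma ctr_mat1 [simp]: "ctr (mat 1) = mat 1"
  by (simp add: ctr_def)

lemma dag_ctr: "dag (ctr A) = ctr (dag A)"
  by (simp add: vec_eq_iff ctr_nth dag_nth ac_simps)

lemma U_ctr: "A \<in> carrier U_group \<Longrightarrow> ctr A \<in> carrier U_group"
  by (simp add: mem_U_iff dag_ctr flip: ctr_mult)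

lemma heis_act_U: "A \<in> carrier U_group \<Longrightarrow> heis_act A h = (ctr A *v fst h, snd h)"
  by (cases h) (simp add: heis_act_def U_matrix_inv ctr_def)

lemma heis_form_ctr:
  "A \<in> carrier U_group \<Longrightarrow> heis_form (ctr A *v x) (ctr A *v y) = heis_form x y"
  by (simp add: heis_form_eq herm_U U_ctr)

text \<open>The complex bilinear pairing. \<open>w_form X dw\<close> is
  \<open>dotp (hlift X) dw\<close>, and the contragredient action on w is the one that preserves it
  (\<open>dotp_ctr\<close>).\<close>

definition dotp :: "complex^'k::finite \<Rightarrow> complex^'k \<Rightarrow> complex"
  where "dotp x y = (\<Sum>k\<in>UNIV. x $ k * y $ k)"

lemma dotp_transpose: "dotp (A *v x) y = dotp x (transpose A *v y)"
proof -
  have "dotp (A *v x) y = (\<Sum>k\<in>UNIV. \<Sum>l\<in>UNIV. A $ k $ l * x $ l * y $ k)"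
    by (simp add: dotp_def matrix_vector_mult_def sum_distrib_right)
  also have "\<dots> = (\<Sum>l\<in>UNIV. \<Sum>k\<in>UNIV. A $ k $ l * x $ l * y $ k)"
    by (rule sum.swap)
  also have "\<dots> = dotp x (transpose A *v y)"
    by (simp add: dotp_def matrix_vector_mult_def transpose_def sum_distrib_left ac_simps)
  finally show ?thesis .
qed

lemma dotp_ctr: "A \<in> carrier U_group \<Longrightarrow> dotp (A *v x) (ctr A *v y) = dotp x y"
  by (simp only: dotp_transpose ctr_def matrix_vector_mul_assoc matrix_transpose_mul[symmetric]
      U_dag_left transpose_mat matrix_vector_mul_lid)

lemma dotp_smult_left: "dotp (c *s x) y = c * dotp x y"
  by (simp add: dotp_def sum_distrib_left ac_simps)

section \<open>Fractional linear transformations of the ball\<close>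

text \<open>Tangent vectors of the affine chart \<open>hlift\<close> of projective space, which
  represents X by (1, X); hence the entry 0 at index \<open>None\<close>.\<close>

definition dlift :: "complex^'m::finite \<Rightarrow> complex^('m option)"
  where "dlift X = (\<chi> k. case k of None \<Rightarrow> 0 | Some a \<Rightarrow> X $ a)"

definition hlift :: "complex^'m::finite \<Rightarrow> complex^('m option)"
  where "hlift X = axis None 1 + dlift X"

lemma dlift_nth [simp]: "dlift X $ None = 0" "dlift X $ Some a = X $ a"
  by (simp_all add: dlift_def)

lemma hlift_nth [simp]: "hlift X $ None = 1" "hlift X $ Some a = X $ a"
  by (simp_all add: hlift_def axis_def)

definition jfac :: "'m::finite mat \<Rightarrow> complex^'m \<Rightarrow> complex"
  where "jfac g X = (g *v hlift X) $ None"

definition mob :: "'m::finite mat \<Rightarrow> complex^'m \<Rightarrow> complex^'m"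
  where "mob g X = (\<chi> a. (g *v hlift X) $ Some a / jfac g X)"

lemma norm_vec_sq: "(norm X)\<^sup>2 = (\<Sum>a\<in>UNIV. (norm (X $ a))\<^sup>2)"
  by (simp add: norm_vec_def L2_set_def sum_nonneg)

lemma cnj_mult_self: "cnj z * z = of_real ((norm z)\<^sup>2)"
  by (metis complex_norm_square mult.commute of_real_power)

lemma herm_self: "herm x x = of_real ((\<Sum>a\<in>UNIV. (norm (x $ Some a))\<^sup>2) - (norm (x $ None))\<^sup>2)"
  by (simp add: herm_option cnj_mult_self)

lemma herm_hlift: "herm (hlift X) (hlift X) = of_real ((norm X)\<^sup>2 - 1)"
  unfolding herm_self norm_vec_sq by simp

lemma hlift_mob: "jfac g X \<noteq> 0 \<Longrightarrow> hlift (mob g X) = (1 / jfac g X) *s (g *v hlift X)"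
  unfolding vec_eq_iff forall_option by (simp add: mob_def jfac_def)

text \<open>A vector whose entry at \<open>None\<close> vanishes has nonnegative
  \<open>herm\<close>-square, whereas \<open>hlift X\<close> and hence its image under g have a
  negative one.\<close>

lemma jfac_nonzero:
  assumes "g \<in> carrier U_group" "norm X < 1"
  shows "jfac g X \<noteq> 0"
proof
  assume "jfac g X = 0"
  then have "Re (herm (g *v hlift X) (g *v hlift X)) \<ge> 0"
    by (simp add: herm_self jfac_def sum_nonneg)
  then have "(norm X)\<^sup>2 \<ge> 1" by (simp add: herm_U assms(1) herm_hlift)
  then show False using assms(2) by (simp add: abs_square_less_1 linorder_not_less[symmetric])
qed

text \<open>The \<open>herm\<close>-square of \<open>hlift X\<close> is
  \<open>(norm X)\<^sup>2 - 1\<close>; it is preserved by g, and normalising the first coordinate of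
  the image divides it by the squared modulus of \<open>jfac g X\<close>.\<close>

lemma one_minus_norm_mob:
  assumes "g \<in> carrier U_group" "norm X < 1"
  shows "1 - (norm (mob g X))\<^sup>2 = (1 - (norm X)\<^sup>2) / (norm (jfac g X))\<^sup>2"
proof -
  have "herm (hlift (mob g X)) (hlift (mob g X)) = of_real (((norm X)\<^sup>2 - 1) / (norm (jfac g X))\<^sup>2)"
    using jfac_nonzero[OF assms] complex_norm_square[of "jfac g X"]
    by (simp add: hlift_mob herm_smult_left herm_smult_right herm_U assms(1) herm_hlift)
  then have "(norm (mob g X))\<^sup>2 - 1 = ((norm X)\<^sup>2 - 1) / (norm (jfac g X))\<^sup>2"
    unfolding herm_hlift of_real_eq_iff .
  then show ?thesis by (simp add: diff_divide_distrib)
qed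

lemma norm_mob_less_1:
  assumes "g \<in> carrier U_group" "norm X < 1"
  shows "norm (mob g X) < 1"
proof -
  have "(norm X)\<^sup>2 < 1" using assms(2) by (simp add: abs_square_less_1)
  then have "1 - (norm (mob g X))\<^sup>2 > 0"
    unfolding one_minus_norm_mob[OF assms] using jfac_nonzero[OF assms] by simp
  then show ?thesis by (simp add: abs_square_less_1)
qed

lemma jfac_mult: "jfac h X \<noteq> 0 \<Longrightarrow> jfac (g ** h) X = jfac g (mob h X) * jfac h X"
  by (simp add: jfac_def[of g] hlift_mob matrix_vector_mult_smult)
    (simp add: jfac_def matrix_vector_mul_assoc)

lemma mob_mult:
  assumes "jfac h X \<noteq> 0" "jfac (g ** h) X \<noteq> 0"
  shows "mob (g ** h) X = mob g (mob h X)"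
proof -
  have j: "jfac (g ** h) X = jfac g (mob h X) * jfac h X" by (rule jfac_mult[OF assms(1)])
  show ?thesis
    using assms unfolding vec_eq_iff mob_def[of "g ** h"] mob_def[of g]
    by (simp add: j) (simp add: hlift_mob matrix_vector_mult_smult matrix_vector_mul_assoc)
qed

lemma mob_one [simp]: "mob (mat 1) X = X" and jfac_one [simp]: "jfac (mat 1) X = 1"
  by (simp_all add: mob_def jfac_def vec_eq_iff)

lemma jfac_zero: "jfac g 0 = g $ None $ None"
  by (simp add: jfac_def matrix_vector_mult_def sum_option)

lemma jfac_eq: "jfac g X = g $ None $ None + (\<Sum>a\<in>UNIV. g $ None $ Some a * X $ a)"
  by (simp add: jfac_def matrix_vector_mult_def sum_option)

text \<open>The corner entry is \<open>jfac g 0\<close>, so this is the automorphy factor normalised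
  to 1 at the origin. For g in the group its values on the ball stay in the right half-plane, which
  makes the principal logarithm a globally smooth choice.\<close>

definition afac :: "'m::finite mat \<Rightarrow> complex^'m \<Rightarrow> complex"
  where "afac g X = jfac g X / g $ None $ None"

text \<open>The first row of an element of the group has \<open>herm\<close>-square \<open>-1\<close>.\<close>

lemma Re_afac_pos:
  assumes "g \<in> carrier U_group" "norm X < 1"
  shows "Re (afac g X) > 0" "g $ None $ None \<noteq> 0"
proof -
  let ?r = "\<chi> a. g $ None $ Some a"
  show nz: "g $ None $ None \<noteq> 0"
    using jfac_nonzero[OF assms(1), of 0] by (simp add: jfac_zero)
  have "(g ** dag g) $ None $ None = 1" using U_dag_right[OF assms(1)] by (simp add: mat_def)
  moreover have "(g ** dag g) $ None $ None
      = of_real ((norm (g $ None $ None))\<^sup>2) - (\<Sum>a\<in>UNIV. of_real ((norm (g $ None $ Some a))\<^sup>2))"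
    unfolding cnj_mult_self[symmetric]
    by (simp add: matrix_matrix_mult_def sum_option dag_nth sum_negf mult.commute)
  ultimately have "complex_of_real ((norm (g $ None $ None))\<^sup>2 - (\<Sum>a\<in>UNIV. (norm (g $ None $ Some a))\<^sup>2)) = of_real 1"
    by simp
  then have row: "(norm (g $ None $ None))\<^sup>2 = 1 + (norm ?r)\<^sup>2"
    unfolding of_real_eq_iff norm_vec_sq by simp
  then have "norm ?r < norm (g $ None $ None)"
    by (intro power2_less_imp_less[OF _ norm_ge_zero]) linarith
  \<comment> \<open>Cauchy-Schwarz bounds the part of \<open>jfac g X\<close> that depends on X
    strictly below the modulus of the corner entry; thus \<open>afac g X\<close> lies in the open
    unit disc about 1.\<close>
  have "norm (\<Sum>a\<in>UNIV. g $ None $ Some a * X $ a)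
      \<le> (\<Sum>a\<in>UNIV. \<bar>norm (?r $ a)\<bar> * \<bar>norm (X $ a)\<bar>)"
    by (intro sum_norm_le) (simp add: norm_mult)
  also have "\<dots> \<le> norm ?r * norm X"
    unfolding norm_vec_def[of ?r] norm_vec_def[of X] by (rule L2_set_mult_ineq)
  also have "\<dots> \<le> norm ?r" using assms(2) by (simp add: mult_left_le)
  also have "\<dots> < norm (g $ None $ None)" by fact
  finally have "norm ((\<Sum>a\<in>UNIV. g $ None $ Some a * X $ a) / g $ None $ None) < 1"
    using nz by (simp add: norm_divide)
  moreover have "afac g X = 1 + (\<Sum>a\<in>UNIV. g $ None $ Some a * X $ a) / g $ None $ None"
    using nz by (simp add: afac_def jfac_eq add_divide_distrib)
  ultimately show "Re (afac g X) > 0"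
    using abs_Re_le_cmod[of "(\<Sum>a\<in>UNIV. g $ None $ Some a * X $ a) / g $ None $ None"] by simp
qed

definition ash :: "'m::finite mat \<Rightarrow> complex^'m \<Rightarrow> real"
  where "ash g X = Im (Ln (afac g X))"

lemma ash_bound:
  assumes "g \<in> carrier U_group" "norm X < 1"
  shows "\<bar>ash g X\<bar> < pi / 2"
  unfolding ash_def using Re_Ln_pos_lt_imp[of "afac g X"] Re_afac_pos[OF assms] by fastforce

lemma ash_one [simp]: "ash (mat 1) X = 0"
  unfolding ash_def afac_def jfac_one by (simp add: mat_def)

lemma ash_zero: "g \<in> carrier U_group \<Longrightarrow> ash g 0 = 0"
  using Re_afac_pos(2)[of g 0] by (simp add: ash_def afac_def jfac_zero)

text \<open>The exponentials of both sides agree, and both sides are smaller than \<open>\<pi>\<close> in absolute value.\<close>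

lemma ash_cocycle:
  assumes g: "g \<in> carrier U_group" and h: "h \<in> carrier U_group" and X: "norm X < 1"
  shows "ash (g ** h) X + ash g (mob h 0) = ash g (mob h X) + ash h X"
proof -
  let ?a = "Ln (afac (g ** h) X) + Ln (afac g (mob h 0))"
  let ?b = "Ln (afac g (mob h X)) + Ln (afac h X)"
  have N: "norm (mob h X) < 1" "norm (mob h 0) < 1" using norm_mob_less_1[OF h] X by auto
  have U: "g ** h \<in> carrier U_group" by (rule U_mult[OF g h])
  have nz: "afac (g ** h) X \<noteq> 0" "afac g (mob h 0) \<noteq> 0" "afac g (mob h X) \<noteq> 0" "afac h X \<noteq> 0"
    using Re_afac_pos(1)[OF U X] Re_afac_pos(1)[OF g N(2)] Re_afac_pos(1)[OF g N(1)]
      Re_afac_pos(1)[OF h X] by auto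
  have h0: "jfac h 0 \<noteq> 0" "jfac h X \<noteq> 0" using jfac_nonzero[OF h] X by auto
  \<comment> \<open>The cocycle identity of \<open>jfac\<close> at X divided by the one at 0. The
    corner entry of \<open>g ** h\<close> is \<open>jfac g (mob h 0) * jfac h 0\<close>, which is
    where the point \<open>mob h 0\<close> enters.\<close>
  have "afac (g ** h) X * afac g (mob h 0) = afac g (mob h X) * afac h X"
    using Re_afac_pos(2)[OF g X] Re_afac_pos(2)[OF h X] Re_afac_pos(2)[OF U X] h0
      jfac_mult[OF h0(1), of g] jfac_mult[OF h0(2), of g]
    by (simp add: afac_def jfac_zero divide_simps)
  then have "exp ?a = exp ?b" using nz by (simp add: exp_add)
  then obtain n where n: "?a = ?b + (of_int (2 * n) * pi) * \<i>" unfolding exp_eq by blast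
  have "Im ?a = Im ?b + 2 * n * pi" unfolding n by simp
  moreover have "\<bar>Im ?a - Im ?b\<bar> < 2 * pi"
    using ash_bound[OF U X] ash_bound[OF g N(2)] ash_bound[OF g N(1)] ash_bound[OF h X]
    by (simp add: ash_def)
  ultimately have "\<bar>real_of_int n\<bar> * (2 * pi) < 1 * (2 * pi)" by (simp add: abs_mult)
  then have "\<bar>real_of_int n\<bar> < 1" using mult_less_cancel_right_pos[of "2 * pi"] pi_gt_zero by auto
  then have "n = 0" by linarith
  then show ?thesis using n by (simp add: ash_def flip: plus_complex.sel)
qed

section \<open>The action in coordinates\<close>

text \<open>
  A point of the universal covering group of the indefinite unitary group acts through its image \<open>g\<close>
  in the unitary group and a value \<open>\<theta>\<close> of the argument of the corner entry of \<open>g\<close>; the sum of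
  \<open>\<theta>\<close> and \<open>ash g X\<close> is then a value of the argument of the automorphy factor \<open>jfac g X\<close>.
\<close>

definition act :: "real \<Rightarrow> 'm::finite mat \<Rightarrow> real \<Rightarrow> 'm heis \<Rightarrow> 'm pt \<Rightarrow> 'm pt"
  where "act c g \<theta> h p =
    (mob g (fst p), (1/2) *\<^sub>R fst h + ctr g *v fst (snd p),
     fst (snd (snd p)) + snd h + heis_form (fst h) (ctr g *v fst (snd p)) - 2 * c * (\<theta> + ash g (fst p)),
     snd (snd (snd p)))"

lemma matrix_vector_scaleR:
  fixes A :: "complex^'n::finite^'k::finite"
  shows "A *v (r *\<^sub>R x) = r *\<^sub>R (A *v x)" "(r *\<^sub>R A) *v x = r *\<^sub>R (A *v x)"
  by (simp_all add: vec_eq_iff matrix_vector_mult_def scaleR_sum_right)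

lemma mem_Nbar: "p \<in> Nbar \<longleftrightarrow> norm (fst p) < 1 \<and> snd (snd (snd p)) > 0"
  by (cases p) (simp add: Nbar_def)

lemma open_Nbar: "open (Nbar :: ('m::finite) pt set)"
proof -
  have "Nbar = {p :: 'm pt. norm (fst p) < 1} \<inter> {p. 0 < snd (snd (snd p))}"
    by (auto simp: mem_Nbar)
  moreover have "open {p :: 'm pt. norm (fst p) < 1}" "open {p :: 'm pt. 0 < snd (snd (snd p))}"
    by (intro open_Collect_less continuous_intros)+
  ultimately show ?thesis by (metis open_Int)
qed

lemma act_Nbar: "g \<in> carrier U_group \<Longrightarrow> p \<in> Nbar \<Longrightarrow> act c g \<theta> h p \<in> Nbar"
  by (simp add: mem_Nbar act_def norm_mob_less_1)

lemma act_one: "act c (mat 1) 0 (0, 0) p = p"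
  by (simp add: act_def heis_form_simps)

text \<open>Over the identity matrix and with central Heisenberg part only \<phi> moves; these are
  the maps that make up F' and the deck transformations.\<close>

lemma act_shift: "act c (mat 1) \<theta> (0, t) p = p + (0, 0, t - 2 * c * \<theta>, 0)"
  by (cases p) (simp add: act_def heis_form_simps)

text \<open>The Heisenberg parts match because \<open>ctr g\<close> preserves
  \<open>heis_form\<close>. By \<open>ash_cocycle\<close> the arguments add up to that of
  \<open>g ** g'\<close>, except for the summand \<open>ash g (mob g' 0)\<close>, which does not
  depend on the point and is absorbed into \<theta>.\<close>

lemma act_compose:
  assumes "g \<in> carrier U_group" "g' \<in> carrier U_group" "p \<in> Nbar"
  shows "act c g \<theta> h (act c g' \<theta>' h' p) =
    act c (g ** g') (\<theta> + \<theta>' + ash g (mob g' 0)) (h \<otimes>\<^bsub>Heis\<^esub> heis_act g h') p"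
proof -
  have X: "norm (fst p) < 1" using assms(3) by (simp add: mem_Nbar)
  obtain v t where h: "h = (v, t)" by fastforce
  obtain v' t' where h': "h' = (v', t')" by fastforce
  have hh: "h \<otimes>\<^bsub>Heis\<^esub> heis_act g h' = (v + ctr g *v v', t + t' + heis_form v (ctr g *v v') / 2)"
    by (simp add: h h' Heis_def heis_act_U assms(1))
  have "mob g (mob g' (fst p)) = mob (g ** g') (fst p)"
    using mob_mult jfac_nonzero assms X U_mult by metis
  moreover have "ash g (mob g' (fst p)) = ash (g ** g') (fst p) + ash g (mob g' 0) - ash g' (fst p)"
    using ash_cocycle[OF assms(1,2) X] by simp
  ultimately show ?thesis
    unfolding hh
    by (simp add: act_def h h' ctr_mult matrix_vector_mul_assoc matrix_vector_right_distrib
        heis_form_simps scaleR_add_right matrix_vector_scaleR heis_form_ctr[OF assms(1)]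
        flip: matrix_vector_mul_assoc) (simp add: algebra_simps)
qed

subsection \<open>Differentiability\<close>

lemma bounded_bilinear_matrix_vector:
  "bounded_bilinear ((*v) :: complex^'n::finite^'k::finite \<Rightarrow> complex^'n \<Rightarrow> complex^'k)"
  unfolding bilinear_conv_bounded_bilinear[symmetric] bilinear_def
  by (auto intro!: linearI simp: matrix_vector_right_distrib matrix_vector_mult_add_rdistrib
      matrix_vector_scaleR)

lemma bounded_bilinear_heis_form: "bounded_bilinear heis_form"
  unfolding bilinear_conv_bounded_bilinear[symmetric] bilinear_def
  by (auto intro!: linearI simp: heis_form_simps)

lemma bounded_linear_ctr: "bounded_linear ctr"
  unfolding linear_conv_bounded_linear[symmetric]
  by (rule linearI) (simp_all add: vec_eq_iff ctr_nth algebra_simps)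

lemma bounded_linear_dag: "bounded_linear dag"
  unfolding linear_conv_bounded_linear[symmetric]
  by (rule linearI) (simp_all add: dag_add dag_scaleR)

lemma bounded_linear_dlift: "bounded_linear dlift"
  unfolding linear_conv_bounded_linear[symmetric]
  by (rule linearI) (simp_all add: vec_eq_iff forall_option)

lemma has_derivative_Ln_compose:
  assumes "(f has_derivative f') (at x within S)" "Re (f x) > 0"
  shows "((\<lambda>x. Ln (f x)) has_derivative (\<lambda>v. f' v / f x)) (at x within S)"
proof -
  have "f x \<notin> \<real>\<^sub>\<le>\<^sub>0" using assms(2) by (auto simp: complex_nonpos_Reals_iff)
  then have "(Ln has_derivative (\<lambda>v. inverse (f x) * v)) (at (f x))"
    using has_field_derivative_Ln by (simp add: has_field_derivative_def)
  from has_derivative_compose[OF assms(1) this] show ?thesis by (simp add: field_simps)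
qed

lemma has_derivative_divide_complex:
  fixes f g :: "'a::real_normed_vector \<Rightarrow> complex"
  assumes "(f has_derivative f') (at x within S)" "(g has_derivative g') (at x within S)" "g x \<noteq> 0"
  shows "((\<lambda>x. f x / g x) has_derivative (\<lambda>v. (f' v - f x / g x * g' v) / g x)) (at x within S)"
  by (rule has_derivative_eq_rhs[OF has_derivative_divide[OF assms]])
    (use assms(3) in \<open>auto simp: fun_eq_iff field_simps\<close>)

lemma has_derivative_vec_lambda:
  fixes f :: "'n::finite \<Rightarrow> 'a::real_normed_vector \<Rightarrow> 'b::real_normed_vector"
  assumes "\<And>i. (f i has_derivative f' i) F"
  shows "((\<lambda>x. \<chi> i. f i x) has_derivative (\<lambda>v. \<chi> i. f' i v)) F"
  unfolding vec_lambda_eq_sum_axis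
  by (intro has_derivative_sum bounded_linear.has_derivative[OF bounded_linear_axis] assms)

text \<open>The total derivative of \<open>mob\<close> at (g, X), with the matrix moving in
  direction A and the point in direction dX.\<close>

definition dmob :: "'m::finite mat \<Rightarrow> complex^'m \<Rightarrow> 'm mat \<Rightarrow> complex^'m \<Rightarrow> complex^'m"
  where "dmob g X A dX =
    (let u = A *v hlift X + g *v dlift dX in (\<chi> a. (u $ Some a - mob g X $ a * u $ None) / jfac g X))"

text \<open>The total derivative of \<open>act\<close> in g, h and p. There is no direction for
  \<theta>: it is held constant here, and its motion along a path is added afterwards by means of
  \<open>act_arg\<close>.\<close>

definition dact :: "real \<Rightarrow> 'm::finite mat \<Rightarrow> 'm heis \<Rightarrow> 'm pt \<Rightarrow> 'm mat \<Rightarrow> 'm heis \<Rightarrow> 'm pt \<Rightarrow> 'm pt"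
  where "dact c g h p A \<eta> q =
    (let u = A *v hlift (fst p) + g *v dlift (fst q); w = ctr A *v fst (snd p) + ctr g *v fst (snd q) in
     (dmob g (fst p) A (fst q), (1/2) *\<^sub>R fst \<eta> + w,
      fst (snd (snd q)) + snd \<eta> + heis_form (fst \<eta>) (ctr g *v fst (snd p)) + heis_form (fst h) w
        - 2 * c * Im (u $ None / jfac g (fst p) - A $ None $ None / g $ None $ None),
      snd (snd (snd q))))"

lemma has_derivative_matrix_hlift:
  assumes "(G has_derivative G') (at t within S)" "(Y has_derivative Y') (at t within S)"
  shows "((\<lambda>s. G s *v hlift (Y s)) has_derivative (\<lambda>d. G' d *v hlift (Y t) + G t *v dlift (Y' d)))
    (at t within S)"
proof -
  have "((\<lambda>s. hlift (Y s)) has_derivative (\<lambda>d. dlift (Y' d))) (at t within S)"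
    unfolding hlift_def
    using has_derivative_add[OF has_derivative_const
        bounded_linear.has_derivative[OF bounded_linear_dlift assms(2)]] by simp
  from bounded_bilinear.FDERIV[OF bounded_bilinear_matrix_vector assms(1) this]
  show ?thesis by (simp add: add.commute)
qed

text \<open>Stated for a moving matrix, a moving Heisenberg element and a moving point at once:
  constant G and H give the differential of an isometry, curves give the velocities of the
  action.\<close>

lemma has_derivative_act:
  fixes G :: "'a::real_normed_vector \<Rightarrow> 'm::finite mat"
  assumes G: "(G has_derivative G') (at t within S)"
    and H: "(H has_derivative H') (at t within S)"
    and P: "(P has_derivative P') (at t within S)"
    and U: "G t \<in> carrier U_group" and N: "norm (fst (P t)) < 1"
  shows "((\<lambda>s. act c (G s) \<theta> (H s) (P s)) has_derivative
    (\<lambda>d. dact c (G t) (H t) (P t) (G' d) (H' d) (P' d))) (at t within S)"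
proof -
  let ?X = "fst (P t)"
  let ?u = "\<lambda>d. G' d *v hlift ?X + G t *v dlift (fst (P' d))"
  let ?w = "\<lambda>d. ctr (G' d) *v fst (snd (P t)) + ctr (G t) *v fst (snd (P' d))"
  note PX = has_derivative_fst[OF P]
  note nz = jfac_nonzero[OF U N] Re_afac_pos[OF U N]
  note u = has_derivative_matrix_hlift[OF G PX]
  have uk: "((\<lambda>s. (G s *v hlift (fst (P s))) $ k) has_derivative (\<lambda>d. ?u d $ k)) (at t within S)" for k
    by (rule bounded_linear.has_derivative[OF bounded_linear_vec_nth u])
  have j: "((\<lambda>s. jfac (G s) (fst (P s))) has_derivative (\<lambda>d. ?u d $ None)) (at t within S)"
    unfolding jfac_def by (rule uk)
  have mob: "((\<lambda>s. mob (G s) (fst (P s))) has_derivative (\<lambda>d. dmob (G t) ?X (G' d) (fst (P' d)))) (at t within S)"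
    unfolding mob_def[of "G _"] dmob_def Let_def
    by (rule has_derivative_vec_lambda)
      (use has_derivative_divide_complex[OF uk j nz(1)] in \<open>simp add: mob_def\<close>)
  have g00: "((\<lambda>s. G s $ None $ None) has_derivative (\<lambda>d. G' d $ None $ None)) (at t within S)"
    by (intro bounded_linear.has_derivative[OF bounded_linear_vec_nth] G)
  have af: "((\<lambda>s. afac (G s) (fst (P s))) has_derivative
      (\<lambda>d. (?u d $ None - afac (G t) ?X * G' d $ None $ None) / G t $ None $ None)) (at t within S)"
    unfolding afac_def by (rule has_derivative_divide_complex[OF j g00 nz(3)])
  have ash: "((\<lambda>s. ash (G s) (fst (P s))) has_derivative
      (\<lambda>d. Im (?u d $ None / jfac (G t) ?X - G' d $ None $ None / G t $ None $ None))) (at t within S)"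
    unfolding ash_def
    by (rule has_derivative_eq_rhs[OF bounded_linear.has_derivative[OF bounded_linear_Im
          has_derivative_Ln_compose[OF af nz(2)]]])
      (use nz(1,3) in \<open>auto simp: fun_eq_iff afac_def field_simps intro!: arg_cong[of _ _ Im]\<close>)
  have w: "((\<lambda>s. ctr (G s) *v fst (snd (P s))) has_derivative ?w) (at t within S)"
    using bounded_bilinear.FDERIV[OF bounded_bilinear_matrix_vector
        bounded_linear.has_derivative[OF bounded_linear_ctr G] has_derivative_fst[OF has_derivative_snd[OF P]]]
    by (simp add: add.commute)
  have hf: "((\<lambda>s. heis_form (fst (H s)) (ctr (G s) *v fst (snd (P s)))) has_derivative
      (\<lambda>d. heis_form (fst (H' d)) (ctr (G t) *v fst (snd (P t))) + heis_form (fst (H t)) (?w d))) (at t within S)"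
    using bounded_bilinear.FDERIV[OF bounded_bilinear_heis_form has_derivative_fst[OF H] w]
    by (simp add: add.commute)
  show ?thesis
    unfolding act_def dact_def Let_def
    by (rule has_derivative_eq_rhs, (rule derivative_intros mob w hf ash H P)+)
      (auto simp: fun_eq_iff algebra_simps)
qed

lemma smooth_on_act:
  assumes g: "g \<in> carrier U_group"
  shows "smooth_on Nbar (act c g \<theta> h)"
proof -
  note S = open_Nbar
  have lin: "bounded_linear (\<lambda>p :: 'a pt. fst p)" "bounded_linear (\<lambda>p :: 'a pt. fst (snd p))"
    "bounded_linear (\<lambda>p :: 'a pt. fst (snd (snd p)))" "bounded_linear (\<lambda>p :: 'a pt. snd (snd (snd p)))"
    by (intro bounded_linear_fst_comp bounded_linear_snd_comp bounded_linear_fst bounded_linear_snd)+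
  note sl = lin[THEN smooth_on_linear[OF S]]
  have u: "smooth_on Nbar (\<lambda>p. g *v hlift (fst p))"
    unfolding hlift_def
    by (rule smooth_on_bounded_linear[OF S matrix_vector_mul_bounded_linear]
        smooth_on_add[OF S] smooth_on_const[OF S]
        smooth_on_bounded_linear[OF S bounded_linear_dlift] sl(1))+
  have uk: "smooth_on Nbar (\<lambda>p. (g *v hlift (fst p)) $ k)" for k
    by (rule smooth_on_bounded_linear[OF S bounded_linear_vec_nth u])
  have nz: "jfac g (fst p) \<noteq> 0" "Re (afac g (fst p)) > 0" "g $ None $ None \<noteq> 0" if "p \<in> Nbar" for p
    using jfac_nonzero[OF g] Re_afac_pos[OF g] that by (auto simp: mem_Nbar)
  have mob: "smooth_on Nbar (\<lambda>p. mob g (fst p))"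
    unfolding mob_def jfac_def
    by (intro smooth_on_vec smooth_on_divide uk S) (use nz in \<open>simp add: jfac_def\<close>)
  have "smooth_on Nbar (\<lambda>p. afac g (fst p))"
    unfolding afac_def jfac_def
    by (intro smooth_on_divide uk S smooth_on_const) (use nz in simp)
  then have ash: "smooth_on Nbar (\<lambda>p. ash g (fst p))"
    unfolding ash_def
    by (intro smooth_on_bounded_linear[OF S bounded_linear_Im] smooth_on_Ln S nz)
  have w: "smooth_on Nbar (\<lambda>p. ctr g *v fst (snd p))"
    by (rule smooth_on_bounded_linear[OF S matrix_vector_mul_bounded_linear sl(2)])
  have hf: "smooth_on Nbar (\<lambda>p. heis_form (fst h) (ctr g *v fst (snd p)))"
    by (rule smooth_on_bounded_linear[OF S bounded_bilinear.bounded_linear_right[OF bounded_bilinear_heis_form] w])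
  show ?thesis
    unfolding act_def
    by (intro smooth_on_Pair smooth_on_add smooth_on_diff smooth_on_mult smooth_on_const S mob ash w hf sl)
qed

subsection \<open>Invariance of the metric\<close>

text \<open>All ingredients of the metric are rewritten in terms of the lift (1, X), on which the
  group acts linearly, so that their transformation follows from the invariance of
  \<open>herm\<close> and \<open>dotp\<close>.\<close>

lemma metric_eq:
  fixes X :: "complex^'m::finite"
  defines "N \<equiv> 1 - (norm X)\<^sup>2" and "Z \<equiv> hlift X"
  shows "contact_form c (X, w, \<phi>, \<rho>) (dX, dw, d\<phi>, d\<rho>) =
      d\<phi> - 2 * heis_form w dw + 2 * c * Im (herm Z (dlift dX) / N)"
    and "g_CH X dX dX' =
      Re (N * herm (dlift dX) (dlift dX') + herm (dlift dX) Z * herm Z (dlift dX')) / N\<^sup>2"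
    and "w_form X dw = dotp Z dw"
    and "dw $ None \<bullet> dw' $ None - (\<Sum>a\<in>UNIV. dw $ Some a \<bullet> dw' $ Some a) = - Re (herm dw dw')"
proof -
  have CH: "CH_form X dX = herm Z (dlift dX)" for dX
    by (simp add: CH_form_def herm_option Z_def)
  show "contact_form c (X, w, \<phi>, \<rho>) (dX, dw, d\<phi>, d\<rho>) =
      d\<phi> - 2 * heis_form w dw + 2 * c * Im (herm Z (dlift dX) / N)"
    by (simp add: contact_form_def CH heis_form_def N_def)
  have inner: "z \<bullet> z' = Re (cnj z * z')" for z z' :: complex
    by (simp add: inner_complex_def)
  have "(\<Sum>a\<in>UNIV. dX $ a \<bullet> dX' $ a) = Re (herm (dlift dX) (dlift dX'))"
    by (simp add: herm_option inner)
  moreover have "CH_form X dX \<bullet> CH_form X dX' = Re (herm (dlift dX) Z * herm Z (dlift dX'))"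
    by (simp only: CH inner herm_cnj)
  ultimately show "g_CH X dX dX' =
      Re (N * herm (dlift dX) (dlift dX') + herm (dlift dX) Z * herm Z (dlift dX')) / N\<^sup>2"
    unfolding g_CH_def N_def[symmetric]
    by (cases "N = 0") (simp_all add: field_simps power2_eq_square)
  show "w_form X dw = dotp Z dw"
    by (simp add: w_form_def dotp_def sum_option Z_def)
  show "dw $ None \<bullet> dw' $ None - (\<Sum>a\<in>UNIV. dw $ Some a \<bullet> dw' $ Some a) = - Re (herm dw dw')"
    by (simp add: herm_option inner)
qed

lemma metric_act:
  assumes g: "g \<in> carrier U_group" and p: "p \<in> Nbar"
  shows "metric c (act c g \<theta> h p) (dact c g h p 0 0 u) (dact c g h p 0 0 v) = metric c p u v"
proof -
  obtain X w \<phi> \<rho> where p_eq: "p = (X, w, \<phi>, \<rho>)" by (metis prod_cases4)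
  obtain dX dw d\<phi> d\<rho> where u_eq: "u = (dX, dw, d\<phi>, d\<rho>)" by (metis prod_cases4)
  obtain dX' dw' d\<phi>' d\<rho>' where v_eq: "v = (dX', dw', d\<phi>', d\<rho>')" by (metis prod_cases4)
  have X: "norm X < 1" using p by (simp add: p_eq mem_Nbar)
  define N J where "N = 1 - (norm X)\<^sup>2" and "J = jfac g X"
  define N' where "N' = 1 - (norm (mob g X))\<^sup>2"
  have J: "J \<noteq> 0" unfolding J_def by (rule jfac_nonzero[OF g X])
  have N: "N > 0" using X by (simp add: N_def abs_square_less_1)
  have N': "N' = N / (norm J)\<^sup>2" unfolding N_def N'_def J_def by (rule one_minus_norm_mob[OF g X])
  have JJ: "complex_of_real ((norm J)\<^sup>2) = J * cnj J" by (simp only: complex_norm_square)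
  have N'c: "complex_of_real N' = N / (J * cnj J)" by (simp only: N' of_real_divide JJ)
  define Z Z' where "Z = hlift X" and "Z' = hlift (mob g X)"
  have Z': "Z' = (1 / J) *s (g *v Z)" unfolding Z'_def Z_def J_def
    by (rule hlift_mob) (use J J_def in simp)
  have hZZ: "herm Z Z = - complex_of_real N" by (simp add: Z_def herm_hlift N_def)
  \<comment> \<open>The logarithmic derivative of the automorphy factor at X in the direction
    d.\<close>
  define l where "l d = (g *v dlift d) $ None / J" for d
  define D where "D d = dlift (dmob g X 0 d)" for d
  \<comment> \<open>Differentiating \<open>Z' = (1 / J) *s (g *v Z)\<close> subtracts from d the
    multiple \<open>l d\<close> of Z, because J varies as well.\<close>
  have D: "D d = (1 / J) *s (g *v (dlift d - l d *s Z))" for d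
  proof -
    have lJ: "(g *v dlift d) $ None = l d * J" using J by (simp add: l_def)
    have Jg: "(g *v Z) $ None = J" by (simp add: J_def jfac_def Z_def)
    have "D d $ k = (1 / J) * ((g *v dlift d) $ k - l d * (g *v Z) $ k)" for k
    proof (cases k)
      case None
      then show ?thesis by (simp add: D_def lJ Jg)
    next
      case (Some a)
      then show ?thesis
        unfolding D_def dmob_def mob_def Let_def Z_def[symmetric] J_def[symmetric]
        by (simp add: lJ diff_divide_distrib)
    qed
    then show ?thesis
      by (simp add: vec_eq_iff matrix_vector_mult_diff_distrib matrix_vector_mult_smult diff_divide_distrib)
  qed
  have hZD: "herm Z' (D d) = (herm Z (dlift d) + N * l d) / (J * cnj J)" for d
    unfolding Z' D herm_smult_left herm_smult_right herm_U[OF g]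
    by (simp add: herm_diff_right herm_smult_right hZZ field_simps J)
  have hDZ: "herm (D d) Z' = (herm (dlift d) Z + N * cnj (l d)) / (J * cnj J)" for d
    using arg_cong[OF hZD[of d], of cnj] by (simp add: herm_cnj mult.commute)
  have hDD: "herm (D d) (D d') = (herm (dlift d) (dlift d') - herm (dlift d) Z * l d'
      - cnj (l d) * herm Z (dlift d') - cnj (l d) * l d' * N) / (J * cnj J)" for d d'
    unfolding D herm_smult_left herm_smult_right herm_U[OF g]
    by (simp add: herm_diff_right herm_diff_left herm_smult_right herm_smult_left hZZ field_simps J)
  have c0: "ctr 0 = (0 :: 'a mat)" by (simp add: vec_eq_iff ctr_nth)
  \<comment> \<open>The last summand of the contact form gains \<open>2 * c * Im (l d)\<close>,
    which the derivative of the translation of \<phi> removes. The Heisenberg term of \<phi>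
    likewise cancels against the shift of w, whose factor 1/2 meets the factor 2 in front of
    \<open>heis_form\<close>.\<close>
  have contact: "contact_form c (act c g \<theta> h p) (dact c g h p 0 0 (d, e, f, r)) =
      contact_form c p (d, e, f, r)" for d e f r
  proof -
    have "herm Z' (D d) / N' = herm Z (dlift d) / N + l d"
      unfolding hZD N'c using J N by (simp add: field_simps)
    then show ?thesis
      unfolding p_eq act_def dact_def Let_def metric_eq fst_conv snd_conv
      by (simp add: Z_def[symmetric] Z'_def[symmetric] D_def[symmetric] N_def[symmetric]
          N'_def[symmetric] heis_form_simps heis_form_ctr[OF g] l_def[symmetric] J_def[symmetric] c0)
        (simp add: algebra_simps)
  qed
  \<comment> \<open>All terms with \<open>l\<close> cancel in the combination of \<open>hDD\<close>
    with the product of \<open>hDZ\<close> and \<open>hZD\<close>; only the factor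
    \<open>(J * cnj J)\<^sup>2\<close> remains, and \<open>N'\<^sup>2\<close> absorbs it.\<close>
  have gCH: "g_CH (mob g X) (dmob g X 0 dX) (dmob g X 0 dX') = g_CH X dX dX'"
  proof -
    have "(N' * herm (D dX) (D dX') + herm (D dX) Z' * herm Z' (D dX')) =
      (N * herm (dlift dX) (dlift dX') + herm (dlift dX) Z * herm Z (dlift dX')) / (J * cnj J)\<^sup>2"
      unfolding hDD hDZ hZD N'c using J by (simp add: field_simps power2_eq_square)
    also have "\<dots> = (N * herm (dlift dX) (dlift dX') + herm (dlift dX) Z * herm Z (dlift dX'))
        / complex_of_real (((norm J)\<^sup>2)\<^sup>2)"
      unfolding JJ[symmetric] by simp
    finally have eq: "N' * herm (D dX) (D dX') + herm (D dX) Z' * herm Z' (D dX') =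
        (N * herm (dlift dX) (dlift dX') + herm (dlift dX) Z * herm Z (dlift dX'))
        / complex_of_real (((norm J)\<^sup>2)\<^sup>2)" .
    have "a / ((norm J)\<^sup>2)\<^sup>2 / (N')\<^sup>2 = a / N\<^sup>2" for a
      using J by (simp add: N' power_divide)
    then show ?thesis
      unfolding metric_eq N_def[symmetric] N'_def[symmetric] Z_def[symmetric] Z'_def[symmetric]
        D_def[symmetric] eq Re_divide_of_real .
  qed
  \<comment> \<open>The lift is divided by J while the pairing with the contragredient action is
    preserved; the squared modulus of J then cancels against \<open>N'\<close>.\<close>
  have wf: "w_form (mob g X) (ctr g *v e) = w_form X e / J" for e
    unfolding metric_eq Z_def[symmetric] Z'_def[symmetric] Z' dotp_smult_left dotp_ctr[OF g] by simp
  have "(a / J) \<bullet> (b / J) = (a \<bullet> b) / (norm J)\<^sup>2" for a b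
  proof -
    have "cnj (a / J) * (b / J) = cnj a * b / complex_of_real ((norm J)\<^sup>2)"
      unfolding JJ by (simp add: mult.commute)
    then have "Re (cnj (a / J) * (b / J)) = Re (cnj a * b) / (norm J)\<^sup>2"
      by (simp only: Re_divide_of_real)
    moreover have "z \<bullet> z' = Re (cnj z * z')" for z z' :: complex
      by (simp add: inner_complex_def)
    ultimately show ?thesis by (simp only:)
  qed
  then have ww: "2 / N' * (w_form (mob g X) (ctr g *v e) \<bullet> w_form (mob g X) (ctr g *v e'))
      = 2 / N * (w_form X e \<bullet> w_form X e')" for e e'
    unfolding wf N' using J by simp
  have proj: "metric c p u v = (snd (snd (snd p)) + c) / snd (snd (snd p)) * g_CH (fst p) (fst u) (fst v)
      + 1 / (4 * (snd (snd (snd p)))\<^sup>2) * ((snd (snd (snd p)) + 2 * c) / (snd (snd (snd p)) + c)) *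
          (snd (snd (snd u)) * snd (snd (snd v)))
      + 1 / snd (snd (snd p)) * Re (herm (fst (snd u)) (fst (snd v)))
      + (snd (snd (snd p)) + c) / (snd (snd (snd p)))\<^sup>2 *
          (2 / (1 - (norm (fst p))\<^sup>2) * (w_form (fst p) (fst (snd u)) \<bullet> w_form (fst p) (fst (snd v))))
      + 1 / (4 * (snd (snd (snd p)))\<^sup>2) * ((snd (snd (snd p)) + c) / (snd (snd (snd p)) + 2 * c)) *
          (contact_form c p u * contact_form c p v)" for p u v :: "'a pt"
    by (cases p; cases u; cases v) (simp add: metric_def metric_eq(4))
  have comp: "fst (act c g \<theta> h p) = mob g X" "snd (snd (snd (act c g \<theta> h p))) = \<rho>"
    "fst (dact c g h p 0 0 (d, e, f, r)) = dmob g X 0 d"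
    "fst (snd (dact c g h p 0 0 (d, e, f, r))) = ctr g *v e"
    "snd (snd (snd (dact c g h p 0 0 (d, e, f, r)))) = r" for d e f r
    by (simp_all add: act_def dact_def Let_def p_eq c0)
  show ?thesis
    unfolding proj[of "act c g \<theta> h p"] proj[of p] u_eq v_eq contact comp N'_def[symmetric] ww gCH
      herm_U[OF U_ctr[OF g]]
    by (simp add: p_eq N_def)
qed

section \<open>Covering groups\<close>

lemma bounded_bilinear_matrix_matrix:
  "bounded_bilinear ((**) :: complex^'n::finite^'k::finite \<Rightarrow> complex^'l::finite^'n \<Rightarrow> complex^'l^'k)"
  unfolding bilinear_conv_bounded_bilinear[symmetric] bilinear_def
  by (auto intro!: linearI simp: vec_eq_iff matrix_matrix_mult_def algebra_simps sum.distrib scaleR_sum_right)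

lemmas continuous_on_matrix_mult = bounded_bilinear.continuous_on[OF bounded_bilinear_matrix_matrix]

lemma continuous_on_dag: "continuous_on S f \<Longrightarrow> continuous_on S (\<lambda>x. dag (f x))"
  by (rule bounded_linear.continuous_on[OF bounded_linear_dag])

text \<open>Treats the covering groups of U(1,n-1) and SU(1,n-1) together. As the carrier lies in
  \<open>U_group\<close>, closure under \<open>dag\<close> is closure under inverses.\<close>

locale matrix_subgroup =
  fixes G :: "'m::finite mat monoid"
  assumes mult_eq [simp]: "mult G = (**)" and one_eq [simp]: "one G = mat 1"
    and carrier_subset: "carrier G \<subseteq> carrier U_group"
    and mult_closed: "A \<in> carrier G \<Longrightarrow> B \<in> carrier G \<Longrightarrow> A ** B \<in> carrier G"
    and one_closed: "mat 1 \<in> carrier G"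
    and dag_closed: "A \<in> carrier G \<Longrightarrow> dag A \<in> carrier G"
begin

definition based :: "(real \<Rightarrow> 'm mat) \<Rightarrow> bool"
  where "based \<gamma> \<longleftrightarrow> path \<gamma> \<and> path_image \<gamma> \<subseteq> carrier G \<and> pathstart \<gamma> = mat 1"

lemma basedI:
  "continuous_on {0..1} \<gamma> \<Longrightarrow> (\<And>t. t \<in> {0..1} \<Longrightarrow> \<gamma> t \<in> carrier G) \<Longrightarrow> \<gamma> 0 = mat 1 \<Longrightarrow> based \<gamma>"
  by (auto simp: based_def path_def path_image_def pathstart_def)

lemma basedD:
  assumes "based \<gamma>"
  shows "continuous_on {0..1} \<gamma>" "t \<in> {0..1} \<Longrightarrow> \<gamma> t \<in> carrier G" "\<gamma> 0 = mat 1"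
  using assms by (auto simp: based_def path_def path_image_def pathstart_def)

lemma basedD_U: "based \<gamma> \<Longrightarrow> t \<in> {0..1} \<Longrightarrow> \<gamma> t \<in> carrier U_group"
  using basedD(2) carrier_subset by blast

lemma group_G: "group G"
proof (rule groupI)
  show "\<exists>B\<in>carrier G. B \<otimes>\<^bsub>G\<^esub> A = \<one>\<^bsub>G\<^esub>" if "A \<in> carrier G" for A
    using that dag_closed carrier_subset by (auto intro!: bexI[of _ "dag A"] U_dag_left)
qed (simp_all add: mult_closed one_closed matrix_mul_assoc)

lemma path_class_eqI:
  assumes "homotopic_paths (carrier G) \<gamma> \<delta>"
  shows "path_class G \<gamma> = path_class G \<delta>"
  unfolding path_class_def
  using assms homotopic_paths_trans homotopic_paths_sym by blast

lemma mem_path_class: "based \<gamma> \<Longrightarrow> \<gamma> \<in> path_class G \<gamma>"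
  by (simp add: path_class_def based_def)

lemma path_class_cong: "based \<gamma> \<Longrightarrow> (\<And>t. t \<in> {0..1} \<Longrightarrow> \<gamma> t = \<delta> t) \<Longrightarrow> path_class G \<gamma> = path_class G \<delta>"
  by (intro path_class_eqI homotopic_paths_eq) (auto simp: based_def)

lemma carrier_cover: "carrier (cover G) = path_class G ` Collect based"
  by (auto simp: cover_def based_def)

lemma path_class_in_cover: "based \<gamma> \<Longrightarrow> path_class G \<gamma> \<in> carrier (cover G)"
  by (simp add: carrier_cover)

lemma coverE:
  assumes "x \<in> carrier (cover G)"
  obtains \<gamma> where "based \<gamma>" "x = path_class G \<gamma>"
  using assms by (auto simp: carrier_cover)

lemma based_mult: "based \<gamma> \<Longrightarrow> based \<delta> \<Longrightarrow> based (\<lambda>t. \<gamma> t ** \<delta> t)"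
  by (intro basedI continuous_on_matrix_mult mult_closed) (auto simp: basedD)

lemma based_dag: "based \<gamma> \<Longrightarrow> based (\<lambda>t. dag (\<gamma> t))"
  by (intro basedI continuous_on_dag dag_closed) (auto simp: basedD)

lemma based_one: "based (\<lambda>t. mat 1)"
  by (intro basedI) (auto simp: one_closed)

text \<open>The pointwise product of two homotopies is a homotopy, since matrix multiplication is
  continuous and the carrier is closed under it.\<close>

lemma homotopic_paths_mult:
  assumes "homotopic_paths (carrier G) \<gamma> \<gamma>'" "homotopic_paths (carrier G) \<delta> \<delta>'"
  shows "homotopic_paths (carrier G) (\<lambda>t. \<gamma> t ** \<delta> t) (\<lambda>t. \<gamma>' t ** \<delta>' t)"
proof -
  obtain h where h: "continuous_on ({0..1} \<times> {0..1}) h" "h \<in> ({0..1} \<times> {0..1}) \<rightarrow> carrier G"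
    "\<forall>x \<in> {0..1}. h (0,x) = \<gamma> x" "\<forall>x \<in> {0..1}. h (1,x) = \<gamma>' x"
    "\<forall>t \<in> {0..1::real}. pathstart(h \<circ> Pair t) = pathstart \<gamma> \<and> pathfinish(h \<circ> Pair t) = pathfinish \<gamma>"
    using assms(1) unfolding homotopic_paths by blast
  obtain k where k: "continuous_on ({0..1} \<times> {0..1}) k" "k \<in> ({0..1} \<times> {0..1}) \<rightarrow> carrier G"
    "\<forall>x \<in> {0..1}. k (0,x) = \<delta> x" "\<forall>x \<in> {0..1}. k (1,x) = \<delta>' x"
    "\<forall>t \<in> {0..1::real}. pathstart(k \<circ> Pair t) = pathstart \<delta> \<and> pathfinish(k \<circ> Pair t) = pathfinish \<delta>"
    using assms(2) unfolding homotopic_paths by blast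
  show ?thesis
    unfolding homotopic_paths
  proof (intro exI[of _ "\<lambda>x. h x ** k x"] conjI)
    show "continuous_on ({0..1} \<times> {0..1}) (\<lambda>x. h x ** k x)"
      by (intro continuous_on_matrix_mult h k)
    show "(\<lambda>x. h x ** k x) \<in> ({0..1} \<times> {0..1}) \<rightarrow> carrier G"
    proof
      fix z :: "real \<times> real" assume "z \<in> {0..1} \<times> {0..1}"
      then have "h z \<in> carrier G" "k z \<in> carrier G"
        using funcset_mem[OF h(2)] funcset_mem[OF k(2)] by simp_all
      then show "h z ** k z \<in> carrier G" by (rule mult_closed)
    qed
    show "\<forall>x\<in>{0..1}. h (0, x) ** k (0, x) = \<gamma> x ** \<delta> x" "\<forall>x\<in>{0..1}. h (1, x) ** k (1, x) = \<gamma>' x ** \<delta>' x"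
      using h(3,4) k(3,4) by simp_all
    show "\<forall>t\<in>{0..1}. pathstart ((\<lambda>x. h x ** k x) \<circ> Pair t) = pathstart (\<lambda>t. \<gamma> t ** \<delta> t) \<and>
        pathfinish ((\<lambda>x. h x ** k x) \<circ> Pair t) = pathfinish (\<lambda>t. \<gamma> t ** \<delta> t)"
      using h(5) k(5) by (simp add: pathstart_def pathfinish_def)
  qed
qed

text \<open>The product in \<open>cover\<close> is a union over all pairs of representatives. It
  collapses to one class, because the class of the product does not depend on the representatives
  and because each factor has one.\<close>

lemma mult_path_class:
  assumes "based \<gamma>" "based \<delta>"
  shows "path_class G \<gamma> \<otimes>\<^bsub>cover G\<^esub> path_class G \<delta> = path_class G (\<lambda>t. \<gamma> t ** \<delta> t)"
proof -
  have "path_class G (\<lambda>t. \<gamma>' t ** \<delta>' t) = path_class G (\<lambda>t. \<gamma> t ** \<delta> t)"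
    if "\<gamma>' \<in> path_class G \<gamma>" "\<delta>' \<in> path_class G \<delta>" for \<gamma>' \<delta>'
    by (rule path_class_eqI[symmetric], rule homotopic_paths_mult) (use that in \<open>simp_all add: path_class_def\<close>)
  then have "path_class G \<gamma> \<otimes>\<^bsub>cover G\<^esub> path_class G \<delta> =
      (\<Union>\<gamma>'\<in>path_class G \<gamma>. \<Union>\<delta>'\<in>path_class G \<delta>. path_class G (\<lambda>t. \<gamma> t ** \<delta> t))"
    by (simp add: cover_def cong: SUP_cong_simp)
  moreover have "path_class G \<gamma> \<noteq> {}" "path_class G \<delta> \<noteq> {}"
    using mem_path_class assms by auto
  ultimately show ?thesis by (simp only: UN_constant if_False)
qed

lemma one_cover: "\<one>\<^bsub>cover G\<^esub> = path_class G (\<lambda>t. mat 1)"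
  by (simp add: cover_def)

lemma dag_mult_path_class:
  assumes "based \<gamma>"
  shows "path_class G (\<lambda>t. dag (\<gamma> t)) \<otimes>\<^bsub>cover G\<^esub> path_class G \<gamma> = \<one>\<^bsub>cover G\<^esub>"
  unfolding mult_path_class[OF based_dag[OF assms] assms] one_cover
  by (intro path_class_cong based_mult based_dag assms U_dag_left basedD_U)

lemma group_cover: "group (cover G)"
proof (rule groupI)
  fix x y assume "x \<in> carrier (cover G)" "y \<in> carrier (cover G)"
  then obtain \<gamma> \<delta> where "based \<gamma>" "based \<delta>" "x = path_class G \<gamma>" "y = path_class G \<delta>"
    by (elim coverE)
  then show "x \<otimes>\<^bsub>cover G\<^esub> y \<in> carrier (cover G)"
    using mult_path_class[of \<gamma> \<delta>] path_class_in_cover[OF based_mult[of \<gamma> \<delta>]] by simp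
next
  show "\<one>\<^bsub>cover G\<^esub> \<in> carrier (cover G)"
    unfolding one_cover by (rule path_class_in_cover[OF based_one])
next
  fix x y z assume "x \<in> carrier (cover G)" "y \<in> carrier (cover G)" "z \<in> carrier (cover G)"
  then obtain \<gamma> \<delta> \<epsilon> where "based \<gamma>" "based \<delta>" "based \<epsilon>"
    "x = path_class G \<gamma>" "y = path_class G \<delta>" "z = path_class G \<epsilon>"
    by (elim coverE)
  then show "x \<otimes>\<^bsub>cover G\<^esub> y \<otimes>\<^bsub>cover G\<^esub> z = x \<otimes>\<^bsub>cover G\<^esub> (y \<otimes>\<^bsub>cover G\<^esub> z)"
    by (simp add: mult_path_class based_mult matrix_mul_assoc)
next
  fix x assume "x \<in> carrier (cover G)"
  then obtain \<gamma> where \<gamma>: "based \<gamma>" "x = path_class G \<gamma>" by (rule coverE)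
  then show "\<one>\<^bsub>cover G\<^esub> \<otimes>\<^bsub>cover G\<^esub> x = x"
    by (simp add: one_cover mult_path_class based_one)
  show "\<exists>y\<in>carrier (cover G). y \<otimes>\<^bsub>cover G\<^esub> x = \<one>\<^bsub>cover G\<^esub>"
    unfolding \<gamma>(2) using dag_mult_path_class[OF \<gamma>(1)] path_class_in_cover[OF based_dag[OF \<gamma>(1)]] by blast
qed

lemma cover_one_closed: "\<one>\<^bsub>cover G\<^esub> \<in> carrier (cover G)"
  by (rule monoid.one_closed[OF group.is_monoid[OF group_cover]])

lemma cover_l_one: "x \<in> carrier (cover G) \<Longrightarrow> \<one>\<^bsub>cover G\<^esub> \<otimes>\<^bsub>cover G\<^esub> x = x"
  by (rule monoid.l_one[OF group.is_monoid[OF group_cover]])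

lemma cover_proj_path_class:
  assumes "based \<gamma>"
  shows "cover_proj (path_class G \<gamma>) = \<gamma> 1"
proof -
  have "pathfinish ` path_class G \<gamma> = {\<gamma> 1}"
    using mem_path_class[OF assms] homotopic_paths_imp_pathfinish
    by (fastforce simp: path_class_def pathfinish_def)
  then show ?thesis by (simp add: cover_proj_def)
qed

lemma cover_proj_closed: "x \<in> carrier (cover G) \<Longrightarrow> cover_proj x \<in> carrier G"
  by (erule coverE) (use basedD(2)[of _ 1] cover_proj_path_class in simp)

lemma cover_proj_mult:
  assumes "x \<in> carrier (cover G)" "y \<in> carrier (cover G)"
  shows "cover_proj (x \<otimes>\<^bsub>cover G\<^esub> y) = cover_proj x ** cover_proj y"
proof -
  obtain \<gamma> \<delta> where "based \<gamma>" "based \<delta>" "x = path_class G \<gamma>" "y = path_class G \<delta>"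
    using assms by (elim coverE)
  then show ?thesis by (simp add: mult_path_class cover_proj_path_class based_mult)
qed

lemma cover_proj_one: "cover_proj \<one>\<^bsub>cover G\<^esub> = mat 1"
  by (simp add: one_cover cover_proj_path_class based_one)

end

lemma det_dag: "det (dag A) = cnj (det A)"
proof -
  have cnj: "det (\<chi> i j. cnj (B $ i $ j)) = cnj (det B)" for B :: "'a mat"
    by (simp add: det_def cnj_sum cnj_prod)
  have I2: "det (I_mat :: 'a mat) * det (I_mat :: 'a mat) = 1"
    by (metis I_mat_sq det_I det_mul)
  have "adj A = (\<chi> i j. cnj (transpose A $ i $ j))"
    by (simp add: adj_def transpose_def vec_eq_iff)
  then have "det (adj A) = cnj (det A)" by (simp add: cnj)
  then show ?thesis using I2 by (simp add: dag_def det_mul ac_simps)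
qed

lemma U_norm_det: "A \<in> carrier U_group \<Longrightarrow> norm (det A) = 1"
proof -
  assume "A \<in> carrier U_group"
  from arg_cong[OF U_dag_left[OF this], of det]
  have "complex_of_real ((norm (det A))\<^sup>2) = of_real 1"
    by (simp add: det_mul det_dag cnj_mult_self[symmetric] del: of_real_power)
  then have "(norm (det A))\<^sup>2 = 1" unfolding of_real_eq_iff .
  then show ?thesis by (simp add: abs_square_eq_1)
qed

interpretation U: matrix_subgroup U_group
proof
  show "mult U_group = (**)" "one U_group = mat 1" by (simp_all add: U_group_def)
qed (simp_all add: U_mult U_one U_dag)

lemma carrier_SU: "A \<in> carrier SU_group \<longleftrightarrow> A \<in> carrier U_group \<and> det A = 1"
  by (simp add: SU_group_def)

interpretation SU: matrix_subgroup SU_group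
proof
  show "mult SU_group = (**)" "one SU_group = mat 1" by (simp_all add: SU_group_def U_group_def)
qed (auto simp: carrier_SU U_mult U_one U_dag det_mul det_dag)

subsection \<open>The inclusion of the covering groups\<close>

lemma SU_based_imp_U: "SU.based \<gamma> \<Longrightarrow> U.based \<gamma>"
  unfolding SU.based_def U.based_def using SU.carrier_subset by blast

text \<open>A homotopy in SU(1,n-1) is also one in U(1,n-1), so all members of the nonempty union
  are the same class.\<close>

lemma cover_incl_path_class:
  assumes "SU.based \<gamma>"
  shows "cover_incl (path_class SU_group \<gamma>) = path_class U_group \<gamma>"
proof -
  have "path_class U_group \<delta> = path_class U_group \<gamma>" if "\<delta> \<in> path_class SU_group \<gamma>" for \<delta>
    by (rule U.path_class_eqI[symmetric], rule homotopic_paths_subset[OF _ SU.carrier_subset])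
      (use that in \<open>simp add: path_class_def\<close>)
  moreover have "path_class SU_group \<gamma> \<noteq> {}"
    using SU.mem_path_class[OF assms] by auto
  ultimately show ?thesis by (simp add: cover_incl_def)
qed

lemma cover_incl_closed: "x \<in> carrier (cover SU_group) \<Longrightarrow> cover_incl x \<in> carrier (cover U_group)"
  by (erule SU.coverE) (simp add: cover_incl_path_class SU_based_imp_U U.path_class_in_cover)

lemma cover_incl_mult:
  assumes "x \<in> carrier (cover SU_group)" "y \<in> carrier (cover SU_group)"
  shows "cover_incl (x \<otimes>\<^bsub>cover SU_group\<^esub> y) = cover_incl x \<otimes>\<^bsub>cover U_group\<^esub> cover_incl y"
proof -
  obtain \<gamma> \<delta> where "SU.based \<gamma>" "SU.based \<delta>" "x = path_class SU_group \<gamma>" "y = path_class SU_group \<delta>"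
    using assms by (elim SU.coverE)
  then show ?thesis
    by (simp add: SU.mult_path_class cover_incl_path_class SU.based_mult U.mult_path_class SU_based_imp_U)
qed

lemma cover_incl_one: "cover_incl \<one>\<^bsub>cover SU_group\<^esub> = \<one>\<^bsub>cover U_group\<^esub>"
  by (simp add: SU.one_cover U.one_cover cover_incl_path_class SU.based_one)

lemma cover_proj_incl: "x \<in> carrier (cover SU_group) \<Longrightarrow> cover_proj (cover_incl x) = cover_proj x"
  by (erule SU.coverE) (simp add: cover_incl_path_class SU_based_imp_U U.cover_proj_path_class SU.cover_proj_path_class)

subsection \<open>The argument of the corner entry\<close>

text \<open>For a path that need not close up, 2\<pi> times the real part of the winding number
  about 0 is the total change of the argument. Along a path based at the identity the corner entry
  starts at 1, so this is a value of its argument at the end point.\<close>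

definition path_arg :: "(real \<Rightarrow> 'm::finite mat) \<Rightarrow> real"
  where "path_arg \<gamma> = 2 * pi * Re (winding_number (\<lambda>t. \<gamma> t $ None $ None) 0)"

definition cover_arg :: "(real \<Rightarrow> 'm::finite mat) set \<Rightarrow> real"
  where "cover_arg x = the_elem (path_arg ` x)"

lemma U_corner_nonzero: "g \<in> carrier U_group \<Longrightarrow> g $ None $ None \<noteq> 0"
  using Re_afac_pos(2)[of g 0] by simp

text \<open>The corner entry maps the group continuously into the punctured plane, where the winding
  number is invariant under homotopies with fixed end points.\<close>

lemma cover_arg_path_class:
  assumes "U.based \<gamma>"
  shows "cover_arg (path_class U_group \<gamma>) = path_arg \<gamma>"
proof -
  have "path_arg \<delta> = path_arg \<gamma>" if "\<delta> \<in> path_class U_group \<gamma>" for \<delta>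
  proof -
    have "homotopic_paths (carrier U_group) \<gamma> \<delta>" using that by (simp add: path_class_def)
    then have "homotopic_paths (- {0}) ((\<lambda>A. A $ None $ None) \<circ> \<gamma>) ((\<lambda>A. A $ None $ None) \<circ> \<delta>)"
      by (rule homotopic_paths_continuous_image)
        (auto intro!: continuous_intros simp: U_corner_nonzero)
    from winding_number_homotopic_paths[OF this] show ?thesis
      by (simp add: path_arg_def o_def)
  qed
  then have "path_arg ` path_class U_group \<gamma> = {path_arg \<gamma>}"
    using U.mem_path_class[OF assms] by blast
  then show ?thesis by (simp add: cover_arg_def)
qed

text \<open>Reduces the computation of arguments to exhibiting a continuous logarithm of the corner
  entry that starts at 0.\<close>

lemma path_arg_eqI:
  assumes "continuous_on {0..1} q" "\<And>t. t \<in> {0..1} \<Longrightarrow> \<gamma> t $ None $ None = exp (q t)" "q 0 = 0"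
  shows "path_arg \<gamma> = Im (q 1)"
proof -
  have "winding_number (\<lambda>t. \<gamma> t $ None $ None) 0 = winding_number (exp \<circ> q) 0"
    by (rule winding_number_cong) (use assms(2) in auto)
  also have "\<dots> = q 1 / (2 * of_real pi * \<i>)"
    using winding_number_compose_exp[of q] assms(1,3)
    by (simp add: path_def pathfinish_def pathstart_def)
  also have "\<dots> = - \<i> * q 1 / of_real (2 * pi)" by (simp add: field_simps)
  finally show ?thesis by (simp add: path_arg_def del: of_real_mult)
qed

lemma corner_log_exists:
  assumes "U.based \<gamma>"
  obtains q where "continuous_on {0..1} q" "\<And>t. t \<in> {0..1} \<Longrightarrow> \<gamma> t $ None $ None = exp (q t)" "q 0 = 0"
proof -
  let ?p = "\<lambda>t. \<gamma> t $ None $ None"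
  have "path ?p" using U.basedD(1)[OF assms] unfolding path_def by (intro continuous_intros)
  moreover have "0 \<notin> path_image ?p"
    using U.basedD(2)[OF assms] U_corner_nonzero unfolding path_image_def by fastforce
  ultimately obtain q where q: "path q" "\<And>t. t \<in> {0..1} \<Longrightarrow> ?p t = 0 + exp (q t)"
    by (rule winding_number_as_continuous_log) auto
  \<comment> \<open>The corner entry starts at 1, so \<open>q 0\<close> is a period of the
    exponential and may be subtracted.\<close>
  have "exp (q 0) = 1" using q(2)[of 0] U.basedD(3)[OF assms] by (simp add: mat_def)
  then show ?thesis
    using that[of "\<lambda>t. q t - q 0"] q
    by (simp add: path_def exp_diff continuous_on_diff)
qed

text \<open>The corner entry of the product is the product of both corner entries with
  \<open>afac (\<gamma> t) (mob (\<delta> t) 0)\<close>. Hence the sum of two continuous logarithms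
  and the principal logarithm of the last factor is again a continuous logarithm. The result is the
  composition law of \<theta> in \<open>act_compose\<close>.\<close>

lemma path_arg_mult:
  assumes "U.based \<gamma>" "U.based \<delta>"
  shows "path_arg (\<lambda>t. \<gamma> t ** \<delta> t) = path_arg \<gamma> + path_arg \<delta> + ash (\<gamma> 1) (mob (\<delta> 1) 0)"
proof -
  obtain q where q: "continuous_on {0..1} q" "\<And>t. t \<in> {0..1} \<Longrightarrow> \<gamma> t $ None $ None = exp (q t)" "q 0 = 0"
    using corner_log_exists[OF assms(1)] by blast
  obtain r where r: "continuous_on {0..1} r" "\<And>t. t \<in> {0..1} \<Longrightarrow> \<delta> t $ None $ None = exp (r t)" "r 0 = 0"
    using corner_log_exists[OF assms(2)] by blast
  note c = U.basedD(1)[OF assms(1)] U.basedD(1)[OF assms(2)]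
  have N: "norm (mob (\<delta> t) 0) < 1" if "t \<in> {0..1}" for t
    using norm_mob_less_1[OF U.basedD(2)[OF assms(2) that]] by simp
  have nz: "\<gamma> t $ None $ None \<noteq> 0" "jfac (\<delta> t) 0 \<noteq> 0" "Re (afac (\<gamma> t) (mob (\<delta> t) 0)) > 0"
    if "t \<in> {0..1}" for t
    using U_corner_nonzero U.basedD(2)[OF assms(1) that] jfac_nonzero[OF U.basedD(2)[OF assms(2) that], of 0]
      Re_afac_pos(1)[OF _ N[OF that]] by auto
  let ?l = "\<lambda>t. Ln (afac (\<gamma> t) (mob (\<delta> t) 0))"
  have "continuous_on {0..1} (\<lambda>t. mob (\<delta> t) 0)"
    unfolding mob_def by (intro continuous_intros c bounded_bilinear.continuous_on[OF bounded_bilinear_matrix_vector])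
      (use nz in \<open>auto simp: jfac_def intro!: continuous_intros c bounded_bilinear.continuous_on[OF bounded_bilinear_matrix_vector]\<close>)
  then have "continuous_on {0..1} (\<lambda>t. afac (\<gamma> t) (mob (\<delta> t) 0))"
    unfolding afac_def jfac_eq by (intro continuous_intros c) (use nz in auto)
  then have l: "continuous_on {0..1} ?l"
  proof (rule continuous_on_Ln')
    fix t :: real assume "t \<in> {0..1}"
    from nz(3)[OF this] show "afac (\<gamma> t) (mob (\<delta> t) 0) \<notin> \<real>\<^sub>\<le>\<^sub>0"
      by (auto simp: complex_nonpos_Reals_iff)
  qed
  have e: "(\<gamma> t ** \<delta> t) $ None $ None = exp (q t + r t + ?l t)" if "t \<in> {0..1}" for t
  proof -
    have "(\<gamma> t ** \<delta> t) $ None $ None = jfac (\<gamma> t) (mob (\<delta> t) 0) * jfac (\<delta> t) 0"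
      using jfac_mult[OF nz(2)[OF that]] by (simp add: jfac_zero)
    also have "\<dots> = \<gamma> t $ None $ None * \<delta> t $ None $ None * afac (\<gamma> t) (mob (\<delta> t) 0)"
      using nz(1)[OF that] by (simp add: afac_def jfac_zero[of "\<delta> t"])
    also have "\<dots> = exp (q t) * exp (r t) * exp (?l t)"
      using nz(3)[OF that] by (subst exp_Ln) (auto simp: q(2)[OF that] r(2)[OF that])
    finally show ?thesis by (simp add: exp_add)
  qed
  have l0: "?l 0 = 0"
    by (simp add: U.basedD(3)[OF assms(1)] U.basedD(3)[OF assms(2)] afac_def)
      (simp add: mat_def)
  show ?thesis
    using path_arg_eqI[OF continuous_on_add[OF continuous_on_add[OF q(1) r(1)] l] e] l0
      path_arg_eqI[OF q] path_arg_eqI[OF r] q(3) r(3)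
    by (simp add: ash_def)
qed

lemma cover_arg_mult:
  assumes "x \<in> carrier (cover U_group)" "y \<in> carrier (cover U_group)"
  shows "cover_arg (x \<otimes>\<^bsub>cover U_group\<^esub> y) =
    cover_arg x + cover_arg y + ash (cover_proj x) (mob (cover_proj y) 0)"
proof -
  obtain \<gamma> \<delta> where "U.based \<gamma>" "U.based \<delta>" "x = path_class U_group \<gamma>" "y = path_class U_group \<delta>"
    using assms by (elim U.coverE)
  then show ?thesis
    by (simp add: U.mult_path_class cover_arg_path_class U.based_mult path_arg_mult U.cover_proj_path_class)
qed

lemma cover_arg_one: "cover_arg \<one>\<^bsub>cover U_group\<^esub> = 0"
  unfolding U.one_cover cover_arg_path_class[OF U.based_one]
  using path_arg_eqI[of "\<lambda>_. 0" "\<lambda>_. mat 1"] by (simp add: mat_def)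

section \<open>The infinitesimal action\<close>

text \<open>The velocity of the fractional linear action at the identity; it is quadratic in
  X.\<close>

definition proj_vf :: "'m::finite mat \<Rightarrow> complex^'m \<Rightarrow> complex^'m"
  where "proj_vf A X = (\<chi> a. (A *v hlift X) $ Some a - X $ a * (A *v hlift X) $ None)"

text \<open>A closed form for \<alpha>. The factor 1/2 appears because the real vector
  \<open>e\<^sub>k\<close> is half the sum of \<open>E\<^sub>k\<close> and its conjugate, and
  \<open>E\<^sub>k\<close> acts by \<open>V\<^sub>k\<close>, whose first term is the derivative in
  \<open>w\<^sup>k\<close>. The summand with -2c is the velocity of the argument of the automorphy
  factor.\<close>

definition alpha_vf :: "real \<Rightarrow> 'm::finite liealg \<Rightarrow> 'm pt \<Rightarrow> 'm pt"
  where "alpha_vf c x p =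
    (proj_vf (fst x) (fst p), (1/2) *\<^sub>R fst (snd x) + ctr (fst x) *v fst (snd p),
     snd (snd x) + heis_form (fst (snd x)) (fst (snd p)) - 2 * c * Im ((fst x *v hlift (fst p)) $ None), 0)"

definition dproj_vf :: "'m::finite mat \<Rightarrow> complex^'m \<Rightarrow> complex^'m \<Rightarrow> complex^'m"
  where "dproj_vf A X d = (\<chi> a. (A *v dlift d) $ Some a - d $ a * (A *v hlift X) $ None
     - X $ a * (A *v dlift d) $ None)"

definition dalpha_vf :: "real \<Rightarrow> 'm::finite liealg \<Rightarrow> 'm pt \<Rightarrow> 'm pt \<Rightarrow> 'm pt"
  where "dalpha_vf c x p q =
    (dproj_vf (fst x) (fst p) (fst q), ctr (fst x) *v fst (snd q),
     heis_form (fst (snd x)) (fst (snd q)) - 2 * c * Im ((fst x *v dlift (fst q)) $ None), 0)"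

lemma matrix_vector_minus: "(- A) *v x = - (A *v x)" for A :: "'a::comm_ring_1^'n^'k"
  by (simp add: vec_eq_iff matrix_vector_mult_def sum_negf)

lemma ctr_zero [simp]: "ctr 0 = 0"
  by (simp add: vec_eq_iff ctr_nth)

lemma dlift_proj_vf: "dlift (proj_vf A X) = A *v hlift X - (A *v hlift X) $ None *s hlift X"
  unfolding vec_eq_iff forall_option by (simp add: proj_vf_def)

lemma ctr_u_alg: "A \<in> u_alg \<Longrightarrow> ctr A = - transpose A"
  by (simp add: ctr_def u_alg_iff transpose_def vec_eq_iff)

lemma ctr_add: "ctr (A + B) = ctr A + ctr B"
  and ctr_diff: "ctr (A - B) = ctr A - ctr B"
  and ctr_scaleR: "ctr (r *\<^sub>R A) = r *\<^sub>R ctr A"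
  by (simp_all add: vec_eq_iff ctr_nth algebra_simps)

lemma heis_form_ctr_u_alg:
  "A \<in> u_alg \<Longrightarrow> heis_form (ctr A *v x) y = - heis_form x (ctr A *v y)"
proof -
  assume "A \<in> u_alg"
  then have "dag (ctr A) = - ctr A"
    by (simp add: dag_ctr u_alg_iff) (simp add: vec_eq_iff ctr_nth)
  then have "herm (ctr A *v x) y = herm x (- (ctr A *v y))"
    by (simp add: herm_dag matrix_vector_minus)
  then show ?thesis by (simp add: heis_form_eq herm_minus_right)
qed

text \<open>Each component reduces to a matrix commutator, since the lift of
  \<open>proj_vf A X\<close> is \<open>A *v hlift X\<close> up to a multiple of
  \<open>hlift X\<close> and the resulting quadratic terms are symmetric in A and B.\<close>

lemma alpha_vf_bracket:
  assumes "x \<in> g_alg" "y \<in> g_alg"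
  shows "alpha_vf c (g_bracket x y) p =
    - (dalpha_vf c y p (alpha_vf c x p) - dalpha_vf c x p (alpha_vf c y p))"
proof -
  obtain A v t where x: "x = (A, (v, t))" by (metis prod_cases3)
  obtain B v' t' where y: "y = (B, (v', t'))" by (metis prod_cases3)
  have A: "A \<in> u_alg" and B: "B \<in> u_alg" using assms by (auto simp: g_alg_def x y)
  have br: "g_bracket x y = (A ** B - B ** A, (ctr A *v v' - ctr B *v v, heis_form v v'))"
    by (simp add: g_bracket_def x y heis_deriv_def ctr_u_alg A B matrix_vector_minus)
  have m: "M *v dlift (proj_vf N X) = (M ** N) *v hlift X - (N *v hlift X) $ None *s (M *v hlift X)"
    for M N :: "'a mat" and X
    by (simp add: dlift_proj_vf matrix_vector_mult_diff_distrib matrix_vector_mult_smult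
        matrix_vector_mul_assoc)
  have sub: "(M - N) *v z = M *v z - N *v z" for M N :: "'a mat" and z
    by (rule matrix_vector_mult_diff_rdistrib)
  have c1: "proj_vf (A ** B - B ** A) X =
      - (dproj_vf B X (proj_vf A X) - dproj_vf A X (proj_vf B X))" for X
    by (simp add: vec_eq_iff proj_vf_def[of "A ** B - B ** A"] dproj_vf_def m sub)
      (simp add: proj_vf_def algebra_simps)
  have c2: "(1/2) *\<^sub>R (ctr A *v v' - ctr B *v v) + ctr (A ** B - B ** A) *v w =
      - (ctr B *v ((1/2) *\<^sub>R v + ctr A *v w) - ctr A *v ((1/2) *\<^sub>R v' + ctr B *v w))" for w
    by (simp add: ctr_diff ctr_mult sub matrix_vector_right_distrib matrix_vector_scaleR
        matrix_vector_mul_assoc scaleR_diff_right)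
  have hf: "heis_form (u - u') w = heis_form u w - heis_form u' w" for u u' w
    using heis_form_simps(1)[of u "- u'" w] by (simp add: heis_form_simps)
  \<comment> \<open>The central term \<open>heis_form v v'\<close> arises as the sum of two halves,
    one from each of the translations of w by v/2 and v'/2.\<close>
  have c3: "heis_form v v' + heis_form (ctr A *v v' - ctr B *v v) w
      - 2 * c * Im (((A ** B - B ** A) *v hlift X) $ None) =
    - ((heis_form v' ((1/2) *\<^sub>R v + ctr A *v w) - 2 * c * Im ((B *v dlift (proj_vf A X)) $ None))
      - (heis_form v ((1/2) *\<^sub>R v' + ctr B *v w) - 2 * c * Im ((A *v dlift (proj_vf B X)) $ None)))" for w X
    using heis_form_commute[of v' v]
    by (simp add: hf sub m heis_form_simps heis_form_ctr_u_alg A B) (simp add: algebra_simps)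
  show ?thesis
    unfolding br by (simp add: x y alpha_vf_def dalpha_vf_def c1 c2 c3)
qed

lemma has_derivative_alpha_vf: "(alpha_vf c x has_derivative dalpha_vf c x p) (at p)"
proof -
  have id: "((\<lambda>q. fst q) has_derivative (\<lambda>q. fst q)) (at p)" 
    by (intro derivative_intros)
  have u: "((\<lambda>q. fst x *v hlift (fst q)) has_derivative (\<lambda>q. fst x *v dlift (fst q))) (at p)"
    using has_derivative_matrix_hlift[OF has_derivative_const[of "fst x"] id] by simp
  note uk = bounded_linear.has_derivative[OF bounded_linear_vec_nth u]
  have pv: "((\<lambda>q. proj_vf (fst x) (fst q)) has_derivative (\<lambda>q. dproj_vf (fst x) (fst p) (fst q))) (at p)"
    unfolding proj_vf_def dproj_vf_def
    by (rule has_derivative_vec_lambda,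
        rule has_derivative_eq_rhs, (rule derivative_intros uk bounded_linear.has_derivative[OF bounded_linear_vec_nth])+)
      (auto simp: fun_eq_iff algebra_simps)
  have w: "((\<lambda>q. ctr (fst x) *v fst (snd q)) has_derivative (\<lambda>q. ctr (fst x) *v fst (snd q))) (at p)"
    by (intro bounded_linear.has_derivative[OF matrix_vector_mul_bounded_linear] derivative_intros)
  have h: "((\<lambda>q. heis_form (fst (snd x)) (fst (snd q))) has_derivative
      (\<lambda>q. heis_form (fst (snd x)) (fst (snd q)))) (at p)"
    by (intro bounded_linear.has_derivative[OF bounded_bilinear.bounded_linear_right[OF bounded_bilinear_heis_form]]
        derivative_intros)
  show ?thesis
    unfolding alpha_vf_def dalpha_vf_def
    by (rule has_derivative_eq_rhs, (rule derivative_intros pv w h uk)+) (auto simp: fun_eq_iff)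
qed

lemma smooth_on_alpha_vf: "smooth_on Nbar (alpha_vf c x)"
proof -
  note S = open_Nbar
  have lin: "bounded_linear (\<lambda>p :: 'a pt. fst p)" "bounded_linear (\<lambda>p :: 'a pt. fst (snd p))"
    by (intro bounded_linear_fst_comp bounded_linear_snd_comp bounded_linear_fst bounded_linear_snd)+
  note sl = lin[THEN smooth_on_linear[OF S]]
  have u: "smooth_on Nbar (\<lambda>p. fst x *v hlift (fst p))"
    unfolding hlift_def
    by (rule smooth_on_bounded_linear[OF S matrix_vector_mul_bounded_linear]
        smooth_on_add[OF S] smooth_on_const[OF S]
        smooth_on_bounded_linear[OF S bounded_linear_dlift] sl(1))+
  have uk: "smooth_on Nbar (\<lambda>p. (fst x *v hlift (fst p)) $ k)" for k
    by (rule smooth_on_bounded_linear[OF S bounded_linear_vec_nth u])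
  have pv: "smooth_on Nbar (\<lambda>p. proj_vf (fst x) (fst p))"
    unfolding proj_vf_def
    by (intro smooth_on_vec smooth_on_diff smooth_on_mult uk S smooth_on_bounded_linear[OF S bounded_linear_vec_nth sl(1)])
  have w: "smooth_on Nbar (\<lambda>p. ctr (fst x) *v fst (snd p))"
    by (rule smooth_on_bounded_linear[OF S matrix_vector_mul_bounded_linear sl(2)])
  have hf: "smooth_on Nbar (\<lambda>p. heis_form (fst (snd x)) (fst (snd p)))"
    by (rule smooth_on_bounded_linear[OF S bounded_bilinear.bounded_linear_right[OF bounded_bilinear_heis_form] sl(2)])
  show ?thesis
    unfolding alpha_vf_def
    by (intro smooth_on_Pair smooth_on_add smooth_on_diff smooth_on_mult smooth_on_const S pv w hf
        smooth_on_bounded_linear[OF S bounded_linear_Im uk])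
qed

text \<open>The complex-linear extension to the general linear algebra.\<close>

definition alpha_cvf :: "real \<Rightarrow> 'm::finite mat \<Rightarrow> 'm pt \<Rightarrow> 'm cvec"
  where "alpha_cvf c M p =
    (proj_vf M (fst p), (\<chi> a. cnj (proj_vf (- dag M) (fst p) $ a)),
     - (transpose M *v fst (snd p)), (\<chi> k. cnj ((transpose (dag M) *v fst (snd p)) $ k)),
     \<i> * of_real c * ((M *v hlift (fst p)) $ None + cnj ((dag M *v hlift (fst p)) $ None)), 0)"

lemma cscale_vec: "cscale z A *v x = z *s (A *v x)" "transpose (cscale z A) = cscale z (transpose A)"
  by (simp_all add: vec_eq_iff cscale_def matrix_vector_mult_def sum_distrib_left ac_simps transpose_def)

text \<open>Only M = A + iB enters: the conjugate components need A - iB, which is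
  \<open>- dag M\<close> because A and B are skew for \<open>dag\<close>. The conditions on the
  generators thus become evaluations at matrix units.\<close>

lemma cext_alpha_vf:
  assumes "A \<in> u_alg" "B \<in> u_alg"
  shows "cext (alpha_vf c) (A, 0) (B, 0) p = alpha_cvf c (A + cscale \<i> B) p"
proof -
  have d: "dag A = - A" "dag B = - B" using assms by (simp_all add: u_alg_iff)
  have dM: "dag (A + cscale \<i> B) = cscale \<i> B - A"
    by (simp add: dag_add dag_cscale d) (simp add: vec_eq_iff cscale_def)
  have tr: "transpose (P + Q) = transpose P + transpose Q" "transpose (P - Q) = transpose P - transpose Q"
    for P Q :: "'a mat"
    by (simp_all add: transpose_def vec_eq_iff)
  have mv: "(P + Q) *v x = P *v x + Q *v x" "(P - Q) *v x = P *v x - Q *v x" "(- P) *v x = - (P *v x)"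
    for P Q :: "'a mat" and x
    by (simp_all add: vec_eq_iff matrix_vector_mult_def algebra_simps sum.distrib sum_subtractf sum_negf)
  show ?thesis
    unfolding cext_def alpha_cvf_def alpha_vf_def dM ctr_u_alg[OF assms(1)] ctr_u_alg[OF assms(2)]
      tr mv cscale_vec complexify_def scale_cvec_def split_conv fst_conv snd_conv proj_vf_def
    by (simp add: vec_eq_iff heis_form_simps mv algebra_simps cscale_vec)
      (simp add: complex_eq_iff algebra_simps)
qed

lemma C_gen_u_alg: "C_gen \<in> u_alg" "0 \<in> u_alg"
  by (simp_all add: u_alg_iff C_gen_def dag_cscale) (simp_all add: vec_eq_iff cscale_def dag_nth)

definition munit :: "'m option \<Rightarrow> 'm option \<Rightarrow> 'm::finite mat"
  where "munit k l = (\<chi> i j. if i = k \<and> j = l then 1 else 0)"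

lemma munit_vec: "(munit k l *v z) $ i = (if i = k then z $ l else 0)"
  by (auto simp: munit_def matrix_vector_mult_def if_distrib[of "\<lambda>x. x * _"] cong: if_cong)

lemma munit_transpose: "transpose (munit k l) = munit l k"
  by (auto simp: munit_def transpose_def vec_eq_iff)

lemma munit_dag: "dag (munit k l) = cscale (isgn k * isgn l) (munit l k)"
  by (auto simp: munit_def dag_nth cscale_def vec_eq_iff)

lemma U_gen_munit: "U_gen a = munit None (Some a)" "sigma (U_gen a) = munit (Some a) None"
proof -
  show 1: "U_gen a = munit None (Some a)"
    by (auto simp: U_gen_def munit_def vec_eq_iff)
  show "sigma (U_gen a) = munit (Some a) None"
    by (simp add: sigma_eq_dag 1 munit_dag) (auto simp: munit_def cscale_def vec_eq_iff)
qed

lemma alpha_cvf_gen: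
  "alpha_cvf c (U_gen a) p = Y_vf c a p"
  "alpha_cvf c (sigma (U_gen a)) p = cnj_cvec (Y_vf c a p)"
proof -
  have d: "dag (munit None (Some a)) = - munit (Some a) None" "dag (munit (Some a) None) = - munit None (Some a)"
    by (simp_all add: munit_dag) (simp_all add: cscale_def vec_eq_iff)
  have tr: "transpose (- M) = - transpose M" for M :: "'a mat"
    by (simp add: transpose_def vec_eq_iff)
  obtain X w f r where p: "p = (X, w, f, r)" by (metis prod_cases4)
  show "alpha_cvf c (U_gen a) p = Y_vf c a p" "alpha_cvf c (sigma (U_gen a)) p = cnj_cvec (Y_vf c a p)"
    unfolding U_gen_munit(2)
    unfolding U_gen_munit(1) alpha_cvf_def d p fst_conv snd_conv Y_vf_def cnj_cvec_def split_conv tr munit_transpose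
    by (auto simp: vec_eq_iff proj_vf_def matrix_vector_minus munit_vec axis_def simp del: transpose_matrix_vector)
qed

lemma infinitesimal_action_alpha_vf: "infinitesimal_action c (alpha_vf c)"
proof -
  have fd: "frechet_derivative (alpha_vf c x) (at p) = dalpha_vf c x p" for x :: "'a liealg" and p
    by (rule frechet_derivative_at[OF has_derivative_alpha_vf, symmetric])
  have "alpha_vf c (r *\<^sub>R x + s *\<^sub>R y) p = r *\<^sub>R alpha_vf c x p + s *\<^sub>R alpha_vf c y p" for x y :: "'a liealg" and p r s
    by (simp add: alpha_vf_def proj_vf_def vec_eq_iff heis_form_simps matrix_vector_mult_add_rdistrib
        matrix_vector_scaleR ctr_add ctr_scaleR algebra_simps)
  moreover have "complexify (alpha_vf c (C_gen, 0) p) = Y_C c p" for p :: "'a pt"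
  proof -
    obtain X w f r where p: "p = (X, w, f, r)" by (metis prod_cases4)
    have "ctr (C_gen :: 'a mat) = cscale (- \<i>) (mat 1)" 
      unfolding ctr_u_alg[OF C_gen_u_alg(1)] by (auto simp: C_gen_def cscale_def vec_eq_iff transpose_def mat_def)
    then have "ctr C_gen *v w = (- \<i>) *s w" by (simp only: cscale_vec matrix_vector_mul_lid)
    moreover have "(C_gen :: 'a mat) *v z = \<i> *s z" for z
      by (simp add: C_gen_def cscale_vec)
    ultimately show ?thesis
      by (simp add: alpha_vf_def Y_C_def p complexify_def heis_form_simps proj_vf_def vec_eq_iff)
  qed
  moreover have "cext (alpha_vf c) (0, e_vec k) (0, - f_vec k) p = V_vf k p"
    "cext (alpha_vf c) (0, e_vec k) (0, f_vec k) p = cnj_cvec (V_vf k p)" for k and p :: "'a pt"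
  proof -
    obtain X w f r where p: "p = (X, w, f, r)" by (metis prod_cases4)
    have h: "heis_form (axis k z) w = - Im (isgn k * (cnj z * w $ k))" for z
      by (simp only: heis_form_eq herm_axis)
    have z: "ctr 0 = (0 :: 'a mat)" "proj_vf 0 X = 0"
      by (simp_all add: vec_eq_iff ctr_nth proj_vf_def)
    have m: "- f_vec k = (- axis k \<i>, 0)" by (simp add: f_vec_def)
    have a: "axis k z $ i = (if i = k then z else 0)" for i k and z :: complex
      by (simp add: axis_def)
    show "cext (alpha_vf c) (0, e_vec k) (0, - f_vec k) p = V_vf k p"
      "cext (alpha_vf c) (0, e_vec k) (0, f_vec k) p = cnj_cvec (V_vf k p)"
      unfolding m unfolding cext_def alpha_vf_def complexify_def scale_cvec_def V_vf_def cnj_cvec_def p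
        e_vec_def f_vec_def fst_conv snd_conv split_conv heis_form_simps h z
      by (simp_all add: vec_eq_iff a)
        (auto simp: isgn_def complex_eq_iff)
  qed
  moreover have "complexify (alpha_vf c (0, T_vec) p) = (0, 0, 0, 0, 1, 0)" for p :: "'a pt"
    by (cases p; auto simp: alpha_vf_def complexify_def T_vec_def proj_vf_def vec_eq_iff heis_form_simps)
  moreover have "cext (alpha_vf c) (A, 0) (B, 0) p = Y_vf c a p"
    if "A \<in> u_alg" "B \<in> u_alg" "A + cscale \<i> B = U_gen a" for A B a and p :: "'a pt"
    using cext_alpha_vf[OF that(1,2), of c p] by (simp only: that(3) alpha_cvf_gen)
  moreover have "cext (alpha_vf c) (A, 0) (B, 0) p = cnj_cvec (Y_vf c a p)"
    if "A \<in> u_alg" "B \<in> u_alg" "A + cscale \<i> B = sigma (U_gen a)" for A B a and p :: "'a pt"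
    using cext_alpha_vf[OF that(1,2), of c p] by (simp only: that(3) alpha_cvf_gen)
  moreover have "alpha_vf c (g_bracket x y) p =
      - (dalpha_vf c y p (alpha_vf c x p) - dalpha_vf c x p (alpha_vf c y p))"
    if "x \<in> g_alg" "y \<in> g_alg" for x y and p :: "'a pt"
    by (rule alpha_vf_bracket[OF that])
  ultimately show ?thesis
    unfolding infinitesimal_action_def lie_bracket_def fd
    by (intro conjI ballI allI impI smooth_on_alpha_vf) blast+
qed

subsection \<open>Uniqueness of the infinitesimal action\<close>

text \<open>With \<open>im_part\<close>, the components of a matrix with respect to the real form
  u(1,n-1) of gl(n, C) and its multiple by i.\<close>

definition re_part :: "'m::finite mat \<Rightarrow> 'm mat"
  where "re_part M = (1/2) *\<^sub>R (M - dag M)"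

definition im_part :: "'m::finite mat \<Rightarrow> 'm mat"
  where "im_part M = cscale (- \<i> / 2) (M + dag M)"

lemma parts_u_alg: "re_part M \<in> u_alg" "im_part M \<in> u_alg"
  by (simp_all add: u_alg_iff re_part_def im_part_def dag_scaleR dag_diff dag_add dag_cscale)
    (simp_all add: vec_eq_iff cscale_def algebra_simps)

lemma parts_sum: "re_part M + cscale \<i> (im_part M) = M" "re_part M + cscale \<i> (- im_part M) = sigma M"
  by (simp_all add: vec_eq_iff re_part_def im_part_def cscale_def sigma_eq_dag scaleR_conv_of_real[where 'a=complex] field_simps)

lemma re_part_u_alg: "A \<in> u_alg \<Longrightarrow> re_part A = A"
  by (simp add: re_part_def u_alg_iff scaleR_2[symmetric])

lemma im_part_u_alg: "A \<in> u_alg \<Longrightarrow> im_part A = 0"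
  by (simp add: im_part_def u_alg_iff) (simp add: cscale_def vec_eq_iff)

lemma parts_add: "re_part (M + N) = re_part M + re_part N" "im_part (M + N) = im_part M + im_part N"
  by (simp_all add: re_part_def im_part_def dag_add vec_eq_iff cscale_def algebra_simps)

lemma parts_cscale:
  "re_part (cscale z M) = Re z *\<^sub>R re_part M + (- Im z) *\<^sub>R im_part M"
  "im_part (cscale z M) = Re z *\<^sub>R im_part M + Im z *\<^sub>R re_part M"
  by (simp_all only: re_part_def im_part_def dag_cscale)
    (simp_all add: vec_eq_iff cscale_def complex_eq_iff field_simps)

lemma parts_sigma: "re_part (sigma M) = re_part M" "im_part (sigma M) = - im_part M"
  by (simp_all add: re_part_def im_part_def sigma_eq_dag dag_minus vec_eq_iff cscale_def algebra_simps)

lemma u_alg_closed: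
  assumes "A \<in> u_alg" "B \<in> u_alg"
  shows "A + B \<in> u_alg" "A - B \<in> u_alg" "r *\<^sub>R A \<in> u_alg" "A ** B - B ** A \<in> u_alg"
proof -
  have "(- A) ** B = - (A ** B)" "A ** (- B) = - (A ** B)" for A B :: "'a mat"
    by (simp_all add: vec_eq_iff matrix_matrix_mult_def sum_negf)
  then show "A ** B - B ** A \<in> u_alg"
    using assms by (simp add: u_alg_iff dag_diff dag_mult)
qed (use assms in \<open>simp_all add: u_alg_iff dag_add dag_diff dag_scaleR\<close>)

lemma parts_unique:
  assumes "P \<in> u_alg" "Q \<in> u_alg"
  shows "re_part (P + cscale \<i> Q) = P" "im_part (P + cscale \<i> Q) = Q"
proof -
  have "im_part P = 0" "im_part Q = 0"
    using assms by (simp_all add: im_part_u_alg)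
  then show "re_part (P + cscale \<i> Q) = P" "im_part (P + cscale \<i> Q) = Q"
    using assms by (simp_all add: parts_add parts_cscale re_part_u_alg)
qed

text \<open>Expanding the commutator of A + iB and C + iD leaves real combinations of brackets,
  which lie in \<open>u_alg\<close>; uniqueness of the decomposition identifies them as the two
  components.\<close>

lemma parts_commutator:
  "re_part (M ** N - N ** M) = (re_part M ** re_part N - re_part N ** re_part M)
    - (im_part M ** im_part N - im_part N ** im_part M)" (is "_ = ?P")
  "im_part (M ** N - N ** M) = (re_part M ** im_part N - im_part N ** re_part M)
    + (im_part M ** re_part N - re_part N ** im_part M)" (is "_ = ?Q")
proof -
  have "(A + cscale \<i> B) ** (C + cscale \<i> D) - (C + cscale \<i> D) ** (A + cscale \<i> B) =
      ((A ** C - C ** A) - (B ** D - D ** B)) + cscale \<i> ((A ** D - D ** A) + (B ** C - C ** B))"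
    for A B C D :: "'a mat"
    by (simp add: vec_eq_iff matrix_matrix_mult_def cscale_def sum_subtractf[symmetric]
        sum.distrib[symmetric] sum_distrib_left algebra_simps)
  from this[of "re_part M" "im_part M" "re_part N" "im_part N"]
  have "M ** N - N ** M = ?P + cscale \<i> ?Q" unfolding parts_sum .
  moreover have "?P \<in> u_alg" "?Q \<in> u_alg"
    by (intro u_alg_closed parts_u_alg)+
  ultimately show "re_part (M ** N - N ** M) = ?P" "im_part (M ** N - N ** M) = ?Q"
    using parts_unique by metis+
qed

lemma munit_mult: "munit i j ** munit k l = (if j = k then munit i l else 0)"
  by (simp add: vec_eq_iff matrix_matrix_mult_def munit_def if_distrib[of "\<lambda>x. x * _"]
      if_distrib[of "\<lambda>x. _ * x"] cong: if_cong)

lemma mat_eq_sum_munit: "M = (\<Sum>i\<in>UNIV. \<Sum>j\<in>UNIV. cscale (M $ i $ j) (munit i j))"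
proof -
  have "(\<Sum>i\<in>UNIV. \<Sum>j\<in>UNIV. cscale (M $ i $ j) (munit i j)) $ k $ l = M $ k $ l" for k l
  proof -
    have "(\<Sum>i\<in>UNIV. \<Sum>j\<in>UNIV. cscale (M $ i $ j) (munit i j)) $ k $ l =
        (\<Sum>i\<in>UNIV. \<Sum>j\<in>UNIV. if i = k \<and> j = l then M $ i $ j else 0)"
      by (auto simp: munit_def cscale_def intro!: sum.cong)
    also have "\<dots> = (\<Sum>i\<in>UNIV. if i = k then M $ i $ l else 0)"
      by (intro sum.cong) (auto simp: if_distrib cong: if_cong)
    finally show ?thesis by simp
  qed
  then show ?thesis by (simp add: vec_eq_iff)
qed

text \<open>Brackets of \<open>U_gen a\<close> with \<open>sigma (U_gen b)\<close> produce the
  remaining matrix units only modulo the unit at the corner. The central generator supplies the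
  trace that isolates the corner unit.\<close>

lemma gl_generated:
  fixes S :: "'m::finite mat set"
  assumes add: "\<And>M N. M \<in> S \<Longrightarrow> N \<in> S \<Longrightarrow> M + N \<in> S"
    and scale: "\<And>z M. M \<in> S \<Longrightarrow> cscale z M \<in> S"
    and bracket: "\<And>M N. M \<in> S \<Longrightarrow> N \<in> S \<Longrightarrow> M ** N - N ** M \<in> S"
    and gens: "C_gen \<in> S" "\<And>a. U_gen a \<in> S" "\<And>a. sigma (U_gen a) \<in> S"
  shows "M \<in> S"
proof -
  have "cscale 0 C_gen \<in> S" by (intro scale gens)
  then have zero: "0 \<in> S" by (simp add: cscale_def vec_eq_iff zero_vec_def)
  have sum: "(\<Sum>i\<in>I. f i) \<in> S" if "\<And>i. i \<in> I \<Longrightarrow> f i \<in> S" for I :: "'i set" and f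
    using that by (induction I rule: infinite_finite_induct) (auto intro: zero add)
  have br: "(if a = b then munit None None else 0) - munit (Some b) (Some a) \<in> S" for a b
    using bracket[OF gens(2)[of a] gens(3)[of b]] unfolding U_gen_munit(2)
    unfolding U_gen_munit(1) by (simp add: munit_mult)
  have one: "mat 1 \<in> S"
    using scale[OF gens(1), of "- \<i>"] by (simp add: C_gen_def cscale_def mat_def vec_eq_iff)
  let ?n = "of_nat (CARD('m)) + 1 :: complex"
  let ?D = "\<Sum>a\<in>(UNIV :: 'm set). munit None None - munit (Some a) (Some a) :: 'm mat"
  \<comment> \<open>The identity plus the sum over a of (corner unit minus diagonal unit at a) is n
    times the corner unit, with n = \<open>?n\<close>.\<close>
  have "cscale (1 / ?n) (mat 1 + ?D) \<in> S"
    using br by (intro scale add one sum) (metis (full_types))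
  also have "cscale (1 / ?n) (mat 1 + ?D) = munit None None"
  proof -
    have n: "?n \<noteq> 0" by (metis Suc_eq_plus1 of_nat_Suc of_nat_neq_0 add.commute)
    have d: "(\<Sum>a\<in>UNIV. (munit (Some a) (Some a) :: 'm mat) $ i $ j) = (if i = j \<and> i \<noteq> None then 1 else 0)" for i j
      by (cases i; cases j) (auto simp: munit_def intro!: sum.neutral)
    have "?D $ i $ j = of_nat (CARD('m)) * (munit None None :: 'm mat) $ i $ j - (if i = j \<and> i \<noteq> None then 1 else 0)" for i j
      by (simp only: sum_component vector_minus_component sum_subtractf d) simp
    then have "cscale (1 / ?n) (mat 1 + ?D) $ i $ j = (munit None None :: 'm mat) $ i $ j" for i j
      using n by (cases i; cases j) (simp_all add: cscale_def mat_def munit_def del: sum_component)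
    then show ?thesis unfolding vec_eq_iff by blast
  qed
  finally have u00: "munit None None \<in> S" .
  have uba: "munit (Some b) (Some a) \<in> S" for a b
  proof -
    have "cscale (-1) ((if a = b then munit None None else 0) - munit (Some b) (Some a)) +
        (if a = b then munit None None else 0) \<in> S"
      using u00 zero br by (intro add scale) auto
    moreover have "cscale (-1) (P - Q) + P = Q" for P Q :: "'m mat"
      by (simp add: cscale_def vec_eq_iff)
    ultimately show ?thesis by simp
  qed
  have "munit i j \<in> S" for i j
  proof (cases i; cases j)
    show "munit i j \<in> S" if "i = None" "j = Some a" for a
      using gens(2)[of a] unfolding U_gen_munit(1) that .
    show "munit i j \<in> S" if "i = Some a" "j = None" for a
      using gens(3)[of a] unfolding U_gen_munit(2) that .
  qed (use u00 uba in auto)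
  then show ?thesis by (subst mat_eq_sum_munit) (intro sum scale)
qed

lemma complexify_inject: "complexify q = complexify q' \<Longrightarrow> q = q'"
  by (cases q; cases q') (simp add: complexify_def)

text \<open>Adding the equations for y and -y isolates the value at x; what remains is the value at
  y.\<close>

lemma cext_inject:
  assumes "cext \<alpha> x y p = cext \<alpha>' x y p" "cext \<alpha> x (- y) p = cext \<alpha>' x (- y) p"
    and "\<alpha> (- y) p = - \<alpha> y p" "\<alpha>' (- y) p = - \<alpha>' y p"
  shows "\<alpha> x p = \<alpha>' x p \<and> \<alpha> y p = \<alpha>' y p"
proof -
  have m: "complexify (- q) = - complexify q" "scale_cvec z (- u) = - scale_cvec z u"
    for q :: "'a pt" and z u
    by (cases q; cases u; simp add: complexify_def scale_cvec_def vec_eq_iff)+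
  let ?a = "complexify (\<alpha> x p)" and ?b = "scale_cvec \<i> (complexify (\<alpha> y p))"
  let ?a' = "complexify (\<alpha>' x p)" and ?b' = "scale_cvec \<i> (complexify (\<alpha>' y p))"
  have "?a + ?b = ?a' + ?b'" "?a - ?b = ?a' - ?b'"
    using assms by (simp_all add: cext_def m)
  then have "(?a + ?b) + (?a - ?b) = (?a' + ?b') + (?a' - ?b')" by simp
  then have "2 *\<^sub>R ?a = 2 *\<^sub>R ?a'" by (simp only: scaleR_2) simp
  then have "?a = ?a'" by simp
  moreover from this have "?b = ?b'" using \<open>?a + ?b = ?a' + ?b'\<close> by simp
  then have "complexify (\<alpha> y p) = complexify (\<alpha>' y p)"
    by (cases "complexify (\<alpha> y p)"; cases "complexify (\<alpha>' y p)") (simp add: scale_cvec_def vec_eq_iff)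
  ultimately show ?thesis using complexify_inject by blast
qed

text \<open>The elements on which both actions coincide form a real subalgebra: the bracket of
  vector fields at a point depends only on nearby values, and \<open>Nbar\<close> is open. It
  contains the Heisenberg basis, and its complexification contains generators of gl(n, C).\<close>

lemma infinitesimal_action_unique:
  fixes \<alpha> \<alpha>' :: "'m::finite liealg \<Rightarrow> 'm pt \<Rightarrow> 'm pt"
  assumes \<alpha>: "infinitesimal_action c \<alpha>" and \<alpha>': "infinitesimal_action c \<alpha>'"
    and "x \<in> g_alg" "p \<in> Nbar"
  shows "\<alpha> x p = \<alpha>' x p"
proof -
  define S where "S = {x \<in> g_alg. \<forall>p\<in>Nbar. \<alpha> x p = \<alpha>' x p}"
  have lin: "f (r *\<^sub>R x + s *\<^sub>R y) p = r *\<^sub>R f x p + s *\<^sub>R f y p"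
    if "infinitesimal_action c f" "x \<in> g_alg" "y \<in> g_alg" "p \<in> Nbar" for f :: "'m liealg \<Rightarrow> 'm pt \<Rightarrow> 'm pt" and x y p r s
    using that unfolding infinitesimal_action_def by blast
  have g_closed: "r *\<^sub>R x + s *\<^sub>R y \<in> g_alg" if "x \<in> g_alg" "y \<in> g_alg" for x y :: "'m liealg" and r s
    using that by (auto simp: g_alg_def intro!: u_alg_closed)
  have S_lin: "r *\<^sub>R x + s *\<^sub>R y \<in> S" if "x \<in> S" "y \<in> S" for x y r s
    using that g_closed lin[OF \<alpha>] lin[OF \<alpha>'] by (simp add: S_def)
  have neg: "f (- x) p = - f x p" if "infinitesimal_action c f" "x \<in> g_alg" "p \<in> Nbar" for f :: "'m liealg \<Rightarrow> 'm pt \<Rightarrow> 'm pt" and x p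
    using lin[OF that(1,2,2,3), of "-1" 0] by simp
  have S_bracket: "g_bracket x y \<in> S" if "x \<in> S" "y \<in> S" for x y
  proof -
    have xy: "x \<in> g_alg" "y \<in> g_alg" using that by (auto simp: S_def)
    then have "g_bracket x y \<in> g_alg"
      by (auto simp: g_alg_def g_bracket_def intro!: u_alg_closed split: prod.splits)
    moreover have "\<alpha> (g_bracket x y) p = \<alpha>' (g_bracket x y) p" if p: "p \<in> Nbar" for p
    proof -
      have "lie_bracket (\<alpha> x) (\<alpha> y) p = lie_bracket (\<alpha>' x) (\<alpha>' y) p"
        using frechet_derivative_cong_open[OF open_Nbar p, of "\<alpha> x" "\<alpha>' x"]
          frechet_derivative_cong_open[OF open_Nbar p, of "\<alpha> y" "\<alpha>' y"] p
          \<open>x \<in> S\<close> \<open>y \<in> S\<close> by (simp add: lie_bracket_def S_def)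
      then show ?thesis
        using \<alpha> \<alpha>' xy p unfolding infinitesimal_action_def by simp
    qed
    ultimately show ?thesis by (simp add: S_def)
  qed
  have pair: "x \<in> S \<and> y \<in> S" if "x \<in> g_alg" "y \<in> g_alg"
    "\<And>p. p \<in> Nbar \<Longrightarrow> cext \<alpha> x y p = cext \<alpha>' x y p \<and> cext \<alpha> x (- y) p = cext \<alpha>' x (- y) p" for x y
    using cext_inject[of \<alpha> x y _ \<alpha>'] that neg[OF \<alpha>] neg[OF \<alpha>'] by (auto simp: S_def)
  have gen: "complexify (f (C_gen, 0) p) = Y_C c p" "complexify (f (0, T_vec) p) = (0, 0, 0, 0, 1, 0)"
    if "infinitesimal_action c f" "p \<in> Nbar" for f :: "'m liealg \<Rightarrow> 'm pt \<Rightarrow> 'm pt" and p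
    using that unfolding infinitesimal_action_def by blast+
  \<comment> \<open>The complexification of the matrix part of S, to which
    \<open>gl_generated\<close> applies.\<close>
  define M where "M = {A. (re_part A, 0) \<in> S \<and> (im_part A, 0) \<in> S}"
  have M: "A \<in> M" for A
  proof (rule gl_generated[of M])
    show "A + B \<in> M" if "A \<in> M" "B \<in> M" for A B
      using that S_lin[of "(re_part A, 0)" "(re_part B, 0)" 1 1] S_lin[of "(im_part A, 0)" "(im_part B, 0)" 1 1]
      by (simp add: M_def parts_add)
    show "cscale z A \<in> M" if "A \<in> M" for z A
      using that S_lin[of "(re_part A, 0)" "(im_part A, 0)" "Re z" "- Im z"]
        S_lin[of "(im_part A, 0)" "(re_part A, 0)" "Re z" "Im z"]
      by (simp add: M_def parts_cscale)
    show "A ** B - B ** A \<in> M" if "A \<in> M" "B \<in> M" for A B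
    proof -
      have br: "(P ** Q - Q ** P, 0) \<in> S" if "(P, 0) \<in> S" "(Q, 0) \<in> S" for P Q
        using S_bracket[OF that] by (simp add: g_bracket_def heis_deriv_def heis_form_simps zero_prod_def)
      have d: "(P - Q, 0) \<in> S" "(P + Q, 0) \<in> S" if "(P, 0) \<in> S" "(Q, 0) \<in> S" for P Q
        using S_lin[OF that, of 1 "-1"] S_lin[OF that, of 1 1] by simp_all
      show ?thesis using that unfolding M_def mem_Collect_eq parts_commutator by (intro conjI d br) auto
    qed
    have "\<alpha> (C_gen, 0) p = \<alpha>' (C_gen, 0) p" if "p \<in> Nbar" for p
      by (rule complexify_inject) (simp add: gen(1)[OF _ that] \<alpha> \<alpha>')
    then have "(C_gen, 0) \<in> S"
      by (simp add: S_def g_alg_def C_gen_u_alg)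
    moreover have "im_part (C_gen :: 'm mat) = 0"
      by (rule im_part_u_alg[OF C_gen_u_alg(1)])
    moreover have "(0, 0) \<in> S" using S_lin[OF \<open>(C_gen, 0) \<in> S\<close> \<open>(C_gen, 0) \<in> S\<close>, of 0 0] by (simp add: zero_prod_def)
    ultimately show "C_gen \<in> M" by (simp add: M_def re_part_u_alg[OF C_gen_u_alg(1)])
    \<comment> \<open>Passing from \<open>U_gen a\<close> to its image under \<open>sigma\<close>
      negates the second component, so the values prescribed on these two generators are precisely
      the two equations required by \<open>cext_inject\<close>.\<close>
    have U: "(re_part (U_gen a), 0) \<in> S \<and> (im_part (U_gen a), 0) \<in> S" for a
    proof (rule pair)
      have "(re_part (U_gen a), 0) \<in> (g_alg :: 'm liealg set)" "(im_part (U_gen a), 0) \<in> (g_alg :: 'm liealg set)"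
        by (simp_all add: g_alg_def parts_u_alg)
      then show "(re_part (U_gen a), 0) \<in> (g_alg :: 'm liealg set)" "(im_part (U_gen a), 0) \<in> (g_alg :: 'm liealg set)" .
      have m: "- im_part (U_gen a) \<in> u_alg"
        using u_alg_closed(3)[OF parts_u_alg(2) parts_u_alg(2), of "-1"] by simp
      fix p :: "'m pt" assume p: "p \<in> Nbar"
      have "cext f (re_part (U_gen a), 0) (im_part (U_gen a), 0) p = Y_vf c a p"
        "cext f (re_part (U_gen a), 0) (- im_part (U_gen a), 0) p = cnj_cvec (Y_vf c a p)"
        if "infinitesimal_action c f" for f
        using that p parts_u_alg parts_sum[of "U_gen a"] m unfolding infinitesimal_action_def by blast+
      then show "cext \<alpha> (re_part (U_gen a), 0) (im_part (U_gen a), 0) p = cext \<alpha>' (re_part (U_gen a), 0) (im_part (U_gen a), 0) p \<and>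
          cext \<alpha> (re_part (U_gen a), 0) (- (im_part (U_gen a), 0)) p = cext \<alpha>' (re_part (U_gen a), 0) (- (im_part (U_gen a), 0)) p"
        using \<alpha> \<alpha>' by simp
    qed
    then show "U_gen a \<in> M" for a by (simp add: M_def)
    show "sigma (U_gen a) \<in> M" for a
      using U[of a] S_lin[of "(im_part (U_gen a), 0)" "(im_part (U_gen a), 0)" "-1" 0] by (simp add: M_def parts_sigma)
  qed
  have sum: "(\<Sum>i\<in>I. f i) \<in> S" if "\<And>i. i \<in> I \<Longrightarrow> f i \<in> S" for I :: "'m option set" and f
  proof -
    have "0 \<in> S" using M[of 0] S_lin[of "(re_part 0, 0)" "(re_part 0, 0)" 0 0]
      by (simp add: M_def zero_prod_def)
    then show ?thesis
      using that S_lin[of _ _ 1 1] by (induction I rule: infinite_finite_induct) auto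
  qed
  have "\<alpha> (0, T_vec) p = \<alpha>' (0, T_vec) p" if "p \<in> Nbar" for p
    by (rule complexify_inject) (simp add: gen(2)[OF _ that] \<alpha> \<alpha>')
  then have T: "(0, T_vec) \<in> S"
    by (simp add: S_def g_alg_def C_gen_u_alg)
  have ef: "(0, e_vec k) \<in> S \<and> (0, f_vec k) \<in> S" for k
  proof (rule pair)
    show "(0, e_vec k) \<in> g_alg" "(0, f_vec k) \<in> g_alg" by (simp_all add: g_alg_def C_gen_u_alg)
    show "cext \<alpha> (0, e_vec k) (0, f_vec k) p = cext \<alpha>' (0, e_vec k) (0, f_vec k) p \<and>
        cext \<alpha> (0, e_vec k) (- (0, f_vec k)) p = cext \<alpha>' (0, e_vec k) (- (0, f_vec k)) p"
      if "p \<in> Nbar" for p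
      using \<alpha> \<alpha>' that unfolding infinitesimal_action_def by simp
  qed
  obtain A v t where x: "x = (A, v, t)" by (metis prod_cases3)
  have A: "(A, 0) \<in> S"
    using M[of A] \<open>x \<in> g_alg\<close> by (simp add: M_def g_alg_def x re_part_u_alg)
  let ?v = "\<Sum>k\<in>UNIV. Re (v $ k) *\<^sub>R (0 :: 'm mat, e_vec k) + Im (v $ k) *\<^sub>R (0, f_vec k)"
  have "?v \<in> S" using ef by (intro sum S_lin) auto
  from S_lin[OF S_lin[OF A this, of 1 1] T, of 1 t] have "1 *\<^sub>R (1 *\<^sub>R (A, 0) + 1 *\<^sub>R ?v) + t *\<^sub>R (0, T_vec) \<in> S" .
  also have "1 *\<^sub>R (1 *\<^sub>R (A, 0) + 1 *\<^sub>R ?v) + t *\<^sub>R (0, T_vec) = x"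
  proof -
    have "fst (snd ?v) $ i = v $ i" for i
    proof -
      have "fst (snd ?v) $ i = (\<Sum>k\<in>UNIV. Re (v $ k) *\<^sub>R (axis k 1 :: complex^'m option) $ i + Im (v $ k) *\<^sub>R (axis k \<i> :: complex^'m option) $ i)"
        by (simp add: fst_sum snd_sum e_vec_def f_vec_def)
      also have "\<dots> = (\<Sum>k\<in>UNIV. if k = i then v $ k else 0)"
        by (intro sum.cong) (auto simp: axis_def complex_eq_iff)
      finally show ?thesis by simp
    qed
    then have "fst (snd ?v) = v" unfolding vec_eq_iff by blast
    moreover have "fst ?v = 0" "snd (snd ?v) = 0" by (simp_all add: fst_sum snd_sum e_vec_def f_vec_def)
    ultimately have "?v = (0, v, 0)" by (intro prod_eqI) simp_all
    then show ?thesis by (simp add: x T_vec_def)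
  qed
  finally show ?thesis using \<open>p \<in> Nbar\<close> by (simp add: S_def)
qed

lemma alpha_eq:
  assumes "x \<in> g_alg" "p \<in> Nbar"
  shows "alpha c x p = alpha_vf c x p"
proof (rule infinitesimal_action_unique[OF _ infinitesimal_action_alpha_vf assms])
  show "infinitesimal_action c (alpha c :: 'a liealg \<Rightarrow> 'a pt \<Rightarrow> 'a pt)"
    unfolding alpha_def
    by (rule someI[of "infinitesimal_action c" "alpha_vf c", OF infinitesimal_action_alpha_vf])
qed

section \<open>The isometric action\<close>

lemma group_semidirect:
  assumes "group G" "group N"
    and closed: "\<And>g h. g \<in> carrier G \<Longrightarrow> h \<in> carrier N \<Longrightarrow> a g h \<in> carrier N"
    and hom: "\<And>g h k. g \<in> carrier G \<Longrightarrow> h \<in> carrier N \<Longrightarrow> k \<in> carrier N \<Longrightarrow> a g (h \<otimes>\<^bsub>N\<^esub> k) = a g h \<otimes>\<^bsub>N\<^esub> a g k"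
    and act: "\<And>g g' h. g \<in> carrier G \<Longrightarrow> g' \<in> carrier G \<Longrightarrow> h \<in> carrier N \<Longrightarrow> a (g \<otimes>\<^bsub>G\<^esub> g') h = a g (a g' h)"
    and one: "\<And>h. h \<in> carrier N \<Longrightarrow> a \<one>\<^bsub>G\<^esub> h = h"
  shows "group (semidirect G a N)"
proof -
  interpret G: group G by fact
  interpret N: group N by fact
  show ?thesis
  proof (rule groupI)
    fix x assume "x \<in> carrier (semidirect G a N)"
    then obtain g h where x: "x = (g, h)" and gh: "g \<in> carrier G" "h \<in> carrier N"
      by (auto simp: semidirect_def)
    have "(inv\<^bsub>G\<^esub> g, a (inv\<^bsub>G\<^esub> g) (inv\<^bsub>N\<^esub> h)) \<otimes>\<^bsub>semidirect G a N\<^esub> x = \<one>\<^bsub>semidirect G a N\<^esub>"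
    proof -
      have "a (inv\<^bsub>G\<^esub> g) (inv\<^bsub>N\<^esub> h) \<otimes>\<^bsub>N\<^esub> a (inv\<^bsub>G\<^esub> g) h = a (inv\<^bsub>G\<^esub> g) \<one>\<^bsub>N\<^esub>"
        using gh hom[of "inv\<^bsub>G\<^esub> g" "inv\<^bsub>N\<^esub> h" h] by simp
      also have "\<dots> = \<one>\<^bsub>N\<^esub>"
        using gh hom[of "inv\<^bsub>G\<^esub> g" "\<one>\<^bsub>N\<^esub>" "\<one>\<^bsub>N\<^esub>"] closed[of "inv\<^bsub>G\<^esub> g" "\<one>\<^bsub>N\<^esub>"]
        by (metis G.inv_closed N.l_cancel_one N.one_closed N.r_one)
      finally show ?thesis using gh by (simp add: x semidirect_def)
    qed
    then show "\<exists>y\<in>carrier (semidirect G a N). y \<otimes>\<^bsub>semidirect G a N\<^esub> x = \<one>\<^bsub>semidirect G a N\<^esub>"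
      using gh closed by (intro bexI[of _ "(inv\<^bsub>G\<^esub> g, a (inv\<^bsub>G\<^esub> g) (inv\<^bsub>N\<^esub> h))"]) (auto simp: semidirect_def)
  qed (auto simp: semidirect_def closed hom act one G.m_assoc N.m_assoc)
qed

lemma Heis_simps [simp]: "carrier Heis = UNIV" "\<one>\<^bsub>Heis\<^esub> = (0, 0)"
  "(v, t) \<otimes>\<^bsub>Heis\<^esub> (v', t') = (v + v', t + t' + heis_form v v' / 2)"
  by (simp_all add: Heis_def)

lemma group_Heis: "group Heis"
proof (rule groupI)
  show "\<exists>y\<in>carrier Heis. y \<otimes>\<^bsub>Heis\<^esub> x = \<one>\<^bsub>Heis\<^esub>" for x :: "'a heis"
    by (rule bexI[of _ "- x"]; cases x) (simp_all add: heis_form_simps)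
qed (auto simp: heis_form_simps algebra_simps add_divide_distrib)

lemma heis_act_mult:
  "A \<in> carrier U_group \<Longrightarrow> heis_act A (h \<otimes>\<^bsub>Heis\<^esub> k) = heis_act A h \<otimes>\<^bsub>Heis\<^esub> heis_act A k"
  by (cases h; cases k) (simp add: heis_act_U matrix_vector_right_distrib heis_form_ctr)

lemma heis_act_compose:
  "A \<in> carrier U_group \<Longrightarrow> B \<in> carrier U_group \<Longrightarrow> heis_act (A ** B) h = heis_act A (heis_act B h)"
  by (simp add: heis_act_U U_mult ctr_mult matrix_vector_mul_assoc)

lemma heis_act_one: "heis_act (mat 1) h = h"
  by (simp add: heis_act_U U_one)

context matrix_subgroup
begin

lemma group_cover_Heis: "group (semidirect (cover G) (\<lambda>x. heis_act (cover_proj x)) Heis)"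
proof (rule group_semidirect[OF group_cover group_Heis])
  have U: "cover_proj g \<in> carrier U_group" if "g \<in> carrier (cover G)" for g
    using cover_proj_closed[OF that] carrier_subset by blast
  show "heis_act (cover_proj g) (h \<otimes>\<^bsub>Heis\<^esub> k) = heis_act (cover_proj g) h \<otimes>\<^bsub>Heis\<^esub> heis_act (cover_proj g) k"
    if "g \<in> carrier (cover G)" for g h k
    by (rule heis_act_mult[OF U[OF that]])
  show "heis_act (cover_proj (g \<otimes>\<^bsub>cover G\<^esub> g')) h = heis_act (cover_proj g) (heis_act (cover_proj g') h)"
    if "g \<in> carrier (cover G)" "g' \<in> carrier (cover G)" for g g' h
    by (simp add: cover_proj_mult that heis_act_compose U)
qed (simp_all add: cover_proj_one heis_act_one)

end

lemma group_U_cover_Heis: "group U_cover_Heis"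
  unfolding U_cover_Heis_def by (rule U.group_cover_Heis)

interpretation UH: group U_cover_Heis
  by (rule group_U_cover_Heis)

lemma U_cover_Heis_simps:
  "carrier U_cover_Heis = carrier (cover U_group) \<times> UNIV"
  "(x, h) \<otimes>\<^bsub>U_cover_Heis\<^esub> (y, k) = (x \<otimes>\<^bsub>cover U_group\<^esub> y, h \<otimes>\<^bsub>Heis\<^esub> heis_act (cover_proj x) k)"
  "\<one>\<^bsub>U_cover_Heis\<^esub> = (\<one>\<^bsub>cover U_group\<^esub>, (0, 0))"
  by (simp_all add: U_cover_Heis_def semidirect_def)

text \<open>The restriction to \<open>Nbar\<close> makes the map extensional, as membership in
  \<open>Bij Nbar\<close> demands, so that equality of maps may be tested on points of the
  manifold.\<close>

definition group_act :: "real \<Rightarrow> (real \<Rightarrow> 'm::finite mat) set \<times> 'm heis \<Rightarrow> 'm pt \<Rightarrow> 'm pt"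
  where "group_act c x = (\<lambda>p\<in>Nbar. act c (cover_proj (fst x)) (cover_arg (fst x)) (snd x) p)"

lemma group_act_Nbar: "x \<in> carrier U_cover_Heis \<Longrightarrow> p \<in> Nbar \<Longrightarrow> group_act c x p \<in> Nbar"
  by (auto simp: group_act_def U_cover_Heis_simps intro!: act_Nbar U.cover_proj_closed)

lemma group_act_compose:
  assumes "x \<in> carrier U_cover_Heis" "y \<in> carrier U_cover_Heis" "p \<in> Nbar"
  shows "group_act c x (group_act c y p) = group_act c (x \<otimes>\<^bsub>U_cover_Heis\<^esub> y) p"
proof -
  obtain g h g' h' where xy: "x = (g, h)" "y = (g', h')"
    and g: "g \<in> carrier (cover U_group)" "g' \<in> carrier (cover U_group)"
    using assms by (cases x; cases y) (auto simp: U_cover_Heis_simps)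
  note U = U.cover_proj_closed[OF g(1)] U.cover_proj_closed[OF g(2)]
  show ?thesis
    using assms(3) by (simp add: group_act_def xy U_cover_Heis_simps act_Nbar U act_compose
        U.cover_proj_mult cover_arg_mult g)
qed

lemma group_act_one: "p \<in> Nbar \<Longrightarrow> group_act c \<one>\<^bsub>U_cover_Heis\<^esub> p = p"
  by (simp add: group_act_def U_cover_Heis_simps U.cover_proj_one cover_arg_one act_one)

lemma carrier_Isom: "f \<in> carrier (Isom c) \<longleftrightarrow>
    f \<in> Bij Nbar \<and> smooth_on Nbar f \<and> smooth_on Nbar (inv_into Nbar f) \<and> preserves_metric_on c Nbar f"
  by (simp add: Isom_def)

lemma mult_Isom: "f \<in> carrier (Isom c) \<Longrightarrow> g \<in> carrier (Isom c) \<Longrightarrow> f \<otimes>\<^bsub>Isom c\<^esub> g = compose Nbar f g"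
  by (simp add: Isom_def BijGroup_def)

lemma frechet_derivative_act:
  assumes g: "g \<in> carrier U_group" and p: "p \<in> Nbar"
  shows "frechet_derivative (act c g \<theta> h) (at p) = dact c g h p 0 0"
proof -
  have N: "norm (fst p) < 1" using p by (simp add: mem_Nbar)
  have "(act c g \<theta> h has_derivative (\<lambda>d. dact c g h p 0 0 d)) (at p)"
    using has_derivative_act[OF has_derivative_const has_derivative_const has_derivative_ident g N] .
  then show ?thesis by (rule frechet_derivative_at[symmetric])
qed

lemma smooth_on_group_act:
  assumes "x \<in> carrier U_cover_Heis"
  shows "smooth_on Nbar (group_act c x)"
proof (rule smooth_on_cong[OF open_Nbar])
  show "smooth_on Nbar (act c (cover_proj (fst x)) (cover_arg (fst x)) (snd x))"
    using assms by (auto simp: U_cover_Heis_simps intro!: smooth_on_act U.cover_proj_closed)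
qed (simp add: group_act_def)

lemma preserves_metric_group_act:
  assumes "x \<in> carrier U_cover_Heis"
  shows "preserves_metric_on c Nbar (group_act c x)"
proof -
  have U: "cover_proj (fst x) \<in> carrier U_group"
    using assms by (auto simp: U_cover_Heis_simps intro!: U.cover_proj_closed)
  have fd: "frechet_derivative (group_act c x) (at p) = dact c (cover_proj (fst x)) (snd x) p 0 0"
    if "p \<in> Nbar" for p
    using frechet_derivative_cong_open[OF open_Nbar that, of "group_act c x"
        "act c (cover_proj (fst x)) (cover_arg (fst x)) (snd x)"]
    by (simp add: frechet_derivative_act[OF U that] group_act_def)
  show ?thesis
    unfolding preserves_metric_on_def
    by (auto simp: fd metric_act U) (simp add: group_act_def metric_act U)
qed

lemma inv_group_act:
  assumes x: "x \<in> carrier U_cover_Heis" and p: "p \<in> Nbar"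
  shows "group_act c (inv\<^bsub>U_cover_Heis\<^esub> x) (group_act c x p) = p"
    "group_act c x (group_act c (inv\<^bsub>U_cover_Heis\<^esub> x) p) = p"
proof -
  show "group_act c (inv\<^bsub>U_cover_Heis\<^esub> x) (group_act c x p) = p"
    "group_act c x (group_act c (inv\<^bsub>U_cover_Heis\<^esub> x) p) = p"
    using x p by (simp_all add: group_act_compose group_act_one)
qed

text \<open>The inverse map is the action of the inverse group element, so its smoothness is another
  instance of \<open>smooth_on_group_act\<close>.\<close>

lemma group_act_Isom:
  assumes x: "x \<in> carrier U_cover_Heis"
  shows "group_act c x \<in> carrier (Isom c)"
proof -
  let ?y = "inv\<^bsub>U_cover_Heis\<^esub> x"
  have y: "?y \<in> carrier U_cover_Heis" using x by simp
  have bij: "bij_betw (group_act c x) Nbar Nbar"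
    by (rule bij_betw_byWitness[where f'="group_act c ?y"])
      (auto simp: inv_group_act x group_act_Nbar y)
  have "inv_into Nbar (group_act c x) p = group_act c ?y p" if "p \<in> Nbar" for p
    by (rule inv_into_f_eq) (use bij that in \<open>auto simp: bij_betw_def group_act_Nbar y inv_group_act x\<close>)
  then have "smooth_on Nbar (inv_into Nbar (group_act c x))"
    by (intro smooth_on_cong[OF open_Nbar _ smooth_on_group_act[OF y]]) simp
  then show ?thesis
    using bij smooth_on_group_act[OF x] preserves_metric_group_act[OF x]
    by (simp add: carrier_Isom Bij_def group_act_def)
qed

lemma group_act_hom: "group_act c \<in> hom U_cover_Heis (Isom c)"
proof (rule homI)
  fix x y :: "(real \<Rightarrow> 'a mat) set \<times> 'a heis"
  assume xy: "x \<in> carrier U_cover_Heis" "y \<in> carrier U_cover_Heis"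
  then have "compose Nbar (group_act c x) (group_act c y) p = group_act c (x \<otimes>\<^bsub>U_cover_Heis\<^esub> y) p" for p
    by (cases "p \<in> Nbar") (simp add: compose_def group_act_compose, simp add: compose_def group_act_def)
  then have "compose Nbar (group_act c x) (group_act c y) = group_act c (x \<otimes>\<^bsub>U_cover_Heis\<^esub> y)"
    by (rule ext)
  then show "group_act c (x \<otimes>\<^bsub>U_cover_Heis\<^esub> y) = group_act c x \<otimes>\<^bsub>Isom c\<^esub> group_act c y"
    using xy by (simp add: mult_Isom group_act_Isom)
qed (rule group_act_Isom)

subsection \<open>Velocities\<close>

text \<open>\<theta> enters only as a translation of \<phi>, so its motion along a path can be
  differentiated apart from the rest.\<close>

lemma act_arg: "act c g \<theta> h p = act c g 0 h p - (0, 0, 2 * c * \<theta>, 0)"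
  by (cases p) (simp add: act_def algebra_simps)

text \<open>The surplus \<open>2 * c * Im (A $ None $ None)\<close> compensates for the constant
  \<theta> in \<open>dact\<close>; the velocity of \<open>cover_arg\<close> cancels it
  later.\<close>

lemma dact_one:
  "dact c (mat 1) (0, 0) p A \<eta> d = alpha_vf c (A, \<eta>) p + (0, 0, 2 * c * Im (A $ None $ None), 0) + d"
proof -
  have "dmob (mat 1) X A Y = proj_vf A X + Y" for X Y
    by (simp add: vec_eq_iff dmob_def proj_vf_def Let_def)
  moreover have "(mat 1 :: 'a mat) $ None $ None = 1" by (simp add: mat_def)
  ultimately show ?thesis
    by (cases d) (simp add: dact_def alpha_vf_def Let_def heis_form_simps algebra_simps)
qed

lemma based_subpath:
  assumes "U.based \<gamma>" "t \<in> {0..1}"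
  shows "U.based (subpath 0 t \<gamma>)"
proof (rule U.basedI)
  have "(\<lambda>s. t * s) ` {0..1} \<subseteq> {0..1}"
    using assms(2) by (auto simp: mult_le_one)
  then show "continuous_on {0..1} (subpath 0 t \<gamma>)"
    using continuous_on_compose2[OF U.basedD(1)[OF assms(1)], of "{0..1}" "\<lambda>s. t * s"]
    by (auto simp: subpath_def intro!: continuous_intros)
  show "subpath 0 t \<gamma> s \<in> carrier U_group" if "s \<in> {0..1}" for s
    using that assms(2) by (auto simp: subpath_def mult_le_one intro!: U.basedD(2)[OF assms(1)])
  show "subpath 0 t \<gamma> 0 = mat 1" using U.basedD(3)[OF assms(1)] by (simp add: subpath_def)
qed

text \<open>Near the identity, the continuous logarithm of the corner entry is the principal one.\<close>

lemma has_vector_derivative_cover_arg: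
  assumes \<gamma>: "U.based \<gamma>" and d: "(\<gamma> has_vector_derivative A) (at 0 within {0..1})"
  shows "((\<lambda>t. cover_arg (path_class U_group (subpath 0 t \<gamma>))) has_vector_derivative Im (A $ None $ None))
    (at 0 within {0..1})"
proof -
  obtain q where q: "continuous_on {0..1} q" "\<And>t. t \<in> {0..1} \<Longrightarrow> \<gamma> t $ None $ None = exp (q t)" "q 0 = 0"
    using corner_log_exists[OF \<gamma>] by blast
  have arg: "cover_arg (path_class U_group (subpath 0 t \<gamma>)) = Im (q t)" if t: "t \<in> {0..1}" for t
  proof -
    have "path_arg (subpath 0 t \<gamma>) = Im (q (t * 1))"
    proof (rule path_arg_eqI)
      show "continuous_on {0..1} (\<lambda>s. q (t * s))"
        by (rule continuous_on_compose2[OF q(1)]) (use t in \<open>auto simp: mult_le_one intro!: continuous_intros\<close>)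
      show "subpath 0 t \<gamma> s $ None $ None = exp (q (t * s))" if "s \<in> {0..1}" for s
        using that t q(2)[of "t * s"] by (simp add: subpath_def mult_le_one)
    qed (simp add: q(3))
    then show ?thesis by (simp add: cover_arg_path_class[OF based_subpath[OF \<gamma> t]])
  qed
  have \<gamma>0: "\<gamma> 0 $ None $ None = 1" using U.basedD(3)[OF \<gamma>] by (simp add: mat_def)
  have "((\<lambda>t. \<gamma> t $ None $ None) has_derivative (\<lambda>t. t *\<^sub>R A $ None $ None)) (at 0 within {0..1})"
    using bounded_linear.has_derivative[OF bounded_linear_vec_nth
        bounded_linear.has_derivative[OF bounded_linear_vec_nth d[unfolded has_vector_derivative_def]]]
    by simp
  from has_derivative_Ln_compose[OF this] have
    L: "((\<lambda>t. Ln (\<gamma> t $ None $ None)) has_derivative (\<lambda>t. t *\<^sub>R A $ None $ None)) (at 0 within {0..1})"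
    by (simp add: \<gamma>0)
  have "(q \<longlongrightarrow> 0) (at 0 within {0..1})"
    using q(1,3) unfolding continuous_on_def by force
  then have "\<forall>\<^sub>F t in at 0 within {0..1}. norm (q t) < 1"
    using tendstoD[of q 0 _ 1] by simp
  moreover have "\<forall>\<^sub>F t in at 0 within {0..1}. t \<in> {0..1::real}"
    by (simp add: eventually_at_filter)
  ultimately have ev: "\<forall>\<^sub>F t in at 0 within {0..1}. Ln (\<gamma> t $ None $ None) = q t"
  proof eventually_elim
    case (elim t)
    have "\<bar>Im (q t)\<bar> < pi" using elim(1) abs_Im_le_cmod[of "q t"] pi_gt3 by linarith
    then show ?case using q(2)[OF elim(2)] by (simp add: Ln_exp)
  qed
  have "(q has_derivative (\<lambda>t. t *\<^sub>R A $ None $ None)) (at 0 within {0..1})"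
    by (rule has_derivative_transform_eventually[OF L ev]) (simp_all add: \<gamma>0 q(3))
  then have "((\<lambda>t. Im (q t)) has_vector_derivative Im (A $ None $ None)) (at 0 within {0..1})"
    using bounded_linear.has_derivative[OF bounded_linear_Im] by (fastforce simp: has_vector_derivative_def)
  then show ?thesis
    by (rule has_vector_derivative_transform[rotated 2]) (auto simp: arg)
qed

text \<open>Differentiate the constant \<open>dag (\<gamma> t) ** \<gamma> t\<close> at t =
  0.\<close>

lemma velocity_u_alg:
  assumes \<gamma>: "U.based \<gamma>" and d: "(\<gamma> has_vector_derivative A) (at 0 within {0..1})"
  shows "A \<in> u_alg"
proof -
  note d' = d[unfolded has_vector_derivative_def]
  have "((\<lambda>t. dag (\<gamma> t) ** \<gamma> t) has_derivative (\<lambda>t. dag (\<gamma> 0) ** (t *\<^sub>R A) + dag (t *\<^sub>R A) ** \<gamma> 0)) (at 0 within {0..1})"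
    by (rule bounded_bilinear.FDERIV[OF bounded_bilinear_matrix_matrix
          bounded_linear.has_derivative[OF bounded_linear_dag d'] d'])
  then have "((\<lambda>t. dag (\<gamma> t) ** \<gamma> t) has_vector_derivative (A + dag A)) (at 0 within {0..1})"
    by (simp add: has_vector_derivative_def U.basedD(3)[OF \<gamma>] dag_scaleR scaleR_add_right)
  then have "((\<lambda>t. mat 1) has_vector_derivative (A + dag A)) (at 0 within {0..1})"
    by (rule has_vector_derivative_transform[rotated 2]) (auto simp: U_dag_left U.basedD(2)[OF \<gamma>])
  moreover have "at 0 within {0..1::real} \<noteq> bot"
    by (simp add: at_within_Icc_at_right)
  ultimately have "A + dag A = 0"
    using vector_derivative_unique_within has_vector_derivative_const by blast
  then show ?thesis by (simp add: u_alg_iff eq_neg_iff_add_eq_0 add.commute)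
qed

text \<open>The point is allowed to move too: in the comparison of the two actions, the inverse of
  one is applied to a point carried along by the other.\<close>

lemma has_vector_derivative_group_act:
  assumes \<gamma>: "U.based \<gamma>" and d: "(\<gamma> has_vector_derivative A) (at 0 within {0..1})"
    and h: "h 0 = 0" "(h has_vector_derivative \<xi>) (at 0 within {0..1})"
    and P: "\<And>t. t \<in> {0..1} \<Longrightarrow> P t \<in> Nbar" "(P has_vector_derivative P') (at 0 within {0..1})"
  shows "((\<lambda>t. group_act c (path_class U_group (subpath 0 t \<gamma>), h t) (P t)) has_vector_derivative
    alpha_vf c (A, \<xi>) (P 0) + P') (at 0 within {0..1})"
proof -
  note d' = d[unfolded has_vector_derivative_def] and h' = h(2)[unfolded has_vector_derivative_def]
    and P2 = P(2)[unfolded has_vector_derivative_def]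
  have N: "norm (fst (P 0)) < 1" using P(1)[of 0] by (simp add: mem_Nbar)
  have U: "\<gamma> 0 \<in> carrier U_group" using U.basedD(2)[OF \<gamma>] by simp
  have h0: "h 0 = (0, 0)" using h(1) by (simp add: zero_prod_def)
  have "((\<lambda>t. act c (\<gamma> t) 0 (h t) (P t)) has_derivative
      (\<lambda>t. dact c (\<gamma> 0) (h 0) (P 0) (t *\<^sub>R A) (t *\<^sub>R \<xi>) (t *\<^sub>R P'))) (at 0 within {0..1})"
    by (rule has_derivative_act[OF d' h' P2 U N])
  moreover have "dact c (\<gamma> 0) (h 0) (P 0) (t *\<^sub>R A) (t *\<^sub>R \<xi>) (t *\<^sub>R P') =
      t *\<^sub>R (alpha_vf c (A, \<xi>) (P 0) + (0, 0, 2 * c * Im (A $ None $ None), 0) + P')" for t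
  proof -
    have "alpha_vf c (t *\<^sub>R A, t *\<^sub>R \<xi>) p = t *\<^sub>R alpha_vf c (A, \<xi>) p" for p
      by (simp add: alpha_vf_def proj_vf_def vec_eq_iff heis_form_simps matrix_vector_scaleR ctr_scaleR algebra_simps)
    then show ?thesis
      by (simp add: U.basedD(3)[OF \<gamma>] h0 dact_one scaleR_add_right)
  qed
  ultimately have "((\<lambda>t. act c (\<gamma> t) 0 (h t) (P t)) has_vector_derivative
      alpha_vf c (A, \<xi>) (P 0) + (0, 0, 2 * c * Im (A $ None $ None), 0) + P') (at 0 within {0..1})"
    by (simp add: has_vector_derivative_def)
  moreover have "((\<lambda>t. (0, 0, 2 * c * cover_arg (path_class U_group (subpath 0 t \<gamma>)), 0) :: 'a pt)
      has_vector_derivative (0, 0, 2 * c * Im (A $ None $ None), 0)) (at 0 within {0..1})"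
    using has_vector_derivative_cover_arg[OF \<gamma> d] unfolding has_vector_derivative_def
    by (auto intro!: derivative_eq_intros)
  ultimately have D: "((\<lambda>t. act c (\<gamma> t) 0 (h t) (P t) - (0, 0, 2 * c * cover_arg (path_class U_group (subpath 0 t \<gamma>)), 0))
      has_vector_derivative (alpha_vf c (A, \<xi>) (P 0) + (0, 0, 2 * c * Im (A $ None $ None), 0) + P')
        - (0, 0, 2 * c * Im (A $ None $ None), 0)) (at 0 within {0..1})"
    by (rule has_vector_derivative_diff)
  have "act c (\<gamma> t) 0 (h t) (P t) - (0, 0, 2 * c * cover_arg (path_class U_group (subpath 0 t \<gamma>)), 0) =
      group_act c (path_class U_group (subpath 0 t \<gamma>), h t) (P t)" if "t \<in> {0..1}" for t
  proof -
    have "cover_proj (path_class U_group (subpath 0 t \<gamma>)) = \<gamma> t"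
      unfolding U.cover_proj_path_class[OF based_subpath[OF \<gamma> that]] by (simp add: subpath_def)
    then show ?thesis
      unfolding group_act_def fst_conv snd_conv using P(1)[OF that]
      by (simp add: act_arg[of c "\<gamma> t" "cover_arg (path_class U_group (subpath 0 t \<gamma>))"])
  qed
  then have "((\<lambda>t. group_act c (path_class U_group (subpath 0 t \<gamma>), h t) (P t))
      has_vector_derivative (alpha_vf c (A, \<xi>) (P 0) + (0, 0, 2 * c * Im (A $ None $ None), 0) + P')
        - (0, 0, 2 * c * Im (A $ None $ None), 0)) (at 0 within {0..1})"
    by (intro has_vector_derivative_transform[OF _ _ D]) auto
  then show ?thesis by simp
qed

lemma integrates_group_act: "integrates c (alpha c) (group_act c)"
  unfolding integrates_def
proof (intro conjI allI ballI impI)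
  show "group_act c \<in> hom U_cover_Heis (Isom c)" by (rule group_act_hom)
  fix \<gamma> :: "real \<Rightarrow> 'a mat" and A and h :: "real \<Rightarrow> 'a heis" and \<xi> and p :: "'a pt"
  assume p: "p \<in> Nbar" and *: "path \<gamma> \<and> path_image \<gamma> \<subseteq> carrier U_group \<and> pathstart \<gamma> = mat 1 \<and>
       (\<gamma> has_vector_derivative A) (at 0 within {0..1}) \<and>
       h 0 = 0 \<and> (h has_vector_derivative \<xi>) (at 0 within {0..1})"
  then have \<gamma>: "U.based \<gamma>" by (simp add: U.based_def)
  have "alpha c (A, \<xi>) p = alpha_vf c (A, \<xi>) p"
    using velocity_u_alg[OF \<gamma>] * p by (intro alpha_eq) (auto simp: g_alg_def)
  then show "((\<lambda>t. group_act c (path_class U_group (subpath 0 t \<gamma>), h t) p)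
      has_vector_derivative alpha c (A, \<xi>) p) (at 0 within {0..1})"
    using has_vector_derivative_group_act[OF \<gamma>, of A h \<xi> "\<lambda>_. p" 0 c] * p by simp
qed

section \<open>Uniqueness of the integrated action\<close>

subsection \<open>A Cayley chart of the unitary group\<close>

lemma smooth_on_prod:
  fixes f :: "'i \<Rightarrow> 'a::real_normed_vector \<Rightarrow> complex"
  shows "open S \<Longrightarrow> (\<And>i. i \<in> I \<Longrightarrow> smooth_on S (f i)) \<Longrightarrow> smooth_on S (\<lambda>x. \<Prod>i\<in>I. f i x)"
  by (induction I rule: infinite_finite_induct) (auto intro: smooth_on_const smooth_on_mult)

lemma smooth_on_vec_nth:
  "open S \<Longrightarrow> smooth_on S f \<Longrightarrow> smooth_on S (\<lambda>x. f x $ i)"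
  by (rule smooth_on_bounded_linear[OF _ bounded_linear_vec_nth])

lemma smooth_on_det:
  fixes f :: "'a::real_normed_vector \<Rightarrow> complex^'n::finite^'n"
  assumes "open S" "\<And>i j. smooth_on S (\<lambda>x. f x $ i $ j)"
  shows "smooth_on S (\<lambda>x. det (f x))"
  unfolding det_def by (intro smooth_on_sum smooth_on_mult smooth_on_const smooth_on_prod assms)

text \<open>Cramer's rule, which exhibits the inverse matrix as a smooth function.\<close>

definition cramer_inv :: "complex^'n::finite^'n \<Rightarrow> complex^'n^'n"
  where "cramer_inv A = (\<chi> k l. det (\<chi> i j. if j = k then axis l 1 $ i else A $ i $ j) / det A)"

lemma cramer_inv:
  assumes "det A \<noteq> 0"
  shows "A ** cramer_inv A = mat 1" "cramer_inv A ** A = mat 1"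
proof -
  have "A *v (\<chi> k. cramer_inv A $ k $ l) = axis l 1" for l
    unfolding cramer[OF assms] by (simp add: cramer_inv_def vec_eq_iff)
  then have "(A *v (\<chi> k. cramer_inv A $ k $ l)) $ i = axis l 1 $ i" for i l by simp
  then show "A ** cramer_inv A = mat 1"
    by (simp add: vec_eq_iff matrix_matrix_mult_def matrix_vector_mult_def mat_def axis_def)
  then show "cramer_inv A ** A = mat 1" by (simp add: matrix_left_right_inverse)
qed

lemma smooth_on_cramer_inv:
  fixes f :: "'a::real_normed_vector \<Rightarrow> complex^'n::finite^'n"
  assumes "open S" "smooth_on S f" "\<And>x. x \<in> S \<Longrightarrow> det (f x) \<noteq> 0"
  shows "smooth_on S (\<lambda>x. cramer_inv (f x))"
proof -
  have nth: "smooth_on S (\<lambda>x. f x $ i $ j)" for i j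
    by (intro smooth_on_vec_nth assms)
  have "smooth_on S (\<lambda>x. (\<chi> i j. if j = k then axis l 1 $ i else f x $ i $ j) $ i $ j)" for k l i j
    by (cases "j = k") (simp_all add: nth smooth_on_const assms(1))
  then show ?thesis
    unfolding cramer_inv_def
    by (intro smooth_on_vec smooth_on_divide smooth_on_det nth assms(1,3))
qed

text \<open>The rational chart from the Lie algebra near 0 to the group near 1. It and its inverse
  are explicit quotients, hence smooth by Cramer's rule.\<close>

definition cayley :: "'m::finite mat \<Rightarrow> 'm mat"
  where "cayley B = cramer_inv (mat 1 - B) ** (mat 1 + B)"

definition cayley_inv :: "'m::finite mat \<Rightarrow> 'm mat"
  where "cayley_inv g = cramer_inv (g + mat 1) ** (g - mat 1)"

lemma matrix_diff_distrib:
  "(A - B) ** C = A ** C - B ** C" "A ** (B - C) = A ** B - A ** (C :: 'a::comm_ring_1^'n^'n)"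
  by (simp_all add: vec_eq_iff matrix_matrix_mult_def algebra_simps sum_subtractf)

lemma matrix_add_distrib:
  "(A + B) ** C = A ** C + B ** C" "A ** (B + C) = A ** B + A ** (C :: 'a::comm_ring_1^'n^'n)"
  by (simp_all add: vec_eq_iff matrix_matrix_mult_def algebra_simps sum.distrib)

lemma matrix_minus_mult: "(- A) ** C = - (A ** C)" "A ** (- C) = - (A ** (C :: 'a::comm_ring_1^'n^'n))"
  by (simp_all add: vec_eq_iff matrix_matrix_mult_def sum_negf)

lemmas matrix_distribs = matrix_diff_distrib matrix_add_distrib matrix_minus_mult

lemma matrix_cancel_left:
  fixes A :: "complex^'n::finite^'n"
  assumes "det A \<noteq> 0" "A ** B = A ** C"
  shows "B = C"
proof -
  have "cramer_inv A ** (A ** B) = cramer_inv A ** (A ** C)" using assms(2) by simp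
  then show ?thesis by (simp add: matrix_mul_assoc cramer_inv[OF assms(1)])
qed

text \<open>For skew B, \<open>dag\<close> exchanges 1 - B and 1 + B, and these commute; so
  \<open>dag\<close> inverts their quotient.\<close>

lemma cayley_U:
  assumes "B \<in> u_alg" "det (mat 1 - B) \<noteq> 0"
  shows "cayley B \<in> carrier U_group"
proof -
  have dB: "dag B = - B" using assms(1) by (simp add: u_alg_iff)
  have P: "(mat 1 - B) ** cayley B = mat 1 + B"
    by (simp add: cayley_def matrix_mul_assoc cramer_inv[OF assms(2)])
  have "dag ((mat 1 - B) ** cayley B) = dag (mat 1 + B)" using P by simp
  then have Q: "dag (cayley B) ** (mat 1 + B) = mat 1 - B"
    by (simp add: dag_mult dag_add dag_diff dB)
  have comm: "(mat 1 + B) ** (mat 1 - B) = (mat 1 - B) ** (mat 1 + B)"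
    by (simp add: matrix_distribs)
  have "cayley B ** (mat 1 - B) = mat 1 + B"
  proof (rule matrix_cancel_left[OF assms(2)])
    show "(mat 1 - B) ** (cayley B ** (mat 1 - B)) = (mat 1 - B) ** (mat 1 + B)"
      by (simp add: matrix_mul_assoc P comm)
  qed
  then have "dag (cayley B) ** cayley B ** (mat 1 - B) = mat 1 ** (mat 1 - B)"
    by (simp add: matrix_mul_assoc[symmetric] Q)
  then have "dag (cayley B) ** cayley B ** (mat 1 - B) ** cramer_inv (mat 1 - B) =
      mat 1 ** (mat 1 - B) ** cramer_inv (mat 1 - B)" by simp
  then show ?thesis
    by (simp add: mem_U_iff matrix_mul_assoc[symmetric] cramer_inv[OF assms(2)])
qed

lemma cayley_inv_u_alg:
  assumes g: "g \<in> carrier U_group" and d: "det (g + mat 1) \<noteq> 0"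
  shows "cayley_inv g \<in> u_alg"
proof -
  let ?K = "cayley_inv g"
  have P: "(g + mat 1) ** ?K = g - mat 1"
    by (simp add: cayley_inv_def matrix_mul_assoc cramer_inv[OF d])
  have "dag ((g + mat 1) ** ?K) ** g = dag (g - mat 1) ** g" using P by simp
  then have Q: "dag ?K ** (g + mat 1) = mat 1 - g"
    by (simp add: dag_mult dag_add dag_diff matrix_distribs matrix_mul_assoc[symmetric] U_dag_left[OF g] add.commute)
  have R: "?K ** (g + mat 1) = g - mat 1"
    by (rule matrix_cancel_left[OF d], simp add: matrix_mul_assoc P) (simp add: matrix_distribs)
  have "dag ?K ** (g + mat 1) = (- ?K) ** (g + mat 1)" by (simp only: Q R matrix_minus_mult minus_diff_eq)
  then have "dag ?K ** (g + mat 1) ** cramer_inv (g + mat 1) = (- ?K) ** (g + mat 1) ** cramer_inv (g + mat 1)"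
    by simp
  then show ?thesis by (simp add: u_alg_iff matrix_mul_assoc[symmetric] cramer_inv[OF d])
qed

lemma cayley_cayley_inv:
  assumes "det (g + mat 1) \<noteq> 0" "det (mat 1 - cayley_inv g) \<noteq> 0"
  shows "cayley (cayley_inv g) = g"
proof -
  let ?K = "cayley_inv g"
  have P: "(g + mat 1) ** ?K = g - mat 1"
    by (simp add: cayley_inv_def matrix_mul_assoc cramer_inv[OF assms(1)])
  have "?K ** (g + mat 1) = g - mat 1"
    by (rule matrix_cancel_left[OF assms(1)], simp add: matrix_mul_assoc P) (simp add: matrix_distribs)
  then have "(mat 1 - ?K) ** g = mat 1 + ?K" by (simp add: matrix_distribs algebra_simps)
  moreover have "(mat 1 - ?K) ** cayley ?K = mat 1 + ?K"
    by (simp add: cayley_def matrix_mul_assoc cramer_inv[OF assms(2)])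
  ultimately show ?thesis using matrix_cancel_left[OF assms(2)] by metis
qed

lemma smooth_on_ident: "open S \<Longrightarrow> smooth_on S (\<lambda>x. x)"
  by (rule smooth_on_linear[OF _ bounded_linear_ident])

lemma smooth_on_imp_continuous_on: "smooth_on S f \<Longrightarrow> continuous_on S f"
  unfolding smooth_on_def by (metis Ck_on.simps(1))

lemma open_det_nonzero:
  fixes f :: "'a::real_normed_vector \<Rightarrow> complex^'n::finite^'n"
  assumes "\<And>i j. smooth_on UNIV (\<lambda>A. f A $ i $ j)"
  shows "open {A. det (f A) \<noteq> 0}"
  using smooth_on_imp_continuous_on[OF smooth_on_det[OF open_UNIV assms]]
  by (intro open_Collect_neq) (auto intro: continuous_intros)

lemma smooth_on_cayley: "open S \<Longrightarrow> (\<And>B. B \<in> S \<Longrightarrow> det (mat 1 - B) \<noteq> 0) \<Longrightarrow> smooth_on S cayley"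
  unfolding cayley_def
  by (intro smooth_on_bilinear[OF _ bounded_bilinear_matrix_matrix] smooth_on_cramer_inv
      smooth_on_add smooth_on_diff smooth_on_const smooth_on_ident)

lemma smooth_on_cayley_inv: "open S \<Longrightarrow> (\<And>g. g \<in> S \<Longrightarrow> det (g + mat 1) \<noteq> 0) \<Longrightarrow> smooth_on S cayley_inv"
  unfolding cayley_inv_def
  by (intro smooth_on_bilinear[OF _ bounded_bilinear_matrix_matrix] smooth_on_cramer_inv
      smooth_on_add smooth_on_diff smooth_on_const smooth_on_ident)

lemma cayley_0: "cayley 0 = mat 1" and cayley_inv_1: "cayley_inv (mat 1) = 0"
  using cramer_inv(2)[of "mat 1"] by (simp_all add: cayley_def cayley_inv_def)

text \<open>Ensures that the inverse Cayley transform is defined at the identity.\<close>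

lemma det_2: "det (mat 1 + mat 1 :: complex^'n::finite^'n) \<noteq> 0"
proof -
  have "(mat 1 + mat 1 :: complex^'n^'n) ** ((1/2) *\<^sub>R mat 1) = mat 1"
    by (simp only: matrix_add_distrib matrix_mul_lid scaleR_add_left[symmetric]) simp
  then have "det (mat 1 + mat 1 :: complex^'n^'n) * det ((1/2) *\<^sub>R mat 1 :: complex^'n^'n) = 1"
    by (metis det_I det_mul)
  then show ?thesis by auto
qed

text \<open>
  A path in a Cayley chart is homotopic to the Cayley image of a straight segment. The segment is
  parametrised by a sine so that the resulting curve extends to the whole real line.
\<close>

lemma small_path_homotopic_smooth:
  obtains \<delta> :: real where "\<delta> > 0"
    "\<And>\<gamma> :: real \<Rightarrow> 'm::finite mat. U.based \<gamma> \<Longrightarrow> (\<And>t. t \<in> {0..1} \<Longrightarrow> dist (\<gamma> t) (mat 1) < \<delta>) \<Longrightarrow>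
      \<exists>\<Gamma>. (\<forall>s. \<Gamma> s \<in> carrier U_group \<and> (\<exists>A. (\<Gamma> has_vector_derivative A) (at s))) \<and> \<Gamma> 0 = mat 1 \<and>
        path_class U_group \<gamma> = path_class U_group \<Gamma>"
proof -
  have "open {B :: 'm mat. det (mat 1 - B) \<noteq> 0}"
    by (intro open_det_nonzero smooth_on_vec_nth smooth_on_diff smooth_on_const smooth_on_ident open_UNIV)
  moreover have "(0 :: 'm mat) \<in> {B. det (mat 1 - B) \<noteq> 0}" by simp
  ultimately obtain r where r: "r > 0" "ball 0 r \<subseteq> {B :: 'm mat. det (mat 1 - B) \<noteq> 0}"
    by (rule openE) auto
  let ?E = "{g :: 'm mat. det (g + mat 1) \<noteq> 0}"
  have E: "open ?E"
    by (intro open_det_nonzero smooth_on_vec_nth smooth_on_add smooth_on_const smooth_on_ident open_UNIV)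
  have K: "continuous_on ?E cayley_inv"
    by (rule smooth_on_imp_continuous_on[OF smooth_on_cayley_inv[OF E]]) simp
  \<comment> \<open>The radius r keeps 1 - B invertible; \<delta> is chosen so that near the
    identity g + 1 is invertible and the Cayley parameter stays within r.\<close>
  have "open (?E \<inter> cayley_inv -` ball 0 r)"
    by (rule continuous_open_preimage[OF K E open_ball])
  moreover have "mat 1 \<in> ?E \<inter> cayley_inv -` ball 0 r"
    using r(1) det_2 by (simp add: cayley_inv_1)
  ultimately obtain \<delta> where \<delta>: "\<delta> > 0" "ball (mat 1) \<delta> \<subseteq> ?E \<inter> cayley_inv -` ball 0 r"
    by (rule openE) auto
  have ck: "smooth_on (ball 0 r) (cayley :: 'm mat \<Rightarrow> 'm mat)"
    by (rule smooth_on_cayley) (use r in auto)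
  show ?thesis
  proof (rule that[OF \<delta>(1)])
    fix \<gamma> :: "real \<Rightarrow> 'm mat"
    assume \<gamma>: "U.based \<gamma>" and small: "\<And>t. t \<in> {0..1} \<Longrightarrow> dist (\<gamma> t) (mat 1) < \<delta>"
    have g: "det (\<gamma> t + mat 1) \<noteq> 0" "norm (cayley_inv (\<gamma> t)) < r" "\<gamma> t \<in> ?E" if "t \<in> {0..1}" for t
      using small[OF that] \<delta>(2) by (auto simp: dist_commute subset_iff)
    let ?V = "u_alg \<inter> ball 0 r :: 'm mat set"
    define \<kappa> where "\<kappa> t = cayley_inv (\<gamma> t)" for t
    define \<Gamma> where "\<Gamma> s = cayley (sin (pi / 2 * s) *\<^sub>R \<kappa> 1)" for s
    have \<kappa>V: "\<kappa> t \<in> ?V" if "t \<in> {0..1}" for t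
      using cayley_inv_u_alg[OF U.basedD(2)[OF \<gamma> that] g(1)[OF that]] g(2)[OF that] by (simp add: \<kappa>_def)
    have sV: "x *\<^sub>R \<kappa> 1 \<in> ?V" if "\<bar>x\<bar> \<le> 1" for x
    proof -
      have "\<kappa> 1 \<in> ?V" by (rule \<kappa>V) simp
      then have "\<bar>x\<bar> * norm (\<kappa> 1) < r" using that mult_left_le_one_le[of "norm (\<kappa> 1)" "\<bar>x\<bar>"] by simp
      then show ?thesis using \<open>\<kappa> 1 \<in> ?V\<close> u_alg_closed(3)[of "\<kappa> 1" "\<kappa> 1" x] by simp
    qed
    have VU: "cayley B \<in> carrier U_group" if "B \<in> ?V" for B
      using that r(2) by (auto intro!: cayley_U)
    have \<kappa>0: "\<kappa> 0 = 0" using U.basedD(3)[OF \<gamma>] by (simp add: \<kappa>_def cayley_inv_1)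
    have conv: "convex ?V"
      by (intro convex_Int convex_ball) (auto simp: convex_def u_alg_closed)
    \<comment> \<open>\<open>?V\<close> is convex, so the path of Cayley parameters deforms linearly
      to the segment. The sine is 0 at s = 0, 1 at s = 1 and at most 1 in modulus everywhere, which
      keeps the curve in the chart.\<close>
    have "homotopic_paths ?V \<kappa> (\<lambda>s. sin (pi / 2 * s) *\<^sub>R \<kappa> 1)"
    proof (rule homotopic_paths_linear)
      show "path \<kappa>" unfolding path_def \<kappa>_def
        by (rule continuous_on_compose2[OF K U.basedD(1)[OF \<gamma>]]) (use g in auto)
      show "path (\<lambda>s. sin (pi / 2 * s) *\<^sub>R \<kappa> 1)" unfolding path_def by (intro continuous_intros)
      show "closed_segment (\<kappa> t) (sin (pi / 2 * t) *\<^sub>R \<kappa> 1) \<subseteq> ?V" if "t \<in> {0..1}" for t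
        by (intro closed_segment_subset \<kappa>V that sV conv) simp
    qed (simp_all add: pathstart_def pathfinish_def \<kappa>0)
    then have "homotopic_paths (carrier U_group) (cayley \<circ> \<kappa>) (cayley \<circ> (\<lambda>s. sin (pi / 2 * s) *\<^sub>R \<kappa> 1))"
      by (rule homotopic_paths_continuous_image)
        (use VU in \<open>auto intro: continuous_on_subset[OF smooth_on_imp_continuous_on[OF ck]]\<close>)
    then have "path_class U_group (cayley \<circ> \<kappa>) = path_class U_group \<Gamma>"
      by (intro U.path_class_eqI) (simp add: \<Gamma>_def[abs_def] o_def)
    moreover have "path_class U_group \<gamma> = path_class U_group (cayley \<circ> \<kappa>)"
    proof (rule U.path_class_cong[OF \<gamma>])
      show "\<gamma> t = (cayley \<circ> \<kappa>) t" if "t \<in> {0..1}" for t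
        using cayley_cayley_inv[OF g(1)[OF that]] g(2)[OF that] r(2) by (auto simp: \<kappa>_def subset_iff)
    qed
    moreover have "\<exists>A. (\<Gamma> has_vector_derivative A) (at s)" for s
    proof -
      have "cayley differentiable at (sin (pi / 2 * s) *\<^sub>R \<kappa> 1)"
        using smooth_on_imp_differentiable[OF ck] sV[of "sin (pi / 2 * s)"] by simp
      then obtain D where D: "(cayley has_derivative D) (at (sin (pi / 2 * s) *\<^sub>R \<kappa> 1))"
        unfolding differentiable_def by blast
      have "((\<lambda>s. sin (pi / 2 * s) *\<^sub>R \<kappa> 1) has_derivative (\<lambda>t. (t * (pi / 2 * cos (pi / 2 * s))) *\<^sub>R \<kappa> 1)) (at s)"
        by (auto intro!: derivative_eq_intros simp: ac_simps)
      from has_derivative_compose[OF this D]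
      have "(\<Gamma> has_derivative (\<lambda>t. D ((t * (pi / 2 * cos (pi / 2 * s))) *\<^sub>R \<kappa> 1))) (at s)"
        unfolding \<Gamma>_def .
      also have "(\<lambda>t. D ((t * (pi / 2 * cos (pi / 2 * s))) *\<^sub>R \<kappa> 1)) =
          (\<lambda>t. t *\<^sub>R D ((pi / 2 * cos (pi / 2 * s)) *\<^sub>R \<kappa> 1))"
        by (simp only: scaleR_scaleR[symmetric] linear_cmul[OF has_derivative_linear[OF D]])
      finally show ?thesis unfolding has_vector_derivative_def by blast
    qed
    moreover have "\<Gamma> s \<in> carrier U_group" for s
      unfolding \<Gamma>_def by (rule VU[OF sV]) simp
    moreover have "\<Gamma> 0 = mat 1" by (simp add: \<Gamma>_def cayley_0)
    ultimately show "\<exists>\<Gamma>. (\<forall>s. \<Gamma> s \<in> carrier U_group \<and> (\<exists>A. (\<Gamma> has_vector_derivative A) (at s))) \<and> \<Gamma> 0 = mat 1 \<and>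
        path_class U_group \<gamma> = path_class U_group \<Gamma>"
      by (intro exI[of _ \<Gamma>]) simp
  qed
qed

subsection \<open>Curves in the group\<close>

text \<open>Translates the remainder of the path from s to s' back to the identity, where
  \<open>integrates\<close> prescribes velocities. T is the real line for differentiable curves and
  the unit interval for general paths.\<close>

lemma path_class_split:
  fixes \<Gamma> :: "real \<Rightarrow> 'm::finite mat"
  assumes cont: "continuous_on T \<Gamma>" and T: "convex T" "0 \<in> T" "s \<in> T" "s' \<in> T"
    and U: "\<And>t. t \<in> T \<Longrightarrow> \<Gamma> t \<in> carrier U_group" and \<Gamma>0: "\<Gamma> 0 = mat 1"
  shows "U.based (\<lambda>\<tau>. \<Gamma> (s * \<tau>))"
    and "U.based (\<lambda>\<tau>. \<Gamma> (s + \<tau> * (s' - s)) ** dag (\<Gamma> s))"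
    and "path_class U_group (\<lambda>\<tau>. \<Gamma> (s' * \<tau>)) =
      path_class U_group (\<lambda>\<tau>. \<Gamma> (s + \<tau> * (s' - s)) ** dag (\<Gamma> s)) \<otimes>\<^bsub>cover U_group\<^esub>
        path_class U_group (\<lambda>\<tau>. \<Gamma> (s * \<tau>))"
proof -
  have cv: "x + u * (y - x) \<in> T" if "x \<in> T" "y \<in> T" "u \<in> {0..1}" for x y u
    using convexD_alt[OF T(1) that(1,2), of u] that(3) by (simp add: algebra_simps)
  have cv0: "y * u \<in> T" if "y \<in> T" "u \<in> {0..1}" for y u
    using cv[OF T(2) that] by (simp add: mult.commute)
  have cc: "continuous_on S (\<lambda>x. \<Gamma> (f x))" if "continuous_on S f" "\<And>x. x \<in> S \<Longrightarrow> f x \<in> T" for S and f :: "'b::topological_space \<Rightarrow> real"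
    by (rule continuous_on_compose2[OF cont that(1)]) (use that(2) in auto)
  have b: "U.based (\<lambda>\<tau>. \<Gamma> (y * \<tau>))" if "y \<in> T" for y
    by (rule U.basedI) (auto intro!: cc U cv0 that continuous_intros simp: \<Gamma>0)
  then show b1: "U.based (\<lambda>\<tau>. \<Gamma> (s * \<tau>))" using T by blast
  show b2: "U.based (\<lambda>\<tau>. \<Gamma> (s + \<tau> * (s' - s)) ** dag (\<Gamma> s))"
    by (rule U.basedI)
      (auto intro!: cc U U_mult U_dag cv T continuous_intros continuous_on_matrix_mult U_dag_right)
  \<comment> \<open>The first coordinate t of z slides the breaking point \<open>t * s\<close> from
    0 to s. At both ends of the second coordinate the factors involving \<Gamma> at
    \<open>t * s\<close> cancel, so the end points stay fixed.\<close>
  let ?a = "\<lambda>z :: real \<times> real. fst z * s + snd z * (s' - fst z * s)"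
  have zT: "?a z \<in> T" "s * fst z \<in> T" "snd z * (fst z * s) \<in> T" if "z \<in> {0..1} \<times> {0..1}" for z
  proof -
    have z: "fst z \<in> {0..1}" "snd z \<in> {0..1}" using that by auto
    show 1: "s * fst z \<in> T" by (rule cv0[OF T(3) z(1)])
    show "?a z \<in> T" using cv[OF 1 T(4) z(2)] by (simp add: mult.commute)
    show "snd z * (fst z * s) \<in> T" using cv0[OF 1 z(2)] by (simp add: ac_simps)
  qed
  have "homotopic_paths (carrier U_group) (\<lambda>\<tau>. \<Gamma> (s' * \<tau>))
      (\<lambda>\<tau>. (\<Gamma> (s + \<tau> * (s' - s)) ** dag (\<Gamma> s)) ** \<Gamma> (s * \<tau>))"
    unfolding homotopic_paths
  proof (intro exI[of _ "\<lambda>z. (\<Gamma> (?a z) ** dag (\<Gamma> (s * fst z))) ** \<Gamma> (snd z * (fst z * s))"] conjI ballI)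
    show "continuous_on ({0..1} \<times> {0..1}) (\<lambda>z. (\<Gamma> (?a z) ** dag (\<Gamma> (s * fst z))) ** \<Gamma> (snd z * (fst z * s)))"
      by (intro continuous_on_matrix_mult continuous_on_dag cc zT) (auto intro!: continuous_intros)
    show "(\<lambda>z. (\<Gamma> (?a z) ** dag (\<Gamma> (s * fst z))) ** \<Gamma> (snd z * (fst z * s))) \<in> ({0..1} \<times> {0..1}) \<rightarrow> carrier U_group"
      by (intro funcsetI U_mult U_dag U zT)
    fix t :: real assume t: "t \<in> {0..1}"
    show "pathstart ((\<lambda>z. (\<Gamma> (?a z) ** dag (\<Gamma> (s * fst z))) ** \<Gamma> (snd z * (fst z * s))) \<circ> Pair t) = pathstart (\<lambda>\<tau>. \<Gamma> (s' * \<tau>))"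
      using U_dag_right[OF U[OF cv0[OF T(3) t]]] by (simp add: pathstart_def \<Gamma>0 mult.commute)
    show "pathfinish ((\<lambda>z. (\<Gamma> (?a z) ** dag (\<Gamma> (s * fst z))) ** \<Gamma> (snd z * (fst z * s))) \<circ> Pair t) = pathfinish (\<lambda>\<tau>. \<Gamma> (s' * \<tau>))"
      using U_dag_left[OF U[OF cv0[OF T(3) t]]]
      by (simp add: pathfinish_def mult.commute flip: matrix_mul_assoc)
  qed (simp_all add: \<Gamma>0 mult.commute)
  then show "path_class U_group (\<lambda>\<tau>. \<Gamma> (s' * \<tau>)) =
      path_class U_group (\<lambda>\<tau>. \<Gamma> (s + \<tau> * (s' - s)) ** dag (\<Gamma> s)) \<otimes>\<^bsub>cover U_group\<^esub>
        path_class U_group (\<lambda>\<tau>. \<Gamma> (s * \<tau>))"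
    unfolding U.mult_path_class[OF b2 b1] by (rule U.path_class_eqI)
qed

definition curve :: "(real \<Rightarrow> 'm::finite mat) \<Rightarrow> (real \<Rightarrow> 'm heis) \<Rightarrow> real \<Rightarrow> (real \<Rightarrow> 'm mat) set \<times> 'm heis"
  where "curve \<gamma> h t = (path_class U_group (subpath 0 t \<gamma>), h t)"

text \<open>The data for which \<open>integrates\<close> prescribes a velocity.\<close>

definition admissible :: "(real \<Rightarrow> 'm::finite mat) \<Rightarrow> (real \<Rightarrow> 'm heis) \<Rightarrow> 'm mat \<Rightarrow> 'm heis \<Rightarrow> bool"
  where "admissible \<gamma> h A \<xi> \<longleftrightarrow> U.based \<gamma> \<and> (\<gamma> has_vector_derivative A) (at 0 within {0..1}) \<and>
    h 0 = 0 \<and> (h has_vector_derivative \<xi>) (at 0 within {0..1})"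

text \<open>One-sided differentiability of \<open>\<theta>\<close> at \<open>s\<close> in the direction \<open>u\<close>, with respect to right translations.\<close>

definition moves :: "(real \<Rightarrow> (real \<Rightarrow> 'm::finite mat) set \<times> 'm heis) \<Rightarrow> real \<Rightarrow> real \<Rightarrow> bool"
  where "moves \<theta> s u \<longleftrightarrow> (\<exists>\<gamma> h A \<xi>. admissible \<gamma> h A \<xi> \<and>
    (\<forall>e\<in>{0..1}. \<theta> (s + u * e) = curve \<gamma> h e \<otimes>\<^bsub>U_cover_Heis\<^esub> \<theta> s))"

lemma curve_carrier: "U.based \<gamma> \<Longrightarrow> t \<in> {0..1} \<Longrightarrow> curve \<gamma> h t \<in> carrier U_cover_Heis"
  by (simp add: curve_def U_cover_Heis_simps U.path_class_in_cover[OF based_subpath])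

lemma curve_zero: "U.based \<gamma> \<Longrightarrow> h 0 = 0 \<Longrightarrow> curve \<gamma> h 0 = \<one>\<^bsub>U_cover_Heis\<^esub>"
proof -
  assume "U.based \<gamma>" "h 0 = 0"
  moreover from this have "subpath 0 0 \<gamma> = (\<lambda>t. mat 1)" by (simp add: subpath_def U.basedD(3))
  ultimately show ?thesis by (simp add: curve_def U_cover_Heis_simps U.one_cover zero_prod_def)
qed

text \<open>The pointwise inverse of a curve is again a curve of the same kind, so that the velocity
  formula applies to it.\<close>

lemma inv_curve:
  assumes \<gamma>: "U.based \<gamma>" and t: "t \<in> {0..1}"
  shows "inv\<^bsub>U_cover_Heis\<^esub> (curve \<gamma> h t) = curve (\<lambda>t. dag (\<gamma> t)) (\<lambda>t. heis_act (dag (\<gamma> t)) (- h t)) t"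
proof -
  note b = based_subpath[OF \<gamma> t]
  have s: "subpath 0 t (\<lambda>t. dag (\<gamma> t)) = (\<lambda>\<tau>. dag (subpath 0 t \<gamma> \<tau>))"
    by (simp add: subpath_def)
  have U: "\<gamma> t \<in> carrier U_group" by (rule U.basedD(2)[OF \<gamma> t])
  have p: "cover_proj (path_class U_group (\<lambda>\<tau>. dag (subpath 0 t \<gamma> \<tau>))) = dag (\<gamma> t)"
    unfolding U.cover_proj_path_class[OF U.based_dag[OF b]] by (simp add: subpath_def)
  have "curve (\<lambda>t. dag (\<gamma> t)) (\<lambda>t. heis_act (dag (\<gamma> t)) (- h t)) t \<otimes>\<^bsub>U_cover_Heis\<^esub> curve \<gamma> h t
      = \<one>\<^bsub>U_cover_Heis\<^esub>"
  proof -
    have "heis_act (dag (\<gamma> t)) (- h t) \<otimes>\<^bsub>Heis\<^esub> heis_act (dag (\<gamma> t)) (h t) = (0, 0)"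
      by (cases "h t") (simp add: heis_act_U U_dag U heis_form_simps matrix_vector_scaleR(1)[of _ "-1", simplified])
    then show ?thesis
      by (simp add: curve_def U_cover_Heis_simps s p U.dag_mult_path_class[OF b])
  qed
  then show ?thesis
    by (rule UH.inv_equality) (intro curve_carrier \<gamma> U.based_dag t)+
qed

lemma admissible_inv:
  assumes "admissible \<gamma> h A \<xi>"
  shows "admissible (\<lambda>t. dag (\<gamma> t)) (\<lambda>t. heis_act (dag (\<gamma> t)) (- h t)) (- A) (- \<xi>)"
proof -
  have \<gamma>: "U.based \<gamma>" and d: "(\<gamma> has_vector_derivative A) (at 0 within {0..1})"
    and h: "h 0 = 0" "(h has_vector_derivative \<xi>) (at 0 within {0..1})"
    using assms by (auto simp: admissible_def)
  have "dag A = - A" using velocity_u_alg[OF \<gamma> d] by (simp add: u_alg_iff)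
  moreover have dd: "((\<lambda>t. dag (\<gamma> t)) has_vector_derivative dag A) (at 0 within {0..1})"
    by (rule bounded_linear.has_vector_derivative[OF bounded_linear_dag d])
  moreover have "((\<lambda>t. heis_act (dag (\<gamma> t)) (- h t)) has_vector_derivative - \<xi>) (at 0 within {0..1})"
  proof -
    have c: "((\<lambda>t. ctr (dag (\<gamma> t))) has_vector_derivative ctr (dag A)) (at 0 within {0..1})"
      by (rule bounded_linear.has_vector_derivative[OF bounded_linear_ctr dd])
    have f: "((\<lambda>t. - fst (h t)) has_vector_derivative - fst \<xi>) (at 0 within {0..1})"
      by (intro has_vector_derivative_minus bounded_linear.has_vector_derivative[OF bounded_linear_fst] h)
    have s: "((\<lambda>t. - snd (h t)) has_vector_derivative - snd \<xi>) (at 0 within {0..1})"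
      by (intro has_vector_derivative_minus bounded_linear.has_vector_derivative[OF bounded_linear_snd] h)
    have "((\<lambda>t. ctr (dag (\<gamma> t)) *v (- fst (h t))) has_vector_derivative
        ctr (dag (\<gamma> 0)) *v (- fst \<xi>) + ctr (dag A) *v (- fst (h 0))) (at 0 within {0..1})"
      by (rule bounded_bilinear.has_vector_derivative[OF bounded_bilinear_matrix_vector c f])
    from has_vector_derivative_Pair[OF this s]
    have D: "((\<lambda>t. (ctr (dag (\<gamma> t)) *v (- fst (h t)), - snd (h t))) has_vector_derivative - \<xi>) (at 0 within {0..1})"
      by (cases \<xi>) (simp add: h U.basedD(3)[OF \<gamma>])
    show ?thesis
      by (rule has_vector_derivative_transform[OF _ _ D])
        (auto simp: heis_act_U U_dag U.basedD(2)[OF \<gamma>])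
  qed
  moreover have "heis_act (dag (\<gamma> 0)) (- h 0) = 0"
    by (simp add: heis_act_U h(1) U.basedD(3)[OF \<gamma>] U_one zero_prod_def)
  ultimately show ?thesis
    using U.based_dag[OF \<gamma>] by (simp add: admissible_def)
qed

subsection \<open>Comparison of two integrated actions\<close>

text \<open>\<open>integrates\<close> gives derivatives only from the right; running away from s in
  both directions and obtaining 0 each time yields a genuine derivative.\<close>

lemma has_vector_derivative_zero_two_sided:
  fixes f :: "real \<Rightarrow> 'a::real_normed_vector"
  assumes "((\<lambda>e. f (s + e)) has_vector_derivative 0) (at 0 within {0..1})"
    and "((\<lambda>e. f (s - e)) has_vector_derivative 0) (at 0 within {0..1})"
  shows "(f has_derivative (\<lambda>_. 0)) (at s)"
  unfolding has_derivative_at_alt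
proof (intro conjI allI impI)
  fix e :: real assume e: "e > 0"
  obtain d1 where d1: "d1 > 0" "\<And>y. y \<in> {0..1} \<Longrightarrow> norm y < d1 \<Longrightarrow> norm (f (s + y) - f s) \<le> e * norm y"
    using assms(1) e unfolding has_vector_derivative_def has_derivative_within_alt by force
  obtain d2 where d2: "d2 > 0" "\<And>y. y \<in> {0..1} \<Longrightarrow> norm y < d2 \<Longrightarrow> norm (f (s - y) - f s) \<le> e * norm y"
    using assms(2) e unfolding has_vector_derivative_def has_derivative_within_alt by force
  have "norm (f y - f s - 0) \<le> e * norm (y - s)" if "norm (y - s) < min 1 (min d1 d2)" for y
    using d1(2)[of "y - s"] d2(2)[of "s - y"] that by (cases "y \<ge> s") (auto simp: abs_minus_commute)
  then show "\<exists>d>0. \<forall>y. norm (y - s) < d \<longrightarrow> norm (f y - f s - 0) \<le> e * norm (y - s)"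
    using d1(1) d2(1) by (intro exI[of _ "min 1 (min d1 d2)"]) auto
qed simp

context
  fixes c :: real and \<beta> :: "(real \<Rightarrow> 'm::finite mat) set \<times> 'm heis \<Rightarrow> 'm pt \<Rightarrow> 'm pt"
  assumes integrates: "integrates c (alpha c) \<beta>"
begin

lemma \<beta>_Isom: "x \<in> carrier U_cover_Heis \<Longrightarrow> \<beta> x \<in> carrier (Isom c)"
  using integrates by (auto simp: integrates_def hom_def)

lemma \<beta>_Nbar: "x \<in> carrier U_cover_Heis \<Longrightarrow> p \<in> Nbar \<Longrightarrow> \<beta> x p \<in> Nbar"
  using \<beta>_Isom[of x] by (auto simp: carrier_Isom dest: Bij_imp_funcset)

lemma \<beta>_compose:
  assumes "x \<in> carrier U_cover_Heis" "y \<in> carrier U_cover_Heis" "p \<in> Nbar"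
  shows "\<beta> (x \<otimes>\<^bsub>U_cover_Heis\<^esub> y) p = \<beta> x (\<beta> y p)"
proof -
  have "\<beta> (x \<otimes>\<^bsub>U_cover_Heis\<^esub> y) = compose Nbar (\<beta> x) (\<beta> y)"
  proof -
    have "\<beta> \<in> hom U_cover_Heis (Isom c)" using integrates by (simp add: integrates_def)
    then show ?thesis using assms by (simp add: hom_mult mult_Isom \<beta>_Isom)
  qed
  then show ?thesis using assms(3) by (simp add: compose_eq)
qed

text \<open>The image of the identity is idempotent and injective.\<close>

lemma \<beta>_one:
  assumes "p \<in> Nbar"
  shows "\<beta> \<one>\<^bsub>U_cover_Heis\<^esub> p = p"
proof -
  have "inj_on (\<beta> \<one>\<^bsub>U_cover_Heis\<^esub>) Nbar"
    using \<beta>_Isom[OF UH.one_closed] by (auto simp: carrier_Isom Bij_def bij_betw_def)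
  moreover have "\<beta> \<one>\<^bsub>U_cover_Heis\<^esub> (\<beta> \<one>\<^bsub>U_cover_Heis\<^esub> p) = \<beta> \<one>\<^bsub>U_cover_Heis\<^esub> p"
    using \<beta>_compose[OF UH.one_closed UH.one_closed assms] by simp
  ultimately show ?thesis
    using assms \<beta>_Nbar[OF UH.one_closed assms] by (auto dest: inj_onD)
qed

definition agree :: "((real \<Rightarrow> 'm mat) set \<times> 'm heis) set"
  where "agree = {x \<in> carrier U_cover_Heis. \<forall>p\<in>Nbar. \<beta> x p = group_act c x p}"

lemma agree_mult: "x \<in> agree \<Longrightarrow> y \<in> agree \<Longrightarrow> x \<otimes>\<^bsub>U_cover_Heis\<^esub> y \<in> agree"
proof -
  show "x \<otimes>\<^bsub>U_cover_Heis\<^esub> y \<in> agree" if "x \<in> agree" "y \<in> agree"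
    using that by (simp add: agree_def \<beta>_compose group_act_Nbar group_act_compose)
qed

lemma agree_one: "\<one>\<^bsub>U_cover_Heis\<^esub> \<in> agree"
proof -
  show ?thesis by (simp add: agree_def \<beta>_one group_act_one)
qed

text \<open>The velocity of the inverse curve at q is the negative of that of the curve, and both
  actions have the velocity \<open>alpha_vf\<close> at the identity.\<close>

lemma drift_zero:
  assumes ad: "admissible \<gamma> h A \<xi>" and q: "q \<in> Nbar"
  shows "((\<lambda>t. group_act c (inv\<^bsub>U_cover_Heis\<^esub> (curve \<gamma> h t)) (\<beta> (curve \<gamma> h t) q))
    has_vector_derivative 0) (at 0 within {0..1})"
proof -
  have \<gamma>: "U.based \<gamma>" and d: "(\<gamma> has_vector_derivative A) (at 0 within {0..1})"
    and h: "h 0 = 0" "(h has_vector_derivative \<xi>) (at 0 within {0..1})"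
    using ad by (auto simp: admissible_def)
  have A: "(A, \<xi>) \<in> g_alg" using velocity_u_alg[OF \<gamma> d] by (simp add: g_alg_def)
  have D: "((\<lambda>t. \<beta> (curve \<gamma> h t) q) has_vector_derivative alpha_vf c (A, \<xi>) q) (at 0 within {0..1})"
    using integrates \<gamma> d h q unfolding integrates_def curve_def U.based_def alpha_eq[OF A q, symmetric] by blast
  have P: "\<beta> (curve \<gamma> h t) q \<in> Nbar" if "t \<in> {0..1}" for t
    by (intro \<beta>_Nbar curve_carrier \<gamma> that q)
  have P0: "\<beta> (curve \<gamma> h 0) q = q" by (simp add: curve_zero \<gamma> h \<beta>_one q)
  let ?\<gamma> = "\<lambda>t. dag (\<gamma> t)" and ?h = "\<lambda>t. heis_act (dag (\<gamma> t)) (- h t)"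
  have "((\<lambda>t. group_act c (path_class U_group (subpath 0 t ?\<gamma>), ?h t) (\<beta> (curve \<gamma> h t) q))
      has_vector_derivative alpha_vf c (- A, - \<xi>) (\<beta> (curve \<gamma> h 0) q) + alpha_vf c (A, \<xi>) q) (at 0 within {0..1})"
    using admissible_inv[OF ad] P D unfolding admissible_def
    by (intro has_vector_derivative_group_act) auto
  moreover have "alpha_vf c (- A, - \<xi>) q + alpha_vf c (A, \<xi>) q = 0"
  proof -
    have "ctr (- A) = - ctr A" by (simp add: vec_eq_iff ctr_nth)
    then show ?thesis
      by (simp add: alpha_vf_def proj_vf_def matrix_vector_minus heis_form_simps zero_prod_def)
        (simp add: vec_eq_iff)
  qed
  ultimately have Z: "((\<lambda>t. group_act c (curve ?\<gamma> ?h t) (\<beta> (curve \<gamma> h t) q))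
      has_vector_derivative 0) (at 0 within {0..1})"
    by (simp only: P0 curve_def[of ?\<gamma>])
  show ?thesis
    by (rule has_vector_derivative_transform[OF _ _ Z]) (auto simp: inv_curve[OF \<gamma>])
qed

text \<open>
  Along a curve \<open>\<theta>\<close>, the derivative of \<open>group_act (\<theta> s)\<^sup>-\<^sup>1 (\<beta> (\<theta> s) p)\<close> vanishes, because both
  actions have the same velocity at the identity.
\<close>

lemma agree_curve:
  assumes \<theta>: "\<And>s. \<theta> s \<in> carrier U_cover_Heis" and \<theta>0: "\<theta> 0 \<in> agree"
    and moves: "\<And>s u. moves \<theta> s u"
  shows "\<theta> (s::real) \<in> agree"
proof -
  have "\<beta> (\<theta> s) p = group_act c (\<theta> s) p" if p: "p \<in> Nbar" for p
  proof -
    define f where "f s = group_act c (inv\<^bsub>U_cover_Heis\<^esub> \<theta> s) (\<beta> (\<theta> s) p)" for s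
    \<comment> \<open>Since \<open>\<theta> (u e)\<close> is a short curve times
      \<open>\<theta> s\<close>, \<open>f (u e)\<close> is the fixed smooth action of the inverse of
      \<open>\<theta> s\<close> applied to the drift at \<open>q\<close>; the chain rule gives
      derivative 0.\<close>
    have one: "((\<lambda>e. f (u e)) has_vector_derivative 0) (at 0 within {0..1})"
      if ad: "admissible \<gamma> h A \<xi>" and u: "\<And>e. e \<in> {0..1} \<Longrightarrow> \<theta> (u e) = curve \<gamma> h e \<otimes>\<^bsub>U_cover_Heis\<^esub> \<theta> s"
      for \<gamma> h A \<xi> s and u :: "real \<Rightarrow> real"
    proof -
      define q where "q = \<beta> (\<theta> s) p"
      have q: "q \<in> Nbar" unfolding q_def by (rule \<beta>_Nbar[OF \<theta> p])
      have \<gamma>: "U.based \<gamma>" "h 0 = 0" using ad by (auto simp: admissible_def)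
      let ?g = "\<lambda>t. group_act c (inv\<^bsub>U_cover_Heis\<^esub> (curve \<gamma> h t)) (\<beta> (curve \<gamma> h t) q)"
      have g0: "?g 0 = q" by (simp add: curve_zero \<gamma> \<beta>_one q group_act_one)
      have dg: "(?g has_derivative (\<lambda>t. t *\<^sub>R 0)) (at 0 within {0..1})"
        using drift_zero[OF ad q] by (simp add: has_vector_derivative_def)
      obtain D where D: "(group_act c (inv\<^bsub>U_cover_Heis\<^esub> \<theta> s) has_derivative D) (at (?g 0))"
        using smooth_on_imp_differentiable[OF smooth_on_group_act[OF UH.inv_closed[OF \<theta>]] q] g0
        unfolding differentiable_def by metis
      have "((\<lambda>t. group_act c (inv\<^bsub>U_cover_Heis\<^esub> \<theta> s) (?g t)) has_derivative (\<lambda>t. D (t *\<^sub>R 0))) (at 0 within {0..1})"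
        by (rule has_derivative_compose[OF dg D])
      then have Z: "((\<lambda>t. group_act c (inv\<^bsub>U_cover_Heis\<^esub> \<theta> s) (?g t)) has_vector_derivative 0) (at 0 within {0..1})"
        using linear_0[OF has_derivative_linear[OF D]] by (simp add: has_vector_derivative_def)
      show ?thesis
      proof (rule has_vector_derivative_transform[OF _ _ Z])
        fix e :: real assume e: "e \<in> {0..1}"
        note cc = curve_carrier[OF \<gamma>(1) e]
        have "f (u e) = group_act c (inv\<^bsub>U_cover_Heis\<^esub> \<theta> s \<otimes>\<^bsub>U_cover_Heis\<^esub> inv\<^bsub>U_cover_Heis\<^esub> (curve \<gamma> h e)) (\<beta> (curve \<gamma> h e) q)"
          using \<beta>_compose[OF cc \<theta> p] by (simp add: f_def u[OF e] UH.inv_mult_group cc \<theta> q_def)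
        also have "\<dots> = group_act c (inv\<^bsub>U_cover_Heis\<^esub> \<theta> s) (?g e)"
          by (rule group_act_compose[symmetric]) (simp_all add: cc \<theta> \<beta>_Nbar q)
        finally show "f (u e) = group_act c (inv\<^bsub>U_cover_Heis\<^esub> \<theta> s) (?g e)" .
      qed simp
    qed
    have "(f has_derivative (\<lambda>_. 0)) (at s)" for s
    proof (rule has_vector_derivative_zero_two_sided)
      show "((\<lambda>e. f (s + e)) has_vector_derivative 0) (at 0 within {0..1})"
        using moves[of s 1] one[of _ _ _ _ "\<lambda>e. s + e" s] by (auto simp: moves_def)
      show "((\<lambda>e. f (s - e)) has_vector_derivative 0) (at 0 within {0..1})"
        using moves[of s "-1"] one[of _ _ _ _ "\<lambda>e. s - e" s] by (auto simp: moves_def)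
    qed
    then obtain k where "\<And>x. f x = k"
      using has_derivative_zero_constant[of UNIV f] by auto
    then have "f s = f 0" by simp
    also have "f 0 = p"
      using \<theta>0 p by (simp add: f_def agree_def inv_group_act)
    finally have "group_act c (\<theta> s) (f s) = group_act c (\<theta> s) p" by simp
    then show ?thesis
      by (simp add: f_def inv_group_act \<theta> \<beta>_Nbar p)
  qed
  then show ?thesis by (simp add: agree_def \<theta>)
qed

text \<open>The classes of the initial pieces of \<Gamma> form a curve in the covering group, and
  \<open>path_class_split\<close> shows that it moves by admissible curves from every parameter in
  both directions.\<close>

lemma agree_smooth_path:
  assumes \<Gamma>: "\<And>s. \<Gamma> s \<in> carrier U_group" "\<And>s. \<exists>A. (\<Gamma> has_vector_derivative A) (at s)" "\<Gamma> 0 = mat 1"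
  shows "(path_class U_group \<Gamma>, (0, 0)) \<in> agree"
proof -
  define \<theta> where "\<theta> s = (path_class U_group (\<lambda>\<tau>. \<Gamma> (s * \<tau>)), (0, 0) :: 'm heis)" for s
  have cont: "continuous_on UNIV \<Gamma>"
    by (meson \<Gamma>(2) continuous_at_imp_continuous_on has_vector_derivative_continuous)
  note split = path_class_split[OF cont convex_UNIV UNIV_I UNIV_I UNIV_I \<Gamma>(1) \<Gamma>(3)]
  have moves: "moves \<theta> s \<sigma>" for s \<sigma>
  proof -
    obtain A where A: "(\<Gamma> has_vector_derivative A) (at s)" using \<Gamma>(2) by blast
    let ?\<gamma> = "\<lambda>\<tau>. \<Gamma> (s + \<sigma> * \<tau>) ** dag (\<Gamma> s)"
    have "((\<lambda>\<tau>. s + \<sigma> * \<tau>) has_vector_derivative \<sigma>) (at 0)"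
      by (auto intro!: derivative_eq_intros simp: has_vector_derivative_def)
    from vector_diff_chain_at[OF this, of \<Gamma> A] A
    have "((\<lambda>\<tau>. \<Gamma> (s + \<sigma> * \<tau>)) has_vector_derivative \<sigma> *\<^sub>R A) (at 0)" by (simp add: o_def)
    from bounded_linear.has_vector_derivative[OF bounded_bilinear.bounded_linear_left[OF bounded_bilinear_matrix_matrix] this]
    have d: "(?\<gamma> has_vector_derivative (\<sigma> *\<^sub>R A) ** dag (\<Gamma> s)) (at 0)" .
    have b: "U.based ?\<gamma>"
      using split(2)[of s "s + \<sigma>"] by (simp add: mult.commute)
    have "admissible ?\<gamma> (\<lambda>_. 0) ((\<sigma> *\<^sub>R A) ** dag (\<Gamma> s)) 0"
      using b has_vector_derivative_at_within[OF d] by (simp add: admissible_def)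
    moreover have "\<theta> (s + \<sigma> * e) = curve ?\<gamma> (\<lambda>_. 0) e \<otimes>\<^bsub>U_cover_Heis\<^esub> \<theta> s" if e: "e \<in> {0..1}" for e
    proof -
      have "cover_proj (path_class U_group (subpath 0 e ?\<gamma>)) \<in> carrier U_group"
        by (intro U.cover_proj_closed U.path_class_in_cover based_subpath b e)
      then show ?thesis
        using split(3)[of "s + \<sigma> * e" s]
        by (simp add: \<theta>_def curve_def U_cover_Heis_simps heis_act_U zero_prod_def heis_form_simps subpath_def ac_simps)
    qed
    ultimately show ?thesis unfolding moves_def by blast
  qed
  have "\<theta> 1 \<in> agree"
  proof (rule agree_curve[OF _ _ moves])
    show "\<theta> s \<in> carrier U_cover_Heis" for s
      using split(1)[of s] by (simp add: \<theta>_def U_cover_Heis_simps U.path_class_in_cover)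
    show "\<theta> 0 \<in> agree" using agree_one by (simp add: \<theta>_def \<Gamma>(3) U_cover_Heis_simps U.one_cover)
  qed
  then show ?thesis by (simp add: \<theta>_def)
qed

lemma agree_heis: "(\<one>\<^bsub>cover U_group\<^esub>, \<xi>) \<in> agree"
proof -
  define \<theta> where "\<theta> s = (\<one>\<^bsub>cover U_group\<^esub> :: (real \<Rightarrow> 'm mat) set, s *\<^sub>R \<xi>)" for s
  note one = U.cover_one_closed U.cover_l_one
  have moves: "moves \<theta> s \<sigma>" for s \<sigma>
  proof -
    have "((\<lambda>t. (\<sigma> * t) *\<^sub>R \<xi>) has_vector_derivative \<sigma> *\<^sub>R \<xi>) (at 0 within {0..1})"
      by (auto intro!: derivative_eq_intros simp: has_vector_derivative_def)
    then have "admissible (\<lambda>t. mat 1) (\<lambda>t. (\<sigma> * t) *\<^sub>R \<xi>) 0 (\<sigma> *\<^sub>R \<xi>)"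
      by (simp add: admissible_def U.based_one)
    moreover have "\<theta> (s + \<sigma> * e) = curve (\<lambda>t. mat 1) (\<lambda>t. (\<sigma> * t) *\<^sub>R \<xi>) e \<otimes>\<^bsub>U_cover_Heis\<^esub> \<theta> s" for e
    proof -
      have "path_class U_group (subpath 0 e (\<lambda>t. mat 1)) = (\<one>\<^bsub>cover U_group\<^esub> :: (real \<Rightarrow> 'm mat) set)"
        by (simp add: subpath_def U.one_cover)
      then show ?thesis
        by (cases \<xi>) (simp add: \<theta>_def curve_def U_cover_Heis_simps U.cover_proj_one heis_act_one one
            heis_form_simps algebra_simps)
    qed
    ultimately show ?thesis unfolding moves_def by blast
  qed
  have "\<theta> 1 \<in> agree"
  proof (rule agree_curve[OF _ _ moves])
    show "\<theta> s \<in> carrier U_cover_Heis" for s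
      by (simp add: \<theta>_def U_cover_Heis_simps one)
    show "\<theta> 0 \<in> agree" using agree_one by (simp add: \<theta>_def U_cover_Heis_simps zero_prod_def)
  qed
  then show ?thesis by (simp add: \<theta>_def)
qed

text \<open>The path is cut into N pieces. Each of them, translated back to the identity, is so
  short that its class is that of a differentiable curve, and the pieces multiply up by
  \<open>path_class_split\<close>.\<close>

lemma agree_path:
  assumes \<gamma>: "U.based \<gamma>"
  shows "(path_class U_group \<gamma>, (0, 0)) \<in> agree"
proof -
  obtain \<delta> :: real where "\<delta> > 0" and \<delta>:
    "\<And>\<gamma> :: real \<Rightarrow> 'm mat. U.based \<gamma> \<Longrightarrow> (\<And>t. t \<in> {0..1} \<Longrightarrow> dist (\<gamma> t) (mat 1) < \<delta>) \<Longrightarrow>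
      \<exists>\<Gamma>. (\<forall>s. \<Gamma> s \<in> carrier U_group \<and> (\<exists>A. (\<Gamma> has_vector_derivative A) (at s))) \<and> \<Gamma> 0 = mat 1 \<and>
        path_class U_group \<gamma> = path_class U_group \<Gamma>"
    by (rule small_path_homotopic_smooth) blast
  have small: "(path_class U_group \<sigma>, (0, 0)) \<in> agree"
    if "U.based \<sigma>" "\<And>t. t \<in> {0..1} \<Longrightarrow> dist (\<sigma> t) (mat 1) < \<delta>" for \<sigma>
  proof -
    note \<delta>' = \<delta>[OF that]
    obtain \<Gamma> where \<Gamma>: "\<And>s. \<Gamma> s \<in> carrier U_group" "\<And>s. \<exists>A. (\<Gamma> has_vector_derivative A) (at s)"
      "\<Gamma> 0 = mat 1" "path_class U_group \<sigma> = path_class U_group \<Gamma>"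
      using \<delta>' by blast
    show ?thesis unfolding \<Gamma>(4) by (rule agree_smooth_path[OF \<Gamma>(1-3)])
  qed
  note split = path_class_split[OF U.basedD(1)[OF \<gamma>] _ _ _ _ U.basedD(2)[OF \<gamma>] U.basedD(3)[OF \<gamma>]]
  \<comment> \<open>Equal to 1 on the diagonal of the compact square; its uniform continuity
    therefore provides one mesh width that makes all translated pieces short.\<close>
  let ?F = "\<lambda>z. \<gamma> (fst z) ** dag (\<gamma> (snd z))"
  have "continuous_on ({0..1} \<times> {0..1}) ?F"
    by (intro continuous_on_matrix_mult continuous_on_dag continuous_on_compose2[OF U.basedD(1)[OF \<gamma>]])
      (auto intro!: continuous_intros)
  then have "uniformly_continuous_on ({0..1} \<times> {0..1}) ?F"
    by (intro compact_uniformly_continuous compact_Times) auto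
  then obtain \<eta> where "\<eta> > 0" and \<eta>: "\<And>z z'. z \<in> {0..1} \<times> {0..1} \<Longrightarrow> z' \<in> {0..1} \<times> {0..1} \<Longrightarrow>
      dist z' z < \<eta> \<Longrightarrow> dist (?F z') (?F z) < \<delta>"
    unfolding uniformly_continuous_on_def using \<open>\<delta> > 0\<close> by blast
  obtain N :: nat where "N \<noteq> 0" "inverse (real N) < \<eta>"
    using real_arch_invD[OF \<open>\<eta> > 0\<close>] by blast
  then have N: "N > 0" "1 / real N < \<eta>" by (simp_all add: inverse_eq_divide)
  have "(path_class U_group (\<lambda>\<tau>. \<gamma> (real k / real N * \<tau>)), (0, 0)) \<in> agree" if "k \<le> N" for k
    using that
  proof (induction k)
    case 0
    then show ?case using agree_one by (simp add: U.basedD(3)[OF \<gamma>] U_cover_Heis_simps U.one_cover)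
  next
    case (Suc k)
    define s s' where "s = real k / real N" and "s' = real (Suc k) / real N"
    have s: "s \<in> {0..1}" "s' \<in> {0..1}" "s' - s = 1 / real N"
      using Suc.prems N(1) by (auto simp: s_def s'_def field_simps)
    let ?\<sigma> = "\<lambda>\<tau>. \<gamma> (s + \<tau> * (s' - s)) ** dag (\<gamma> s)"
    have b: "U.based ?\<sigma>" by (rule split(2)) (use s in auto)
    have "dist (?\<sigma> \<tau>) (mat 1) < \<delta>" if \<tau>: "\<tau> \<in> {0..1}" for \<tau>
    proof -
      have "s + \<tau> * (s' - s) \<in> {0..1}"
        using convexD_alt[of "{0..1::real}" s s' \<tau>] s \<tau> by (simp add: algebra_simps)
      moreover have "dist (s + \<tau> * (s' - s), s) (s, s) < \<eta>"
      proof -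
        have "\<tau> * (1 / real N) \<le> 1 * (1 / real N)" by (rule mult_right_mono) (use \<tau> in auto)
        then show ?thesis using N(2) \<tau> by (simp add: dist_Pair_Pair dist_real_def s(3) abs_mult)
      qed
      ultimately have "dist (?F (s + \<tau> * (s' - s), s)) (?F (s, s)) < \<delta>"
        using s by (intro \<eta>) auto
      then show ?thesis by (simp add: U_dag_right U.basedD(2)[OF \<gamma> s(1)])
    qed
    from small[OF b this] have "(path_class U_group ?\<sigma>, (0, 0)) \<in> agree" .
    moreover have "(path_class U_group (\<lambda>\<tau>. \<gamma> (s * \<tau>)), (0, 0)) \<in> agree"
      using Suc by (simp add: s_def)
    ultimately have "(path_class U_group ?\<sigma>, (0, 0)) \<otimes>\<^bsub>U_cover_Heis\<^esub> (path_class U_group (\<lambda>\<tau>. \<gamma> (s * \<tau>)), (0, 0)) \<in> agree"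
      by (rule agree_mult)
    moreover have "path_class U_group (\<lambda>\<tau>. \<gamma> (s' * \<tau>)) =
        path_class U_group ?\<sigma> \<otimes>\<^bsub>cover U_group\<^esub> path_class U_group (\<lambda>\<tau>. \<gamma> (s * \<tau>))"
      by (rule split(3)) (use s in auto)
    moreover have "cover_proj (path_class U_group ?\<sigma>) \<in> carrier U_group"
      by (intro U.cover_proj_closed U.path_class_in_cover b)
    ultimately show ?case
      by (simp add: U_cover_Heis_simps heis_act_U heis_form_simps s'_def)
  qed
  from this[of N] show ?thesis using N(1) by simp
qed

lemma \<beta>_eq: "x \<in> carrier U_cover_Heis \<Longrightarrow> \<beta> x = group_act c x"
proof -
  assume x: "x \<in> carrier U_cover_Heis"
  obtain g h where gh: "x = (g, h)" "g \<in> carrier (cover U_group)"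
    using x by (cases x) (auto simp: U_cover_Heis_simps)
  have "(g, (0, 0)) \<in> agree" using gh(2) by (auto elim: U.coverE simp: agree_path)
  from agree_mult[OF agree_heis[of h] this] have "x \<in> agree"
    by (cases h) (simp add: gh U_cover_Heis_simps U.cover_proj_one heis_act_one heis_form_simps U.cover_l_one)
  then have eq: "\<beta> x p = group_act c x p" if "p \<in> Nbar" for p
    using that by (simp add: agree_def)
  have "\<beta> x \<in> extensional Nbar" "group_act c x \<in> extensional Nbar"
    using \<beta>_Isom[OF x] group_act_Isom[OF x] by (simp_all add: carrier_Isom Bij_def)
  then show ?thesis by (rule extensionalityI) (rule eq)
qed

end

lemma beta_eq: "x \<in> carrier U_cover_Heis \<Longrightarrow> beta c x = group_act c x"
proof (rule \<beta>_eq)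
  show "integrates c (alpha c) (beta c :: (real \<Rightarrow> 'a mat) set \<times> 'a heis \<Rightarrow> 'a pt \<Rightarrow> 'a pt)"
    unfolding beta_def by (rule someI[of "integrates c (alpha c)" "group_act c", OF integrates_group_act])
qed

section \<open>Connectedness of the special indefinite unitary group\<close>

text \<open>The complex reflection in the non-isotropic vector \<open>u\<close>, with multiplier \<open>z\<close>.\<close>

definition creflection :: "complex^('m::finite option) \<Rightarrow> complex \<Rightarrow> 'm mat"
  where "creflection u z = mat 1 + (\<chi> i j. (z - 1) / herm u u * (u $ i * isgn j * cnj (u $ j)))"

lemma creflection_vec: "creflection u z *v x = x + ((z - 1) / herm u u * herm u x) *s u"
proof -
  have "(\<chi> i j. k * (u $ i * isgn j * cnj (u $ j))) *v x = (k * herm u x) *s u" for k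
    by (simp add: vec_eq_iff matrix_vector_mult_def herm_def sum_distrib_left sum_distrib_right ac_simps)
  then show ?thesis
    by (simp only: creflection_def matrix_vector_mult_add_rdistrib matrix_vector_mul_lid)
qed

lemma matrix_vector_axis: "((A :: complex^'n::finite^'k) *v axis k 1) $ i = A $ i $ k"
  by (simp add: matrix_vector_mult_def axis_def if_distrib[of "\<lambda>x. _ * x"] cong: if_cong)

text \<open>\<open>herm\<close> is nondegenerate: testing on the coordinate vectors recovers the
  matrix equation.\<close>

lemma mem_U_iff_herm: "A \<in> carrier U_group \<longleftrightarrow> (\<forall>x y. herm (A *v x) (A *v y) = herm x y)"
proof
  assume *: "\<forall>x y. herm (A *v x) (A *v y) = herm x y"
  have "((dag A ** A) *v y) $ k = y $ k" for y k
  proof -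
    have "herm (axis k 1) ((dag A ** A) *v y) = herm (axis k 1) y"
      using * by (simp add: herm_dag matrix_vector_mul_assoc)
    then show ?thesis unfolding herm_axis by (simp add: isgn_def split: if_splits)
  qed
  then have "(dag A ** A) *v y = mat 1 *v y" for y by (simp add: vec_eq_iff)
  then show "A \<in> carrier U_group" unfolding mem_U_iff by (metis matrix_eq)
qed (simp add: herm_U)

lemma creflection_U:
  assumes "herm u u \<noteq> 0" "norm z = 1"
  shows "creflection u z \<in> carrier U_group"
  unfolding mem_U_iff_herm
proof (intro allI)
  fix x y
  let ?h = "herm u u"
  define k where "k = (z - 1) / herm u u"
  have h: "cnj ?h = ?h" by (rule herm_cnj)
  have zz: "cnj z * z = 1" using assms(2) by (simp add: cnj_mult_self)
  \<comment> \<open>The common factor of all terms by which the reflection could change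
    \<open>herm x y\<close>; it vanishes because z has modulus 1.\<close>
  have "k + cnj k + cnj k * k * ?h = ((z - 1) + (cnj z - 1) + (cnj z - 1) * (z - 1)) / ?h"
    using assms(1) by (simp add: k_def h field_simps)
  also have "(z - 1) + (cnj z - 1) + (cnj z - 1) * (z - 1) = 0"
    using zz by (simp add: algebra_simps)
  finally have k: "k + cnj k + cnj k * k * ?h = 0" by simp
  have "herm (creflection u z *v x) (creflection u z *v y) =
      herm x y + (k + cnj k + cnj k * k * ?h) * (herm x u * herm u y)"
    unfolding creflection_vec k_def[symmetric] herm_add_left herm_add_right herm_smult_left herm_smult_right
      complex_cnj_mult herm_cnj by (simp add: algebra_simps)
  then show "herm (creflection u z *v x) (creflection u z *v y) = herm x y" unfolding k by simp
qed

text \<open>As x and y have equal \<open>herm\<close>-squares, the square of u = x - y is s +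
  \<open>cnj s\<close> with s = \<open>herm u x\<close>, and the multiplier can be solved
  for.\<close>

lemma creflection_maps:
  assumes "herm x x = herm y y" "herm (x - y) (x - y) \<noteq> 0"
  obtains z where "norm z = 1" "creflection (x - y) z *v x = y"
proof -
  define u s where "u = x - y" and "s = herm u x"
  have "herm u y = - cnj s"
    by (simp add: s_def u_def herm_diff_left herm_cnj herm_diff_right assms(1))
  then have uu: "herm u u = s + cnj s"
    by (subst (2) u_def) (simp add: herm_diff_right s_def)
  then have s: "s + cnj s \<noteq> 0" "s \<noteq> 0" using assms(2) by (auto simp: u_def)
  \<comment> \<open>The reflection sends x to x - u = y exactly when (z - 1) s / (s +
    \<open>cnj s\<close>) = -1, that is for z = \<open>- cnj s / s\<close>.\<close>
  have "norm (- cnj s / s) = 1" using s(2) by (simp add: norm_divide)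
  moreover have "(- cnj s / s - 1) / (s + cnj s) * s = - 1"
  proof -
    define q where "q = s + cnj s"
    have cnj_s: "cnj s = q - s" and "q \<noteq> 0" using s(1) by (simp_all add: q_def)
    then show ?thesis
      unfolding cnj_s using s(2) by (simp add: field_simps)
  qed
  then have "creflection u (- cnj s / s) *v x = x + (- 1) *s u"
    unfolding creflection_vec uu s_def[symmetric] by simp
  then have "creflection u (- cnj s / s) *v x = y" by (simp add: u_def)
  ultimately show ?thesis using that unfolding u_def by blast
qed

definition U_connected :: "'m::finite mat \<Rightarrow> bool"
  where "U_connected A \<longleftrightarrow> (\<exists>\<gamma>. U.based \<gamma> \<and> \<gamma> 1 = A)"

lemma U_connected_mult: "U_connected A \<Longrightarrow> U_connected B \<Longrightarrow> U_connected (A ** B)"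
  unfolding U_connected_def using U.based_mult by blast

lemma U_connected_dag: "U_connected A \<Longrightarrow> U_connected (dag A)"
  unfolding U_connected_def using U.based_dag by blast

lemma continuous_on_creflection: "continuous_on S f \<Longrightarrow> continuous_on S (\<lambda>t. creflection u (f t))"
  unfolding creflection_def vec_lambda_eq_sum_axis divide_inverse
  by (intro continuous_intros bounded_linear.continuous_on[OF bounded_linear_axis])

lemma creflection_one: "creflection u 1 = mat 1"
  by (simp add: creflection_def vec_eq_iff)

text \<open>Turn the multiplier along the unit circle from 1 to z.\<close>

lemma U_connected_creflection:
  assumes "herm u u \<noteq> 0" "norm z = 1"
  shows "U_connected (creflection u z)"
proof -
  have "U.based (\<lambda>t. creflection u (cis (t * Arg z)))"
    by (rule U.basedI) (auto intro!: continuous_on_creflection continuous_intros creflection_U assms simp: creflection_one)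
  moreover have "cis (1 * Arg z) = z"
    using assms(2) by (simp add: cis_conv_exp) (metis Arg_eq mult_1 norm_zero of_real_1 zero_neq_one)
  ultimately show ?thesis unfolding U_connected_def by (metis (mono_tags, lifting))
qed

text \<open>A matrix that fixes some basis vectors is reduced by a reflection to one that fixes one more.\<close>

lemma U_connected_fixing:
  fixes A :: "'m::finite mat"
  assumes "finite F" "A \<in> carrier U_group" "A *v axis None 1 = axis None 1"
    and "\<And>a. a \<notin> F \<Longrightarrow> A *v axis (Some a) 1 = axis (Some a) 1"
  shows "U_connected A"
  using assms
proof (induction F arbitrary: A)
  case empty
  have "A = mat 1"
  proof -
    have "A *v axis k 1 = axis k 1" for k using empty by (cases k) auto
    then have "A $ i $ k = mat 1 $ i $ k" for i k
      using matrix_vector_axis[of A k i] by (simp add: mat_def axis_def)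
    then show ?thesis by (simp add: vec_eq_iff)
  qed
  then show ?case using U.based_one unfolding U_connected_def by auto
next
  case (insert a F)
  define y where "y = (axis (Some a) 1 :: complex^'m option)"
  define x where "x = A *v y"
  show ?case
  proof (cases "x = y")
    case True
    show ?thesis
    proof (rule insert.IH[OF insert.prems(1,2)])
      show "A *v axis (Some b) 1 = axis (Some b) 1" if "b \<notin> F" for b
        using insert.prems(3)[of b] True that by (cases "b = a") (auto simp: x_def y_def)
    qed
  next
    case False
    \<comment> \<open>A preserves \<open>herm\<close>, so x - y is orthogonal to every other basis
      vector fixed by A; the reflection in x - y keeps those fixed.\<close>
    have orth: "herm (x - y) (axis k 1) = 0" if "A *v axis k 1 = axis k 1" "k \<noteq> Some a" for k
    proof -
      have "herm x (axis k 1) = herm y (axis k 1)"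
        using herm_U[OF insert.prems(1), of y "axis k 1"] that(1) by (simp add: x_def)
      then show ?thesis by (simp add: herm_diff_left)
    qed
    \<comment> \<open>Orthogonality to the negative basis vector puts x - y in the positive definite
      part, so being nonzero it is not isotropic.\<close>
    have "cnj (herm (x - y) (axis None 1)) = 0" using orth[of None] insert.prems(2) by simp
    then have u0: "(x - y) $ None = 0" unfolding herm_cnj herm_axis by simp
    obtain b where "(x - y) $ Some b \<noteq> 0"
      using False u0 unfolding vec_eq_iff forall_option by auto
    then have "(norm ((x - y) $ Some b))\<^sup>2 > 0" by simp
    then have pos: "(\<Sum>a\<in>UNIV. (norm ((x - y) $ Some a))\<^sup>2) > 0"
      by (intro sum_pos2[of _ b]) auto
    have nz: "herm (x - y) (x - y) \<noteq> 0"
      unfolding herm_self u0 of_real_eq_0_iff using pos by simp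
    have "herm x x = herm y y" by (simp add: x_def herm_U insert.prems(1))
    from creflection_maps[OF this nz] obtain z where z: "norm z = 1" "creflection (x - y) z *v x = y" by blast
    let ?R = "creflection (x - y) z"
    have R: "?R \<in> carrier U_group" by (rule creflection_U[OF nz z(1)])
    have fix_R: "(?R ** A) *v axis k 1 = axis k 1" if "A *v axis k 1 = axis k 1" "k \<noteq> Some a" for k
      using that orth[OF that] by (simp add: creflection_vec flip: matrix_vector_mul_assoc)
    have "U_connected (?R ** A)"
    proof (rule insert.IH)
      show "(?R ** A) *v axis (Some b) 1 = axis (Some b) 1" if "b \<notin> F" for b
        using that insert.prems(3)[of b] fix_R[of "Some b"] z(2)
        by (cases "b = a") (auto simp: x_def y_def simp flip: matrix_vector_mul_assoc)
    qed (use R insert.prems U_mult fix_R in auto)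
    then have "U_connected (dag ?R ** (?R ** A))"
      by (rule U_connected_mult[OF U_connected_dag[OF U_connected_creflection[OF nz z(1)]]])
    then show ?thesis by (simp add: matrix_mul_assoc U_dag_left[OF R])
  qed
qed

lemma herm_e0: "herm (axis None 1) (axis None 1) = - 1"
  unfolding herm_axis by (simp add: axis_def)

lemma e0_nth: "(axis None 1 :: complex^('m::finite option)) $ j = (if j = None then 1 else 0)"
  by (simp add: axis_def)

text \<open>The obstacle is that the difference between the image of the negative basis vector and
  that vector may be isotropic. A preliminary reflection in the basis vector adjusts the phase of
  the corner entry to exclude this.\<close>

lemma U_connected:
  fixes A :: "'m::finite mat"
  assumes A: "A \<in> carrier U_group"
  shows "U_connected A"
proof -
  let ?e = "axis None 1 :: complex^'m option"
  \<comment> \<open>Makes the corner entry negative real, so the difference has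
    \<open>herm\<close>-square -2 - 2 |\<open>A $ None $ None\<close>|, which is not 0.\<close>
  define z where "z = - of_real (norm (A $ None $ None)) / A $ None $ None"
  have nz: "A $ None $ None \<noteq> 0" by (rule U_corner_nonzero[OF A])
  then have z: "norm z = 1" by (simp add: z_def norm_divide)
  have he: "herm ?e ?e \<noteq> 0" by (simp add: herm_e0)
  let ?D = "creflection ?e z"
  have D: "?D \<in> carrier U_group" by (rule creflection_U[OF he z])
  define x where "x = (?D ** A) *v ?e"
  have A1: "(A *v ?e) $ None = A $ None $ None"
    by (rule matrix_vector_axis)
  have x_eq: "x = A *v ?e + ((z - 1) * (A *v ?e) $ None) *s ?e"
    by (simp only: x_def matrix_vector_mul_assoc[symmetric] creflection_vec herm_e0)
      (simp add: herm_axis vec_eq_iff algebra_simps)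
  have "x $ None = z * A $ None $ None"
    unfolding x_eq by (simp add: A1 e0_nth algebra_simps)
  then have x0: "x $ None = - of_real (norm (A $ None $ None))"
    using nz by (simp add: z_def)
  have xx: "herm x x = herm ?e ?e" by (simp add: x_def herm_U U_mult D A)
  have ex: "herm ?e x = of_real (norm (A $ None $ None))" by (simp add: herm_axis x0)
  then have "herm x ?e = of_real (norm (A $ None $ None))"
    by (metis herm_cnj complex_cnj_complex_of_real)
  then have "herm (x - ?e) (x - ?e) = of_real (- 2 - 2 * norm (A $ None $ None))"
    by (simp add: herm_diff_left herm_diff_right xx ex herm_e0)
  moreover have "- 2 - 2 * norm (A $ None $ None) \<noteq> 0"
    using norm_ge_zero[of "A $ None $ None"] by linarith
  ultimately have u: "herm (x - ?e) (x - ?e) \<noteq> 0" by (metis of_real_eq_0_iff)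
  obtain z' where z': "norm z' = 1" "creflection (x - ?e) z' *v x = ?e"
    using creflection_maps[OF xx u] by blast
  let ?R = "creflection (x - ?e) z'"
  have R: "?R \<in> carrier U_group" by (rule creflection_U[OF u z'(1)])
  have "U_connected (?R ** (?D ** A))"
    by (rule U_connected_fixing[of UNIV])
      (use R D A z'(2) in \<open>auto intro!: U_mult simp: x_def matrix_vector_mul_assoc\<close>)
  then have "U_connected ((dag ?D ** dag ?R) ** (?R ** (?D ** A)))"
    by (rule U_connected_mult[rotated]) (intro U_connected_mult U_connected_dag U_connected_creflection he u z z'(1))
  also have "(dag ?D ** dag ?R) ** (?R ** (?D ** A)) = dag ?D ** (dag ?R ** ?R) ** ?D ** A"
    by (simp only: matrix_mul_assoc)
  finally show ?thesis by (simp add: U_dag_left[OF R] U_dag_left[OF D])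
qed

section \<open>From the unitary to the special unitary group\<close>

lemma continuous_on_det:
  fixes f :: "'a::topological_space \<Rightarrow> complex^'n::finite^'n"
  shows "continuous_on S f \<Longrightarrow> continuous_on S (\<lambda>x. det (f x))"
  unfolding det_def by (intro continuous_intros)

lemma det_creflection_e0: "det (creflection (axis None 1 :: complex^('m::finite option)) z) = z"
proof -
  let ?R = "creflection (axis None 1 :: complex^('m option)) z"
  have nth: "?R $ i $ j = (if i = j then if i = None then z else 1 else 0)" for i j
    by (cases i; cases j) (auto simp: creflection_def mat_def e0_nth herm_e0)
  have "det ?R = (\<Prod>i\<in>UNIV. ?R $ i $ i)"
    by (rule det_diagonal) (simp add: nth)
  also have "\<dots> = z"
    by (simp add: nth UNIV_option_conv prod.reindex)
  finally show ?thesis .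
qed

text \<open>A path in U(1,n-1) is corrected by reflections whose multiplier is the conjugate of its
  determinant; at both ends the determinant is 1, so the end points do not change.\<close>

lemma SU_connected:
  fixes A :: "'m::finite mat"
  assumes "A \<in> carrier SU_group"
  obtains \<gamma> where "SU.based \<gamma>" "\<gamma> 1 = A"
proof -
  have A: "A \<in> carrier U_group" "det A = 1" using assms by (auto simp: carrier_SU)
  obtain \<gamma> where \<gamma>: "U.based \<gamma>" "\<gamma> 1 = A" using U_connected[OF A(1)] unfolding U_connected_def by blast
  let ?R = "creflection (axis None 1 :: complex^'m option)"
  let ?\<delta> = "\<lambda>t. ?R (cnj (det (\<gamma> t))) ** \<gamma> t"
  have n: "norm (det (\<gamma> t)) = 1" if "t \<in> {0..1}" for t
    by (rule U_norm_det[OF U.basedD(2)[OF \<gamma>(1) that]])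
  have "SU.based ?\<delta>"
  proof (rule SU.basedI)
    show "continuous_on {0..1} ?\<delta>"
      by (intro continuous_on_matrix_mult continuous_on_creflection continuous_on_cnj continuous_on_det U.basedD(1)[OF \<gamma>(1)])
    show "?\<delta> t \<in> carrier SU_group" if t: "t \<in> {0..1}" for t
    proof -
      have "?R (cnj (det (\<gamma> t))) \<in> carrier U_group"
        by (rule creflection_U) (simp_all add: herm_e0 n[OF t])
      then show ?thesis
        using n[OF t] by (simp add: carrier_SU U_mult U.basedD(2)[OF \<gamma>(1) t] det_mul det_creflection_e0 cnj_mult_self)
    qed
    show "?\<delta> 0 = mat 1" by (simp add: U.basedD(3)[OF \<gamma>(1)] creflection_one)
  qed
  moreover have "?\<delta> 1 = A" by (simp add: \<gamma>(2) A(2) creflection_one)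
  ultimately show ?thesis by (rule that)
qed

section \<open>The quotient\<close>

text \<open>Loops in the special unitary group act by translations of \<open>\<phi>\<close>, whose lengths are the periods.\<close>

definition period :: "'m::finite itself \<Rightarrow> real \<Rightarrow> real set"
  where "period _ c = {- 2 * c * cover_arg (cover_incl x) | x.
    x \<in> carrier (cover (SU_group :: 'm mat monoid)) \<and> cover_proj x = mat 1}"

lemma ctr_inject: "ctr A = ctr B \<Longrightarrow> A = B"
proof -
  assume "ctr A = ctr B"
  then have "ctr (ctr A) = ctr (ctr B)" by simp
  moreover have "ctr (ctr M) = M" for M :: "'a mat"
    by (simp add: vec_eq_iff ctr_nth ac_simps)
  ultimately show ?thesis by simp
qed

text \<open>The coordinate w sees v and \<open>ctr g\<close> and is blind to \<phi>. The discrepancy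
  \<open>s p\<close> may vary with the point, as happens when two maps agree only on the
  quotient.\<close>

lemma act_determines:
  assumes "\<And>p :: 'm::finite pt. p \<in> Nbar \<Longrightarrow> act c g \<theta> h p = act c g' \<theta>' h' p + (0, 0, s p, 0)"
  shows "g = g'" "fst h = fst h'"
proof -
  have w: "(1/2) *\<^sub>R fst h + ctr g *v w = (1/2) *\<^sub>R fst h' + ctr g' *v w" for w
    using arg_cong[OF assms[of "(0, w, 0, 1)"], of "\<lambda>p. fst (snd p)"]
    by (simp add: mem_Nbar act_def)
  from w[of 0] show h: "fst h = fst h'" by simp
  have "ctr g *v w = ctr g' *v w" for w using w[of w] by (simp add: h)
  then have "ctr g = ctr g'" by (simp add: matrix_eq)
  then show "g = g'" by (rule ctr_inject)
qed

text \<open>\<phi> enters additively, so translations of \<phi> commute with the action, which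
  therefore descends to orbits.\<close>

lemma act_phi: "act c g \<theta> (v, t) (p + (0, 0, s, 0)) = act c g \<theta> (v, t) p + (0, 0, s, 0)"
  and act_change: "act c g \<theta>' (v, t') p = act c g \<theta> (v, t) p + (0, 0, t' - t - 2 * c * (\<theta>' - \<theta>), 0)"
  by (cases p; simp add: act_def algebra_simps)+

lemma Nbar_shift: "p + (0, 0, s, 0) \<in> Nbar \<longleftrightarrow> p \<in> Nbar"
  by (cases p) (simp add: mem_Nbar)

lemma SU_cover_Heis_simps:
  "carrier SU_cover_Heis = carrier (cover SU_group) \<times> UNIV"
  "(x, h) \<otimes>\<^bsub>SU_cover_Heis\<^esub> (y, k) = (x \<otimes>\<^bsub>cover SU_group\<^esub> y, h \<otimes>\<^bsub>Heis\<^esub> heis_act (cover_proj x) k)"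
  "\<one>\<^bsub>SU_cover_Heis\<^esub> = (\<one>\<^bsub>cover SU_group\<^esub>, (0, 0))"
  by (simp_all add: SU_cover_Heis_def semidirect_def)

lemma group_SU_cover_Heis: "group SU_cover_Heis"
  unfolding SU_cover_Heis_def by (rule SU.group_cover_Heis)

lemmas SU_cover_Heis_closed = monoid.m_closed[OF group.is_monoid[OF group_SU_cover_Heis]]
  monoid.one_closed[OF group.is_monoid[OF group_SU_cover_Heis]]

lemma beta'_act:
  assumes "x \<in> carrier (cover SU_group)" "p \<in> Nbar"
  shows "beta' c (x, h) p = act c (cover_proj x) (cover_arg (cover_incl x)) h p"
  using assms
  by (simp add: beta'_def beta_eq U_cover_Heis_simps cover_incl_closed group_act_def cover_proj_incl)

lemma beta'_eq: "x \<in> carrier (cover SU_group) \<Longrightarrow> beta' c (x, h) = group_act c (cover_incl x, h)"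
  by (simp add: beta'_def beta_eq U_cover_Heis_simps cover_incl_closed)

lemma beta_heis: "beta c (\<one>\<^bsub>cover U_group\<^esub>, h) = (\<lambda>p\<in>Nbar. act c (mat 1) 0 h p)"
  by (simp add: beta_eq U_cover_Heis_simps U.cover_one_closed group_act_def U.cover_proj_one cover_arg_one)

section \<open>The group of periods and the subgroup F'\<close>

lemma ash_ker: "g \<in> carrier U_group \<Longrightarrow> ash g (mob (mat 1) 0) = 0"
  by (simp add: ash_zero)

text \<open>The quotient of y by x lies over 1, and a factor over 1 on the right adds its argument
  without correction, since \<open>ash\<close> vanishes at the origin.\<close>

lemma cover_arg_ker:
  fixes x y :: "(real \<Rightarrow> 'm::finite mat) set"
  assumes "x \<in> carrier (cover SU_group)" "y \<in> carrier (cover SU_group)" "cover_proj x = cover_proj y"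
  shows "- 2 * c * (cover_arg (cover_incl y) - cover_arg (cover_incl x)) \<in> period TYPE('m) c"
proof -
  interpret group "cover (SU_group :: 'm mat monoid)" by (rule SU.group_cover)
  let ?k = "inv\<^bsub>cover SU_group\<^esub> x \<otimes>\<^bsub>cover SU_group\<^esub> y"
  have k: "?k \<in> carrier (cover SU_group)" using assms by simp
  have U: "cover_proj x \<in> carrier U_group"
    using SU.cover_proj_closed[OF assms(1)] SU.carrier_subset by blast
  have pk: "cover_proj ?k = mat 1"
  proof -
    have "cover_proj ?k = cover_proj (inv\<^bsub>cover SU_group\<^esub> x) ** cover_proj x"
      using assms by (simp add: SU.cover_proj_mult)
    also have "\<dots> = cover_proj (inv\<^bsub>cover SU_group\<^esub> x \<otimes>\<^bsub>cover SU_group\<^esub> x)"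
      by (rule SU.cover_proj_mult[symmetric]) (use assms(1) in simp_all)
    finally show ?thesis using assms(1) by (simp add: SU.cover_proj_one)
  qed
  have "y = x \<otimes>\<^bsub>cover SU_group\<^esub> ?k" using assms by (simp add: m_assoc[symmetric])
  then have "cover_incl y = cover_incl x \<otimes>\<^bsub>cover U_group\<^esub> cover_incl ?k"
    using cover_incl_mult[OF assms(1) k] by simp
  then have "cover_arg (cover_incl y) = cover_arg (cover_incl x) + cover_arg (cover_incl ?k)"
    using cover_arg_mult[OF cover_incl_closed[OF assms(1)] cover_incl_closed[OF k]]
    by (simp add: cover_proj_incl assms(1) k pk ash_ker[OF U, simplified])
  then show ?thesis using k pk by (auto simp: period_def)
qed

lemma period_ker: "x \<in> carrier (cover SU_group) \<Longrightarrow> cover_proj x = mat 1 \<Longrightarrow>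
    - 2 * c * cover_arg (cover_incl x) \<in> period TYPE('m) c"
  for x :: "(real \<Rightarrow> 'm::finite mat) set"
  by (auto simp: period_def)

lemma period_zero: "0 \<in> period TYPE('m::finite) c"
  using cover_arg_ker[OF SU.cover_one_closed SU.cover_one_closed refl, where 'm='m] by simp

lemma period_diff: "s \<in> period TYPE('m::finite) c \<Longrightarrow> t \<in> period TYPE('m) c \<Longrightarrow> s - t \<in> period TYPE('m) c"
proof -
  assume "s \<in> period TYPE('m) c" "t \<in> period TYPE('m) c"
  then obtain x y :: "(real \<Rightarrow> 'm mat) set" where
    xy: "x \<in> carrier (cover SU_group)" "cover_proj x = mat 1" "s = - 2 * c * cover_arg (cover_incl x)"
      "y \<in> carrier (cover SU_group)" "cover_proj y = mat 1" "t = - 2 * c * cover_arg (cover_incl y)"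
    by (auto simp: period_def)
  then show ?thesis using cover_arg_ker[OF xy(4,1), of c] by (simp add: algebra_simps)
qed

lemma period_minus: "t \<in> period TYPE('m::finite) c \<Longrightarrow> - t \<in> period TYPE('m) c"
  using period_diff[OF period_zero] by fastforce

lemma period_add: "s \<in> period TYPE('m::finite) c \<Longrightarrow> t \<in> period TYPE('m) c \<Longrightarrow> s + t \<in> period TYPE('m) c"
  using period_diff[of s c "- t"] period_minus by fastforce

text \<open>An element of both images acts on w once linearly and once by a translation, so both are
  trivial; the value of \<phi> at a base point gives the period. The converse is
  \<open>act_shift\<close>.\<close>

lemma F'_eq: "(F' c :: ('m::finite pt \<Rightarrow> 'm pt) set) =
    (\<lambda>t. beta c (\<one>\<^bsub>cover U_group\<^esub>, (0, t))) ` period TYPE('m) c"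
proof (intro subset_antisym subsetI)
  fix f :: "'m pt \<Rightarrow> 'm pt" assume "f \<in> F' c"
  then obtain x h where x: "x \<in> carrier (cover SU_group)"
    and fx: "f = beta' c (x, (0, 0))" and fh: "f = beta c (\<one>\<^bsub>cover U_group\<^esub>, h)"
    by (auto simp: F'_def U'_img_def H_img_def)
  have eq: "act c (cover_proj x) (cover_arg (cover_incl x)) (0, 0) p = act c (mat 1) 0 h p + (0, 0, 0, 0)" if "p \<in> Nbar" for p
    using fun_cong[OF trans[OF fx[symmetric] fh], of p] that by (simp add: beta'_act x beta_heis zero_prod_def[symmetric])
  from act_determines[OF eq] have g: "cover_proj x = mat 1" and v: "fst h = 0" by auto
  have "snd h = - 2 * c * cover_arg (cover_incl x)"
    using arg_cong[OF eq[of "(0, 0, 0, 1)"], of "\<lambda>p. fst (snd (snd p))"]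
    by (simp add: mem_Nbar act_def g v heis_form_simps)
  then have "h = (0, - 2 * c * cover_arg (cover_incl x))" using v by (metis prod.collapse)
  then show "f \<in> (\<lambda>t. beta c (\<one>\<^bsub>cover U_group\<^esub>, (0, t))) ` period TYPE('m) c"
    using fh period_ker[OF x g] by auto
next
  fix f :: "'m pt \<Rightarrow> 'm pt" assume "f \<in> (\<lambda>t. beta c (\<one>\<^bsub>cover U_group\<^esub>, (0, t))) ` period TYPE('m) c"
  then obtain x :: "(real \<Rightarrow> 'm mat) set" where x: "x \<in> carrier (cover SU_group)" "cover_proj x = mat 1"
    and f: "f = beta c (\<one>\<^bsub>cover U_group\<^esub>, (0, - 2 * c * cover_arg (cover_incl x)))"
    by (auto simp: period_def)
  have "act c (mat 1) 0 (0, - 2 * c * cover_arg (cover_incl x)) p = beta' c (x, (0, 0)) p" if "p \<in> Nbar" for p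
    by (simp add: beta'_act x that act_shift)
  then have "f = beta' c (x, (0, 0))"
    unfolding f beta_heis by (intro extensionalityI[of _ Nbar]) (auto simp: beta'_eq x group_act_def)
  then have "f \<in> U'_img c" using x(1) by (auto simp: U'_img_def)
  moreover have "f \<in> H_img c" unfolding f H_img_def by (intro image_eqI[OF refl]) simp
  ultimately show "f \<in> F' c" by (simp add: F'_def)
qed

lemma F'_Heis_eq: "(F'_Heis c :: 'm::finite heis set) = {0} \<times> period TYPE('m) c"
proof -
  have "h = (0, t)" if "beta c (\<one>\<^bsub>cover U_group\<^esub>, h) = beta c (\<one>\<^bsub>cover U_group\<^esub>, (0, t))" for h :: "'m heis" and t
  proof -
    have "beta c (\<one>\<^bsub>cover U_group\<^esub>, h) (0, 0, 0, 1) = beta c (\<one>\<^bsub>cover U_group\<^esub>, (0, t)) (0, 0, 0, 1)"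
      using that by simp
    then show ?thesis
      by (cases h) (simp add: beta_heis mem_Nbar act_def heis_form_simps)
  qed
  then show ?thesis by (force simp: F'_Heis_def F'_eq)
qed

text \<open>Valid for c = 0 too: there \<open>deck\<close> is trivial by definition, and the only
  period is 0 because periods carry the factor c.\<close>

lemma proj_eq:
  fixes p :: "'m::finite pt"
  assumes "p \<in> Nbar"
  shows "proj c p = (\<lambda>t. p + (0, 0, t, 0)) ` period TYPE('m) c"
proof -
  have b: "beta c (\<one>\<^bsub>cover U_group\<^esub>, (0, t)) p = p + (0, 0, t, 0)" for t
    using assms by (simp add: beta_heis act_shift)
  have orb: "{f p |f. f \<in> F' c} = (\<lambda>t. p + (0, 0, t, 0)) ` period TYPE('m) c"
  proof -
    have "{f p |f. f \<in> F' c} = (\<lambda>f. f p) ` F' c" by blast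
    then show ?thesis by (simp add: F'_eq image_image b)
  qed
  show ?thesis
  proof (cases "c = 0")
    case True
    then have "period TYPE('m) c = {0}" using period_zero[where 'm='m and c=c] by (auto simp: period_def)
    then show ?thesis
      using assms True by (simp add: proj_def deck_def orbit_def Isom_def BijGroup_def zero_prod_def[symmetric])
  next
    case False
    then show ?thesis using orb by (simp add: proj_def deck_def orbit_def)
  qed
qed

lemma proj_eq_iff:
  fixes p q :: "'m::finite pt"
  assumes "p \<in> Nbar" "q \<in> Nbar"
  shows "proj c p = proj c q \<longleftrightarrow> (\<exists>t\<in>period TYPE('m) c. p = q + (0, 0, t, 0))"
proof
  assume "proj c p = proj c q"
  moreover have "p \<in> proj c p"
    unfolding proj_eq[OF assms(1)] using period_zero[where 'm='m and c=c]
    by (intro image_eqI[of _ _ 0]) (simp_all add: zero_prod_def[symmetric])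
  ultimately show "\<exists>t\<in>period TYPE('m) c. p = q + (0, 0, t, 0)" by (auto simp: proj_eq assms)
next
  assume "\<exists>t\<in>period TYPE('m) c. p = q + (0, 0, t, 0)"
  then obtain t where t: "t \<in> period TYPE('m) c" "p = q + (0, 0, t, 0)" by blast
  have shift: "q + (0, 0, t, 0) + (0, 0, s, 0) = q + (0, 0, t + s, 0)" for s
    by (cases q) simp
  have "(\<lambda>s. t + s) ` period TYPE('m) c = period TYPE('m) c"
  proof (intro subset_antisym subsetI)
    show "s \<in> (\<lambda>s. t + s) ` period TYPE('m) c" if "s \<in> period TYPE('m) c" for s
      using period_diff[OF that t(1)] by (intro image_eqI[of _ _ "s - t"]) simp_all
  qed (use period_add[OF t(1)] in auto)
  then have "(\<lambda>s. q + (0, 0, s, 0)) ` (\<lambda>s. t + s) ` period TYPE('m) c = (\<lambda>s. q + (0, 0, s, 0)) ` period TYPE('m) c"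
    by (rule arg_cong)
  then show "proj c p = proj c q"
    unfolding proj_eq[OF assms(1)] proj_eq[OF assms(2)] unfolding t(2) shift image_image .
qed

lemma Nhat_eq: "Nhat c = proj c ` Nbar"
  by (auto simp: Nhat_def orbits_def proj_def)

subsection \<open>The descended action\<close>

lemma beta_hat'_proj:
  assumes "x \<in> carrier (cover SU_group)" "p \<in> Nbar"
  shows "beta_hat' c (x, h) (proj c p) = proj c (beta' c (x, h) p)"
proof -
  have N: "beta' c (x, h) p \<in> Nbar"
    using assms by (simp add: beta'_eq group_act_Nbar U_cover_Heis_simps cover_incl_closed)
  have "beta' c (x, h) (p + (0, 0, t, 0)) = beta' c (x, h) p + (0, 0, t, 0)" for t
    using assms by (cases h) (simp add: beta'_act Nbar_shift act_phi)
  moreover have "proj c p \<in> Nhat c" using assms(2) by (simp add: Nhat_eq)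
  then have "beta_hat' c (x, h) (proj c p) = beta' c (x, h) ` proj c p" by (simp add: beta_hat'_def)
  ultimately show ?thesis
    unfolding proj_eq[OF assms(2)] proj_eq[OF N] by (simp add: image_image)
qed

lemma beta'_Nbar: "y \<in> carrier SU_cover_Heis \<Longrightarrow> p \<in> Nbar \<Longrightarrow> beta' c y p \<in> Nbar"
  by (auto simp: SU_cover_Heis_simps beta'_eq group_act_Nbar U_cover_Heis_simps cover_incl_closed)

lemma beta'_compose:
  assumes "y \<in> carrier SU_cover_Heis" "z \<in> carrier SU_cover_Heis" "p \<in> Nbar"
  shows "beta' c (y \<otimes>\<^bsub>SU_cover_Heis\<^esub> z) p = beta' c y (beta' c z p)"
proof -
  obtain x h x' h' where yz: "y = (x, h)" "z = (x', h')"
    and x: "x \<in> carrier (cover SU_group)" "x' \<in> carrier (cover SU_group)"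
    using assms by (auto simp: SU_cover_Heis_simps)
  have xx: "x \<otimes>\<^bsub>cover SU_group\<^esub> x' \<in> carrier (cover SU_group)"
    by (rule monoid.m_closed[OF group.is_monoid[OF SU.group_cover] x])
  show ?thesis
    using assms(3) group_act_compose[of "(cover_incl x, h)" "(cover_incl x', h')" p c] x
    by (simp add: yz SU_cover_Heis_simps beta'_eq xx cover_incl_mult U_cover_Heis_simps cover_incl_closed cover_proj_incl)
qed

lemma beta'_one: "p \<in> Nbar \<Longrightarrow> beta' c \<one>\<^bsub>SU_cover_Heis\<^esub> p = p"
  by (simp add: SU_cover_Heis_simps beta'_act SU.cover_one_closed SU.cover_proj_one cover_incl_one cover_arg_one act_one)

lemma beta_hat'_apply:
  "y \<in> carrier SU_cover_Heis \<Longrightarrow> p \<in> Nbar \<Longrightarrow> beta_hat' c y (proj c p) = proj c (beta' c y p)"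
  by (auto simp: SU_cover_Heis_simps beta_hat'_proj)

lemma beta_hat'_compose:
  assumes "y \<in> carrier SU_cover_Heis" "z \<in> carrier SU_cover_Heis" "P \<in> Nhat c"
  shows "beta_hat' c (y \<otimes>\<^bsub>SU_cover_Heis\<^esub> z) P = beta_hat' c y (beta_hat' c z P)"
proof -
  have yz: "y \<otimes>\<^bsub>SU_cover_Heis\<^esub> z \<in> carrier SU_cover_Heis"
    by (rule SU_cover_Heis_closed(1)[OF assms(1,2)])
  obtain p where "p \<in> Nbar" "P = proj c p" using assms(3) by (auto simp: Nhat_eq)
  then show ?thesis using assms(1,2) yz by (simp add: beta_hat'_apply beta'_compose beta'_Nbar)
qed

lemma beta_hat'_Nhat: "y \<in> carrier SU_cover_Heis \<Longrightarrow> P \<in> Nhat c \<Longrightarrow> beta_hat' c y P \<in> Nhat c"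
  by (auto simp: Nhat_eq beta_hat'_apply beta'_Nbar)

lemma beta_hat'_one: "P \<in> Nhat c \<Longrightarrow> beta_hat' c \<one>\<^bsub>SU_cover_Heis\<^esub> P = P"
  by (auto simp: Nhat_eq beta_hat'_apply[OF SU_cover_Heis_closed(2)] beta'_one)

text \<open>The action on \<open>Nbar\<close> is a global lift and serves around every
  point.\<close>

lemma local_isometry_beta_hat':
  assumes y: "y \<in> carrier SU_cover_Heis" and F: "\<And>p. p \<in> Nbar \<Longrightarrow> F (proj c p) = beta_hat' c y (proj c p)"
  shows "local_isometry_hat c F"
  unfolding local_isometry_hat_def
proof (intro ballI exI[of _ Nbar] exI[of _ "beta' c y"] conjI)
  obtain x h where "y = (x, h)" "x \<in> carrier (cover SU_group)" using y by (auto simp: SU_cover_Heis_simps)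
  then show "smooth_on Nbar (beta' c y)" "preserves_metric_on c Nbar (beta' c y)"
    by (simp_all add: beta'_eq smooth_on_group_act preserves_metric_group_act U_cover_Heis_simps cover_incl_closed)
  show "beta' c y ` Nbar \<subseteq> Nbar" using beta'_Nbar[OF y] by blast
qed (simp_all add: open_Nbar F beta_hat'_apply y)

lemma mult_Isom_hat: "mult (Isom_hat c) = mult (BijGroup (Nhat c))" "one (Isom_hat c) = one (BijGroup (Nhat c))"
  by (simp_all add: Isom_hat_def)

lemma beta_hat'_Isom_hat:
  assumes y: "y \<in> carrier SU_cover_Heis"
  shows "beta_hat' c y \<in> Bij (Nhat c)" "beta_hat' c y \<in> carrier (Isom_hat c)"
proof -
  interpret group "SU_cover_Heis :: ((real \<Rightarrow> 'a mat) set \<times> 'a heis) monoid" by (rule group_SU_cover_Heis)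
  let ?z = "inv\<^bsub>SU_cover_Heis\<^esub> y"
  have z: "?z \<in> carrier SU_cover_Heis" using y by simp
  have yz: "beta_hat' c y (beta_hat' c ?z P) = P" "beta_hat' c ?z (beta_hat' c y P) = P" if "P \<in> Nhat c" for P
    using beta_hat'_compose[OF y z that] beta_hat'_compose[OF z y that] y that by (simp_all add: beta_hat'_one)
  have bij: "bij_betw (beta_hat' c y) (Nhat c) (Nhat c)"
    by (rule bij_betw_byWitness[where f'="beta_hat' c ?z"]) (auto simp: yz beta_hat'_Nhat y z)
  then show B: "beta_hat' c y \<in> Bij (Nhat c)" by (simp add: Bij_def beta_hat'_def)
  have "inv_into (Nhat c) (beta_hat' c y) P = beta_hat' c ?z P" if "P \<in> Nhat c" for P
    by (rule inv_into_f_eq) (use bij that in \<open>auto simp: bij_betw_def beta_hat'_Nhat z yz\<close>)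
  then have "local_isometry_hat c (inv_into (Nhat c) (beta_hat' c y))"
    by (intro local_isometry_beta_hat'[OF z]) (simp add: Nhat_eq)
  then show "beta_hat' c y \<in> carrier (Isom_hat c)"
    using B local_isometry_beta_hat'[OF y] by (simp add: Isom_hat_def)
qed

lemma beta_hat'_mult:
  assumes "y \<in> carrier SU_cover_Heis" "z \<in> carrier SU_cover_Heis"
  shows "beta_hat' c (y \<otimes>\<^bsub>SU_cover_Heis\<^esub> z) = beta_hat' c y \<otimes>\<^bsub>BijGroup (Nhat c)\<^esub> beta_hat' c z"
proof -
  have "beta_hat' c (y \<otimes>\<^bsub>SU_cover_Heis\<^esub> z) P = compose (Nhat c) (beta_hat' c y) (beta_hat' c z) P" for P
    by (cases "P \<in> Nhat c") (simp add: compose_def beta_hat'_compose assms, simp add: compose_def beta_hat'_def)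
  then show ?thesis using assms by (auto simp: BijGroup_def beta_hat'_Isom_hat)
qed

lemma beta_hat'_unit: "beta_hat' c \<one>\<^bsub>SU_cover_Heis\<^esub> = \<one>\<^bsub>BijGroup (Nhat c)\<^esub>"
proof -
  have "beta_hat' c \<one>\<^bsub>SU_cover_Heis\<^esub> P = (\<lambda>P\<in>Nhat c. P) P" for P
    by (cases "P \<in> Nhat c") (simp add: beta_hat'_one, simp add: beta_hat'_def)
  then have "beta_hat' c \<one>\<^bsub>SU_cover_Heis\<^esub> = (\<lambda>P\<in>Nhat c. P)" by (rule ext)
  then show ?thesis by (simp add: BijGroup_def)
qed

lemma subgroup_G_hat': "subgroup (G_hat' c) (Isom_hat c)"
proof -
  interpret S: group "SU_cover_Heis :: ((real \<Rightarrow> 'a mat) set \<times> 'a heis) monoid" by (rule group_SU_cover_Heis)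
  interpret B: group "BijGroup (Nhat c :: 'a pt set set)" by (rule group_BijGroup)
  \<comment> \<open>The inverse in \<open>Isom_hat c\<close> is a definite description; uniqueness
    is taken from \<open>BijGroup (Nhat c)\<close>, which has the same product and unit and a larger
    carrier.\<close>
  have inv: "inv\<^bsub>Isom_hat c\<^esub> (beta_hat' c y) = beta_hat' c (inv\<^bsub>SU_cover_Heis\<^esub> y)"
    if y: "y \<in> carrier SU_cover_Heis" for y :: "(real \<Rightarrow> 'a mat) set \<times> 'a heis"
    unfolding m_inv_def[of "Isom_hat c"] mult_Isom_hat
  proof (rule the_equality)
    have z: "inv\<^bsub>SU_cover_Heis\<^esub> y \<in> carrier SU_cover_Heis" using y by simp
    show *: "beta_hat' c (inv\<^bsub>SU_cover_Heis\<^esub> y) \<in> carrier (Isom_hat c) \<and>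
        beta_hat' c y \<otimes>\<^bsub>BijGroup (Nhat c)\<^esub> beta_hat' c (inv\<^bsub>SU_cover_Heis\<^esub> y) = \<one>\<^bsub>BijGroup (Nhat c)\<^esub> \<and>
        beta_hat' c (inv\<^bsub>SU_cover_Heis\<^esub> y) \<otimes>\<^bsub>BijGroup (Nhat c)\<^esub> beta_hat' c y = \<one>\<^bsub>BijGroup (Nhat c)\<^esub>"
      using y z by (simp add: beta_hat'_Isom_hat beta_hat'_unit flip: beta_hat'_mult)
    fix f assume f: "f \<in> carrier (Isom_hat c) \<and> beta_hat' c y \<otimes>\<^bsub>BijGroup (Nhat c)\<^esub> f = \<one>\<^bsub>BijGroup (Nhat c)\<^esub> \<and>
        f \<otimes>\<^bsub>BijGroup (Nhat c)\<^esub> beta_hat' c y = \<one>\<^bsub>BijGroup (Nhat c)\<^esub>"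
    have car: "carrier (BijGroup (Nhat c)) = Bij (Nhat c :: 'a pt set set)" by (simp add: BijGroup_def)
    have "f \<in> Bij (Nhat c)" using f by (simp add: Isom_hat_def)
    then have "inv\<^bsub>BijGroup (Nhat c)\<^esub> (beta_hat' c y) = f"
      using f y by (intro B.inv_equality) (simp_all add: car beta_hat'_Isom_hat)
    moreover have "inv\<^bsub>BijGroup (Nhat c)\<^esub> (beta_hat' c y) = beta_hat' c (inv\<^bsub>SU_cover_Heis\<^esub> y)"
      using * y z by (intro B.inv_equality) (simp_all add: car beta_hat'_Isom_hat)
    ultimately show "f = beta_hat' c (inv\<^bsub>SU_cover_Heis\<^esub> y)" by simp
  qed
  show ?thesis
  proof
    show "G_hat' c \<subseteq> carrier (Isom_hat c)" by (auto simp: G_hat'_def beta_hat'_Isom_hat)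
    show "f \<otimes>\<^bsub>Isom_hat c\<^esub> g \<in> G_hat' c" if "f \<in> G_hat' c" "g \<in> G_hat' c" for f g
    proof -
      note fg = that
      obtain y z where yz: "y \<in> carrier SU_cover_Heis" "z \<in> carrier SU_cover_Heis"
        "f = beta_hat' c y" "g = beta_hat' c z"
        using fg by (auto simp: G_hat'_def)
      have "f \<otimes>\<^bsub>Isom_hat c\<^esub> g = beta_hat' c (y \<otimes>\<^bsub>SU_cover_Heis\<^esub> z)"
        unfolding mult_Isom_hat yz(3,4) by (rule beta_hat'_mult[OF yz(1,2), symmetric])
      then show ?thesis using SU_cover_Heis_closed(1)[OF yz(1,2)] by (simp add: G_hat'_def)
    qed
    show "\<one>\<^bsub>Isom_hat c\<^esub> \<in> G_hat' c"
      unfolding G_hat'_def mult_Isom_hat beta_hat'_unit[symmetric] by (intro imageI SU_cover_Heis_closed(2))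
    show "inv\<^bsub>Isom_hat c\<^esub> f \<in> G_hat' c" if "f \<in> G_hat' c" for f :: "'a pt set \<Rightarrow> 'a pt set"
      using that by (auto simp: G_hat'_def inv intro!: imageI group.inv_closed[OF group_SU_cover_Heis])
  qed
qed

section \<open>The kernel of the descended action\<close>

lemma F'_Heis_rcos: "F'_Heis c #>\<^bsub>Heis\<^esub> (v, t) = {v} \<times> (\<lambda>s. s + t) ` period TYPE('m) c"
  for v :: "complex^('m::finite option)"
  by (auto simp: r_coset_def F'_Heis_eq heis_form_simps)

lemma F'_Heis_rcos_eq_iff:
  "F'_Heis c #>\<^bsub>Heis\<^esub> (v, t) = F'_Heis c #>\<^bsub>Heis\<^esub> (v', t') \<longleftrightarrow> v = v' \<and> t' - t \<in> period TYPE('m) c"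
  for v v' :: "complex^('m::finite option)"
proof
  assume eq: "F'_Heis c #>\<^bsub>Heis\<^esub> (v, t) = F'_Heis c #>\<^bsub>Heis\<^esub> (v', t')"
  have "(v', 0 + t') \<in> F'_Heis c #>\<^bsub>Heis\<^esub> (v', t')"
    unfolding F'_Heis_rcos using period_zero[where 'm='m and c=c] by blast
  then have "(v', 0 + t') \<in> F'_Heis c #>\<^bsub>Heis\<^esub> (v, t)" by (simp only: eq)
  then show "v = v' \<and> t' - t \<in> period TYPE('m) c" by (auto simp: F'_Heis_rcos)
next
  assume *: "v = v' \<and> t' - t \<in> period TYPE('m) c"
  have "(\<lambda>s. s + t) ` period TYPE('m) c = (\<lambda>s. s + t') ` period TYPE('m) c"
  proof (intro subset_antisym subsetI)
    show "r \<in> (\<lambda>s. s + t') ` period TYPE('m) c" if "r \<in> (\<lambda>s. s + t) ` period TYPE('m) c" for r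
      using that * period_diff[where 'm='m and c=c and t="t' - t"]
      by (auto intro!: image_eqI[of _ _ "_ - (t' - t)"])
    show "r \<in> (\<lambda>s. s + t) ` period TYPE('m) c" if "r \<in> (\<lambda>s. s + t') ` period TYPE('m) c" for r
      using that * period_add[where 'm='m and c=c and t="t' - t"]
      by (auto intro!: image_eqI[of _ _ "_ + (t' - t)"])
  qed
  then show "F'_Heis c #>\<^bsub>Heis\<^esub> (v, t) = F'_Heis c #>\<^bsub>Heis\<^esub> (v', t')"
    unfolding F'_Heis_rcos using * by simp
qed

text \<open>Equality on the quotient means equality up to a period at every point, which
  \<open>act_determines\<close> turns into equal matrices and equal v. The two lifts of the matrix
  then differ by a period by \<open>cover_arg_ker\<close>, so t and t' must as well.\<close>

lemma beta_hat'_eq_iff: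
  fixes x x' :: "(real \<Rightarrow> 'm::finite mat) set"
  assumes x: "x \<in> carrier (cover SU_group)" and x': "x' \<in> carrier (cover SU_group)"
  shows "beta_hat' c (x, h) = beta_hat' c (x', h') \<longleftrightarrow>
    cover_proj x = cover_proj x' \<and> F'_Heis c #>\<^bsub>Heis\<^esub> h = F'_Heis c #>\<^bsub>Heis\<^esub> h'"
proof -
  obtain v t v' t' where h: "h = (v, t)" "h' = (v', t')" by fastforce
  let ?\<theta> = "cover_arg (cover_incl x)" and ?\<theta>' = "cover_arg (cover_incl x')"
  have y: "(x, h) \<in> carrier SU_cover_Heis" "(x', h') \<in> carrier SU_cover_Heis"
    using x x' by (simp_all add: SU_cover_Heis_simps)
  have "beta_hat' c (x, h) = beta_hat' c (x', h') \<longleftrightarrow>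
      (\<forall>p\<in>Nbar. proj c (beta' c (x, h) p) = proj c (beta' c (x', h') p))"
  proof
    assume "beta_hat' c (x, h) = beta_hat' c (x', h')"
    then show "\<forall>p\<in>Nbar. proj c (beta' c (x, h) p) = proj c (beta' c (x', h') p)"
      by (metis beta_hat'_proj x x')
  next
    assume *: "\<forall>p\<in>Nbar. proj c (beta' c (x, h) p) = proj c (beta' c (x', h') p)"
    have "beta_hat' c (x, h) P = beta_hat' c (x', h') P" for P
    proof (cases "P \<in> Nhat c")
      case True
      then show ?thesis using * x x' by (auto simp: Nhat_eq beta_hat'_proj)
    qed (simp add: beta_hat'_def)
    then show "beta_hat' c (x, h) = beta_hat' c (x', h')" by (rule ext)
  qed
  also have "\<dots> \<longleftrightarrow> (\<forall>p\<in>Nbar. \<exists>s\<in>period TYPE('m) c.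
      act c (cover_proj x) ?\<theta> h p = act c (cover_proj x') ?\<theta>' h' p + (0, 0, s, 0))"
    using proj_eq_iff[OF beta'_Nbar[OF y(1)] beta'_Nbar[OF y(2)], of _ _ c] x x'
    by (simp add: beta'_act)
  also have "\<dots> \<longleftrightarrow> cover_proj x = cover_proj x' \<and> v = v' \<and> t' - t \<in> period TYPE('m) c"
  proof
    assume "\<forall>p\<in>Nbar. \<exists>s\<in>period TYPE('m) c.
      act c (cover_proj x) ?\<theta> h p = act c (cover_proj x') ?\<theta>' h' p + (0, 0, s, 0)"
    then obtain s where s: "\<And>p. p \<in> Nbar \<Longrightarrow> s p \<in> period TYPE('m) c"
      "\<And>p. p \<in> Nbar \<Longrightarrow> act c (cover_proj x) ?\<theta> h p = act c (cover_proj x') ?\<theta>' h' p + (0, 0, s p, 0)"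
      by metis
    from act_determines[OF s(2)] have g: "cover_proj x = cover_proj x'" and v: "v = v'"
      by (simp_all add: h)
    \<comment> \<open>With g and v equal, the two maps differ by a constant translation of \<phi>,
      so one base point decides.\<close>
    define p :: "'m pt" where "p = (0, 0, 0, 1)"
    have p: "p \<in> Nbar" by (simp add: p_def mem_Nbar)
    have "act c (cover_proj x) ?\<theta> h p = act c (cover_proj x') ?\<theta>' h' p + (0, 0, t - t' - 2 * c * (?\<theta> - ?\<theta>'), 0)"
      unfolding h g v by (rule act_change)
    then have "s p = t - t' - 2 * c * (?\<theta> - ?\<theta>')" using s(2)[OF p] by simp
    then have "t' - t = (- 2 * c * (?\<theta> - ?\<theta>')) - s p" by simp
    moreover have "- 2 * c * (?\<theta> - ?\<theta>') \<in> period TYPE('m) c"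
      by (rule cover_arg_ker[OF x' x]) (simp add: g)
    ultimately show "cover_proj x = cover_proj x' \<and> v = v' \<and> t' - t \<in> period TYPE('m) c"
      using g v period_diff s(1)[OF p] by metis
  next
    assume *: "cover_proj x = cover_proj x' \<and> v = v' \<and> t' - t \<in> period TYPE('m) c"
    have "(- 2 * c * (?\<theta> - ?\<theta>')) - (t' - t) \<in> period TYPE('m) c"
      using * by (intro period_diff[OF cover_arg_ker[OF x' x]]) auto
    moreover have "act c (cover_proj x) ?\<theta> h p =
        act c (cover_proj x') ?\<theta>' h' p + (0, 0, (- 2 * c * (?\<theta> - ?\<theta>')) - (t' - t), 0)" for p
      using * act_change[of c "cover_proj x'" ?\<theta> v' t p ?\<theta>' t'] by (simp add: h)
    ultimately show "\<forall>p\<in>Nbar. \<exists>s\<in>period TYPE('m) c.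
      act c (cover_proj x) ?\<theta> h p = act c (cover_proj x') ?\<theta>' h' p + (0, 0, s, 0)" by blast
  qed
  finally show ?thesis by (simp add: h F'_Heis_rcos_eq_iff)
qed

section \<open>The semidirect product with the quotient of the Heisenberg group\<close>

lemma normal_F'_Heis: "F'_Heis c \<lhd> (Heis :: 'm::finite heis monoid)"
proof -
  interpret group "Heis :: 'm heis monoid" by (rule group_Heis)
  have inv: "inv\<^bsub>Heis\<^esub> (v, t) = (- v, - t)" for v :: "complex^('m option)" and t
    by (rule inv_equality) (simp_all add: heis_form_simps)
  show ?thesis
    unfolding normal_inv_iff
  proof (intro conjI ballI)
    show "subgroup (F'_Heis c) (Heis :: 'm heis monoid)"
      by unfold_locales
        (auto simp: F'_Heis_eq inv heis_form_simps period_zero period_add period_minus)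
    show "x \<otimes>\<^bsub>Heis\<^esub> h \<otimes>\<^bsub>Heis\<^esub> inv\<^bsub>Heis\<^esub> x \<in> F'_Heis c" if "h \<in> F'_Heis c" for x h :: "'m heis"
      using that by (cases x) (auto simp: F'_Heis_eq inv heis_form_simps)
  qed
qed

text \<open>The matrices fix the centre of the Heisenberg group, and \<open>F'_Heis c\<close> is
  contained in it.\<close>

lemma heis_act_rcos:
  assumes "A \<in> carrier U_group"
  shows "heis_act A ` (F'_Heis c #>\<^bsub>Heis\<^esub> h) = F'_Heis c #>\<^bsub>Heis\<^esub> heis_act A h"
  by (cases h) (auto simp: F'_Heis_rcos heis_act_U[OF assms] image_iff)

lemma SU_Heis_mod_simps:
  "carrier (SU_Heis_mod c) = carrier SU_group \<times> (\<lambda>h. F'_Heis c #>\<^bsub>Heis\<^esub> h) ` UNIV"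
  "A \<in> carrier SU_group \<Longrightarrow> (A, F'_Heis c #>\<^bsub>Heis\<^esub> h) \<otimes>\<^bsub>SU_Heis_mod c\<^esub> (B, F'_Heis c #>\<^bsub>Heis\<^esub> k) =
    (A ** B, F'_Heis c #>\<^bsub>Heis\<^esub> (h \<otimes>\<^bsub>Heis\<^esub> heis_act A k))"
proof -
  show "carrier (SU_Heis_mod c) = carrier SU_group \<times> (\<lambda>h. F'_Heis c #>\<^bsub>Heis\<^esub> h) ` UNIV"
    by (auto simp: SU_Heis_mod_def semidirect_def FactGroup_def RCOSETS_def)
  show "(A, F'_Heis c #>\<^bsub>Heis\<^esub> h) \<otimes>\<^bsub>SU_Heis_mod c\<^esub> (B, F'_Heis c #>\<^bsub>Heis\<^esub> k) =
    (A ** B, F'_Heis c #>\<^bsub>Heis\<^esub> (h \<otimes>\<^bsub>Heis\<^esub> heis_act A k))" if "A \<in> carrier SU_group"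
    using that SU.carrier_subset normal.rcos_sum[OF normal_F'_Heis, of h "heis_act A k" c]
    by (auto simp: SU_Heis_mod_def semidirect_def FactGroup_def heis_act_rcos)
qed

lemma group_SU_Heis_mod: "group (SU_Heis_mod c :: ('m::finite mat \<times> 'm heis set) monoid)"
  unfolding SU_Heis_mod_def
proof (rule group_semidirect[OF SU.group_G normal.factorgroup_is_group[OF normal_F'_Heis]])
  have car: "carrier (Heis Mod F'_Heis c) = (\<lambda>h. F'_Heis c #>\<^bsub>Heis\<^esub> h) ` (UNIV :: 'm heis set)"
    by (auto simp: FactGroup_def RCOSETS_def)
  have mult: "(F'_Heis c #>\<^bsub>Heis\<^esub> h) \<otimes>\<^bsub>Heis Mod F'_Heis c\<^esub> (F'_Heis c #>\<^bsub>Heis\<^esub> k) = F'_Heis c #>\<^bsub>Heis\<^esub> (h \<otimes>\<^bsub>Heis\<^esub> k)"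
    for h k :: "'m heis"
    using normal.rcos_sum[OF normal_F'_Heis, of h k c] by (simp add: FactGroup_def)
  have U: "A \<in> carrier U_group" if "A \<in> carrier SU_group" for A :: "'m mat"
    using that SU.carrier_subset by blast
  show "heis_act A ` K \<in> carrier (Heis Mod F'_Heis c)"
    if "A \<in> carrier SU_group" "K \<in> carrier (Heis Mod F'_Heis c)" for A :: "'m mat" and K
    using that by (auto simp: car heis_act_rcos U)
  show "heis_act A ` (K \<otimes>\<^bsub>Heis Mod F'_Heis c\<^esub> L) = heis_act A ` K \<otimes>\<^bsub>Heis Mod F'_Heis c\<^esub> heis_act A ` L"
    if "A \<in> carrier SU_group" "K \<in> carrier (Heis Mod F'_Heis c)" "L \<in> carrier (Heis Mod F'_Heis c)" for A :: "'m mat" and K L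
  proof -
    note KL = that
    obtain h k where "K = F'_Heis c #>\<^bsub>Heis\<^esub> h" "L = F'_Heis c #>\<^bsub>Heis\<^esub> k" using KL(2,3) unfolding car by blast
    then show ?thesis using KL(1) by (simp only: mult heis_act_rcos U heis_act_mult)
  qed
  show "heis_act (A \<otimes>\<^bsub>SU_group\<^esub> B) ` K = heis_act A ` (heis_act B ` K)"
    if "A \<in> carrier SU_group" "B \<in> carrier SU_group" for A B :: "'m mat" and K
    using that by (simp add: image_image heis_act_compose U)
  show "heis_act \<one>\<^bsub>SU_group\<^esub> ` K = K" for K :: "'m heis set"
    by (simp add: heis_act_one)
qed

text \<open>The clause on \<open>cover_proj x\<close> and cosets ties the isomorphism to the given
  action: such pairs exhaust the carrier, so it determines \<Phi> there.\<close>

theorem theorem3p15: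
  fixes c :: real
  assumes "c \<ge> 0"
  shows "subgroup (G_hat' c) (Isom_hat c :: ('m::finite pt set \<Rightarrow> 'm pt set) monoid) \<and>
    (\<exists>\<Phi> :: 'm mat \<times> 'm heis set \<Rightarrow> 'm pt set \<Rightarrow> 'm pt set.
       \<Phi> \<in> iso (SU_Heis_mod c) (Isom_hat c \<lparr>carrier := G_hat' c\<rparr>) \<and>
       (\<forall>x \<in> carrier (cover SU_group). \<forall>h \<in> carrier Heis.
          \<Phi> (cover_proj x, F'_Heis c #>\<^bsub>Heis\<^esub> h) = beta_hat' c (x, h)) \<and>
       faithful_action (SU_Heis_mod c) (Nhat c) \<Phi> \<and>
       (\<forall>y \<in> carrier (SU_Heis_mod c). \<Phi> y \<in> carrier (Isom_hat c)))"
proof -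
  define \<Psi> :: "(real \<Rightarrow> 'm mat) set \<times> 'm heis \<Rightarrow> 'm mat \<times> 'm heis set"
    where "\<Psi> y = (cover_proj (fst y), F'_Heis c #>\<^bsub>Heis\<^esub> snd y)" for y
  \<comment> \<open>A preimage under \<Psi> is chosen; by \<open>eq_iff\<close> the value does not
    depend on the choice.\<close>
  define \<Phi> where "\<Phi> z = beta_hat' c (SOME y. y \<in> carrier SU_cover_Heis \<and> \<Psi> y = z)" for z
  interpret S: group "SU_cover_Heis :: ((real \<Rightarrow> 'm mat) set \<times> 'm heis) monoid" by (rule group_SU_cover_Heis)
  have eq_iff: "beta_hat' c y = beta_hat' c y' \<longleftrightarrow> \<Psi> y = \<Psi> y'"
    if "y \<in> carrier SU_cover_Heis" "y' \<in> carrier SU_cover_Heis" for y y'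
    using that by (cases y; cases y') (simp add: SU_cover_Heis_simps \<Psi>_def beta_hat'_eq_iff)
  have \<Phi>\<Psi>: "\<Phi> (\<Psi> y) = beta_hat' c y" if y: "y \<in> carrier SU_cover_Heis" for y
    unfolding \<Phi>_def by (rule someI2[of _ y]) (use y eq_iff in auto)
  have surj: "\<exists>y\<in>carrier SU_cover_Heis. z = \<Psi> y" if z: "z \<in> carrier (SU_Heis_mod c)" for z
  proof -
    obtain A h where A: "A \<in> carrier SU_group" "z = (A, F'_Heis c #>\<^bsub>Heis\<^esub> h)"
      using z by (auto simp: SU_Heis_mod_simps)
    obtain \<gamma> where \<gamma>: "SU.based \<gamma>" "\<gamma> 1 = A" using SU_connected[OF A(1)] by blast
    show ?thesis
      using SU.path_class_in_cover[OF \<gamma>(1)] SU.cover_proj_path_class[OF \<gamma>(1)] \<gamma>(2)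
      by (intro bexI[of _ "(path_class SU_group \<gamma>, h)"]) (auto simp: \<Psi>_def SU_cover_Heis_simps A(2))
  qed
  have \<Psi>_closed: "\<Psi> y \<in> carrier (SU_Heis_mod c)" if "y \<in> carrier SU_cover_Heis" for y
    using that by (auto simp: \<Psi>_def SU_Heis_mod_simps SU_cover_Heis_simps SU.cover_proj_closed)
  have \<Psi>_mult: "\<Psi> (y \<otimes>\<^bsub>SU_cover_Heis\<^esub> y') = \<Psi> y \<otimes>\<^bsub>SU_Heis_mod c\<^esub> \<Psi> y'"
    if "y \<in> carrier SU_cover_Heis" "y' \<in> carrier SU_cover_Heis" for y y'
    using that by (cases y; cases y')
      (simp add: \<Psi>_def SU_cover_Heis_simps SU_Heis_mod_simps(2) SU.cover_proj_closed SU.cover_proj_mult)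
  have mult: "\<Phi> (z \<otimes>\<^bsub>SU_Heis_mod c\<^esub> z') = \<Phi> z \<otimes>\<^bsub>BijGroup (Nhat c)\<^esub> \<Phi> z'"
    if "z \<in> carrier (SU_Heis_mod c)" "z' \<in> carrier (SU_Heis_mod c)" for z z'
  proof -
    from surj[OF that(1)] surj[OF that(2)]
    obtain y y' where y: "y \<in> carrier SU_cover_Heis" "z = \<Psi> y" "y' \<in> carrier SU_cover_Heis" "z' = \<Psi> y'"
      by blast
    then show ?thesis by (simp add: \<Phi>\<Psi> beta_hat'_mult flip: \<Psi>_mult)
  qed
  have image: "\<Phi> ` carrier (SU_Heis_mod c) = G_hat' c"
  proof -
    have "carrier (SU_Heis_mod c) = \<Psi> ` carrier SU_cover_Heis" using surj \<Psi>_closed by blast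
    then show ?thesis by (simp add: G_hat'_def image_image \<Phi>\<Psi> cong: image_cong)
  qed
  have inj: "inj_on \<Phi> (carrier (SU_Heis_mod c))"
  proof (rule inj_onI)
    fix z z' assume "z \<in> carrier (SU_Heis_mod c)" "z' \<in> carrier (SU_Heis_mod c)" and eq: "\<Phi> z = \<Phi> z'"
    then obtain y y' where y: "y \<in> carrier SU_cover_Heis" "z = \<Psi> y" "y' \<in> carrier SU_cover_Heis" "z' = \<Psi> y'"
      using surj by meson
    then show "z = z'" using eq eq_iff by (simp add: \<Phi>\<Psi>)
  qed
  have G: "G_hat' c \<subseteq> carrier (Isom_hat c :: ('m pt set \<Rightarrow> 'm pt set) monoid)"
    by (rule subgroup.subset[OF subgroup_G_hat'])
  have closed: "\<Phi> z \<in> carrier (Isom_hat c)" if "z \<in> carrier (SU_Heis_mod c)" for z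
    using that image G by blast
  have "\<Phi> \<in> iso (SU_Heis_mod c) (Isom_hat c \<lparr>carrier := G_hat' c\<rparr>)"
    using image inj by (auto simp: iso_def hom_def bij_betw_def mult mult_Isom_hat)
  moreover have "\<forall>x \<in> carrier (cover SU_group). \<forall>h \<in> carrier Heis.
      \<Phi> (cover_proj x, F'_Heis c #>\<^bsub>Heis\<^esub> h) = beta_hat' c (x, h)"
  proof (intro ballI)
    fix x :: "(real \<Rightarrow> 'm mat) set" and h :: "'m heis"
    assume "x \<in> carrier (cover SU_group)"
    then show "\<Phi> (cover_proj x, F'_Heis c #>\<^bsub>Heis\<^esub> h) = beta_hat' c (x, h)"
      using \<Phi>\<Psi>[of "(x, h)"] by (simp add: \<Psi>_def SU_cover_Heis_simps)
  qed
  moreover have "faithful_action (SU_Heis_mod c) (Nhat c) \<Phi>"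
  proof -
    have "\<Phi> \<in> hom (SU_Heis_mod c) (BijGroup (Nhat c))"
      using closed by (auto simp: hom_def mult) (auto simp: Isom_hat_def BijGroup_def)
    then show ?thesis
      unfolding faithful_action_def group_action_def group_hom_def group_hom_axioms_def faithful_action_axioms_def
      using inj group_SU_Heis_mod group_BijGroup by blast
  qed
  ultimately show ?thesis using subgroup_G_hat' closed by blast
qed

end
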